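(* Let $2<p<\infty$, and let $\mu$ be a positive Borel measure on $\mathbb{D}$. If $$\sup_{I\subset\mathbb{T}}\frac{\mu\left(S(I)\right)}{|I|\left(\log\frac{e}{|I|}\right)^{-p/2+1}}<\infty,$$ where the supremum is over all arcs $I\subset\mathbb{T}$, then $\mu$ is a $p$-Carleson measure for $\mathcal{D}^p_{p-1}$.
   Context: $\mathbb{D}=\{z\in\mathbb{C}:|z|<1\}$, $\mathbb{T}=\partial\mathbb{D}$, and $dA(z)=\frac{dx\,dy}{\pi}$. The Dirichlet-type space $\mathcal{D}^p_{p-1}$ consists of analytic functions $f$ in $\mathbb{D}$ with $\|f\|_{\mathcal{D}^p_{p-1}}^p=\int_{\mathbb{D}}|f'(z)|^p(1-|z|^2)^{p-1}\,dA(z)+|f(0)|^p<\infty$. For an arc (interval) $I\subset\mathbb{T}$, $|I|$ is its normalized Lebesgue measure ($|\mathbb{T}|=1$), and the Carleson square is $S(I)=\{re^{it}:e^{it}\in I,\ 1-|I|\le r<1\}$. A positive Borel measure $\mu$ on $\mathbb{D}$ is a $p$-Carleson measure for $\mathcal{D}^p_{p-1}$ if the identity operator $\mathcal{D}^p_{p-1}\to L^p(\mu)$ is bounded, i.e. there is $C>0$ such that $\int_{\mathbb{D}}|f|^p\,d\mu\le C\|f\|_{\mathcal{D}^p_{p-1}}^p$ for all $f\in\mathcal{D}^p_{p-1}$. *)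

theory Defs
  imports "HOL-Analysis.Analysis"
begin

abbreviation unit_disc :: "complex set" where
  "unit_disc \<equiv> ball 0 1"

definition area_measure :: "complex measure" where
  "area_measure = scale_measure (ennreal (1 / pi)) lborel"

text \<open>The \<open>p\<close>-th power of the norm, with values in \<^typ>\<open>ennreal\<close>; it is \<open>\<infinity>\<close> off the space.\<close>

definition dirichlet_norm_powr :: "real \<Rightarrow> (complex \<Rightarrow> complex) \<Rightarrow> ennreal" where
  "dirichlet_norm_powr p f =
     (\<integral>\<^sup>+ z \<in> unit_disc.
        ennreal (norm (deriv f z) powr p * (1 - (norm z)\<^sup>2) powr (p - 1)) \<partial>area_measure)
     + ennreal (norm (f 0) powr p)"

text \<open>Elements are total functions on \<^typ>\<open>complex\<close>; their values outside the disc are irrelevant.\<close>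

definition dirichlet_space :: "real \<Rightarrow> (complex \<Rightarrow> complex) set" where
  "dirichlet_space p = {f. f holomorphic_on unit_disc \<and> dirichlet_norm_powr p f < \<infinity>}"

definition borel_measure_on_disc :: "complex measure \<Rightarrow> bool" where
  "borel_measure_on_disc \<mu> \<longleftrightarrow> sets \<mu> = sets (restrict_space borel unit_disc)"

definition arc_length :: "complex set \<Rightarrow> real" where
  "arc_length I = measure lborel {t \<in> {0..<2 * pi}. cis t \<in> I} / (2 * pi)"

text \<open>
  Arcs may be open, closed or half-open, and the whole circle is an arc (its Carleson square
  is the disc).  Arcs of length zero are excluded, since they would give a quotient \<open>0 / 0\<close>.
\<close>

definition circle_arc :: "complex set \<Rightarrow> bool" where
  "circle_arc I \<longleftrightarrow> (\<exists>J :: real set. is_interval J \<and> I = cis ` J) \<and> 0 < arc_length I"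

definition carleson_square :: "complex set \<Rightarrow> complex set" where
  "carleson_square I =
     {of_real r * cis t | r t. cis t \<in> I \<and> 1 - arc_length I \<le> r \<and> r < 1}"

definition p_carleson_measure :: "real \<Rightarrow> complex measure \<Rightarrow> bool" where
  "p_carleson_measure p \<mu> \<longleftrightarrow>
     (\<exists>C :: real. 0 < C \<and>
        (\<forall>f \<in> dirichlet_space p.
           (\<integral>\<^sup>+ z. ennreal (norm (f z) powr p) \<partial>\<mu>) \<le> ennreal C * dirichlet_norm_powr p f))"

end

theory Submission
  imports Defs "HOL-Complex_Analysis.Complex_Analysis"
begin

text \<open>
  Put \<open>q = p / 2\<close>, \<open>a = q - 1\<close>, and cut the disc into the shells on which \<open>1 - |z|\<close> lies
  between \<open>exp (1 - 2 ^ (k + 1))\<close> and \<open>exp (1 - 2 ^ k)\<close>.  The logarithmic weight is constant on a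
  shell up to a factor, so there the hypothesis reads: \<open>2 ^ (k * a) * \<mu>\<close> satisfies the classical
  Carleson condition, mass of a box at most a constant times its side.  This reduces the theorem to
  two facts, one about measures and one about functions.

  The first is the embedding theorem of Carleson, applied on the circle of a radius \<open>R k\<close> that
  is slightly larger than the moduli in the \<open>k\<close>-th shell
  (\<open>carleson_embedding_circle\<close>, \<open>shell_embedding\<close>).  The value of \<open>f\<close> at a point of the shell is a
  Poisson average of its values on the circle; a large value forces a large average over some
  interval, a Vitali selection among these intervals gives a weak type bound, and integrating over
  the levels gives that the integral of \<open>|f| powr p\<close> over the shell is at most a constant times
  \<open>2 ^ (- k * a) * u (R k)\<close>, where \<open>u r\<close> is the integral of \<open>|f| powr p\<close> over the circle of
  radius \<open>r\<close>.

  The second is the growth estimate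
  \<open>u r powr (1 / q) \<le> u 0 powr (1 / q) + 4 * q\<^sup>2 * (integral of (1 - s) * v s powr (1 / q) over {0..r})\<close>,
  where \<open>v\<close> is the same mean for \<open>f'\<close> (\<open>circle_integral_smooth_power_growth\<close>).  It comes from
  \<open>(r * u')' = r * m\<close>, \<open>m\<close> being the circle integral of the Laplacian
  \<open>p\<^sup>2 * |f| powr (p - 2) * |f'|\<^sup>2\<close>, which Hoelder's inequality bounds by
  \<open>p\<^sup>2 * u powr (1 - 1 / q) * v powr (1 / q)\<close>.  In the variable \<open>log (1 / (1 - s))\<close> the
  sum of the terms \<open>2 ^ (- k * a) * u (R k)\<close> is then controlled by Hardy's inequality with the exponent
  \<open>q > 1\<close> (\<open>dyadic_log_means_le\<close>), and the right-hand side is the integral of \<open>|f'| powr p\<close> against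
  \<open>(1 - |z|) powr (p - 1)\<close> in polar coordinates (\<open>nn_integral_polar_le\<close>).

  The second derivatives of \<open>|f| powr p\<close> matter at this endpoint: Hoelder's inequality applied to
  the first derivative \<open>|f| powr (p - 1) * |f'|\<close> would lose a power of the logarithm.
\<close>

section \<open>Growth of circle means\<close>

text \<open>
  For \<open>q = p / 2\<close> this is a regularisation of \<open>|f| powr p\<close>: it is smooth at the zeros of \<open>f\<close> and
  positive everywhere.  The parameter \<open>e\<close> tends to \<open>0\<close> only at the very end.
\<close>

definition smooth_power :: "real \<Rightarrow> real \<Rightarrow> (complex \<Rightarrow> complex) \<Rightarrow> complex \<Rightarrow> real" where
  "smooth_power e q f z = (e + (norm (f z))\<^sup>2) powr q"

definition circle_integral :: "(complex \<Rightarrow> real) \<Rightarrow> real \<Rightarrow> real" where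
  "circle_integral G r = integral {0..2 * pi} (\<lambda>t. G (of_real r * cis t))"

lemma DERIV_smooth_power_comp:
  fixes h :: "real \<Rightarrow> complex"
  assumes h: "(h has_vector_derivative h') (at x)" and e: "0 < e"
  shows "((\<lambda>x. (e + (norm (h x))\<^sup>2) powr c) has_real_derivative
           2 * c * (e + (norm (h x))\<^sup>2) powr (c - 1) * Re (cnj (h x) * h')) (at x)"
proof -
  have pos: "0 < e + (norm (h x))\<^sup>2"
    using e by (simp add: add_pos_nonneg)
  have "((\<lambda>x. Re (h x)) has_real_derivative Re h') (at x)" "((\<lambda>x. Im (h x)) has_real_derivative Im h') (at x)"
    using bounded_linear.has_vector_derivative[OF bounded_linear_Re h]
      bounded_linear.has_vector_derivative[OF bounded_linear_Im h]
    by (auto simp: has_real_derivative_iff_has_vector_derivative)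
  then have "((\<lambda>x. e + ((Re (h x))\<^sup>2 + (Im (h x))\<^sup>2)) has_real_derivative 2 * Re (cnj (h x) * h')) (at x)"
    by - (assumption | rule derivative_eq_intros | simp add: algebra_simps)+
  then have d: "((\<lambda>x. e + (norm (h x))\<^sup>2) has_real_derivative 2 * Re (cnj (h x) * h')) (at x)"
    by (simp add: cmod_power2)
  show ?thesis
    by (rule DERIV_cong[OF DERIV_fun_powr[OF d pos]]) simp
qed

lemma has_vector_derivative_Re_cnj_mult:
  fixes h k :: "real \<Rightarrow> complex"
  assumes "(h has_vector_derivative h') (at x)" "(k has_vector_derivative k') (at x)"
  shows "((\<lambda>x. Re (cnj (h x) * k x)) has_real_derivative Re (cnj (h x) * k') + Re (cnj h' * k x)) (at x)"
proof -
  have "((\<lambda>x. cnj (h x) * k x) has_vector_derivative cnj (h x) * k' + cnj h' * k x) (at x)"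
    by (intro has_vector_derivative_mult assms(2) bounded_linear.has_vector_derivative[OF bounded_linear_cnj assms(1)])
  from bounded_linear.has_vector_derivative[OF bounded_linear_Re this]
  show ?thesis
    by (simp add: has_real_derivative_iff_has_vector_derivative)
qed

lemma ray_vector_derivative:
  assumes "f holomorphic_on ball 0 1" "\<bar>r\<bar> < 1"
  shows "((\<lambda>r. f (of_real r * cis t)) has_vector_derivative cis t * deriv f (of_real r * cis t)) (at r)"
proof -
  have "((\<lambda>r. of_real r * cis t) has_vector_derivative cis t) (at r)"
    by (auto intro!: derivative_eq_intros simp: has_vector_derivative_def scaleR_conv_of_real fun_eq_iff)
  moreover have "(f has_field_derivative deriv f (of_real r * cis t)) (at (of_real r * cis t))"
    using assms by (intro holomorphic_derivI[of f "ball 0 1"]) (auto simp: norm_mult)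
  ultimately show ?thesis
    by (rule field_vector_diff_chain_at[unfolded o_def])
qed

lemma circle_vector_derivative:
  assumes "f holomorphic_on ball 0 1" "\<bar>r\<bar> < 1"
  shows "((\<lambda>t. f (of_real r * cis t)) has_vector_derivative
            \<i> * (of_real r * cis t) * deriv f (of_real r * cis t)) (at t)"
proof -
  have "((\<lambda>t. of_real r * cis t) has_vector_derivative \<i> * (of_real r * cis t)) (at t)"
    by (auto intro!: derivative_eq_intros simp: has_vector_derivative_def scaleR_conv_of_real fun_eq_iff)
  moreover have "(f has_field_derivative deriv f (of_real r * cis t)) (at (of_real r * cis t))"
    using assms by (intro holomorphic_derivI[of f "ball 0 1"]) (auto simp: norm_mult)
  ultimately show ?thesis
    by (rule field_vector_diff_chain_at[unfolded o_def])
qed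

lemma continuous_on_polar:
  assumes "continuous_on (ball 0 1) (G :: complex \<Rightarrow> 'b::topological_space)"
  shows "continuous_on ({-1<..<1} \<times> T) (\<lambda>(r, t). G (of_real r * cis t))"
  unfolding case_prod_beta
  by (rule continuous_on_compose2[OF assms]) (auto intro!: continuous_intros simp: norm_mult)

lemma continuous_on_circle:
  assumes "continuous_on (ball 0 1) (G :: complex \<Rightarrow> 'b::topological_space)" "\<bar>r\<bar> < 1"
  shows "continuous_on T (\<lambda>t. G (of_real r * cis t))"
  by (rule continuous_on_compose2[OF assms(1)]) (use assms(2) in \<open>auto intro!: continuous_intros simp: norm_mult\<close>)

lemma circle_integral_continuous:
  assumes "continuous_on (ball 0 1) G"
  shows "continuous_on {-1<..<1} (circle_integral G)"
proof -
  have "continuous_on {-1<..<1} (\<lambda>r. integral (cbox 0 (2*pi)) (\<lambda>t. G (of_real r * cis t)))"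
    by (rule integral_continuous_on_param) (use continuous_on_polar[OF assms] in \<open>simp\<close>)
  then show ?thesis
    by (simp add: circle_integral_def[abs_def])
qed

lemma continuous_on_smooth_power:
  assumes "f holomorphic_on ball 0 1" "0 < e"
  shows "continuous_on (ball 0 1) (smooth_power e q f)"
  unfolding smooth_power_def[abs_def]
  using assms by (intro continuous_intros holomorphic_on_imp_continuous_on) (auto simp: add_pos_nonneg add_nonneg_eq_0_iff)

lemma smooth_power_pos: "0 < e \<Longrightarrow> 0 < smooth_power e q f z"
  by (simp add: smooth_power_def add_pos_nonneg add_nonneg_eq_0_iff)

lemma integral_Icc_pos:
  fixes h :: "real \<Rightarrow> real"
  assumes h: "continuous_on {a..b} h" "\<And>x. x \<in> {a..b} \<Longrightarrow> 0 < h x" and ab: "a < b"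
  shows "0 < integral {a..b} h"
proof -
  obtain x where x: "x \<in> {a..b}" "\<And>y. y \<in> {a..b} \<Longrightarrow> h x \<le> h y"
    using continuous_attains_inf[OF compact_Icc _ h(1)] ab by fastforce
  have "integral {a..b} (\<lambda>_. h x) \<le> integral {a..b} h"
    by (intro integral_le integrable_continuous_real continuous_intros h x)
  moreover have "0 < integral {a..b} (\<lambda>_. h x)" using ab h(2)[OF x(1)] by simp
  ultimately show ?thesis by linarith
qed

lemma DERIV_circle_integral:
  assumes d: "\<And>r t. r \<in> U \<Longrightarrow> t \<in> {0..2*pi} \<Longrightarrow> ((\<lambda>r. g r t) has_real_derivative g' r t) (at r)"
    and c: "\<And>r. r \<in> U \<Longrightarrow> continuous_on {0..2*pi} (g r)"
    and c': "continuous_on (U \<times> {0..2*pi}) (\<lambda>(r, t). g' r t)"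
    and U: "r0 \<in> U" "convex U" "open U"
  shows "((\<lambda>r. integral {0..2*pi} (g r)) has_real_derivative integral {0..2*pi} (g' r0)) (at r0)"
proof -
  have "((\<lambda>r. integral (cbox 0 (2*pi)) (g r)) has_real_derivative integral (cbox 0 (2*pi)) (g' r0)) (at r0 within U)"
  proof (rule leibniz_rule_field_derivative)
    show "((\<lambda>r. g r t) has_real_derivative g' r t) (at r within U)" if "r \<in> U" "t \<in> cbox 0 (2*pi)" for r t
      using d[of r t] that by (simp add: has_field_derivative_at_within)
    show "g r integrable_on cbox 0 (2*pi)" if "r \<in> U" for r
      using integrable_continuous_real[OF c[OF that]] by simp
    show "continuous_on (U \<times> cbox 0 (2*pi)) (\<lambda>(r, t). g' r t)"
      using c' by simp
  qed (rule U)+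
  then show ?thesis
    using at_within_open[OF U(1,3)] by simp
qed

text \<open>
  The Laplacian of \<^const>\<open>smooth_power\<close>.
\<close>

definition smooth_laplacian :: "real \<Rightarrow> real \<Rightarrow> (complex \<Rightarrow> complex) \<Rightarrow> complex \<Rightarrow> real" where
  "smooth_laplacian e q f z = 4 * q * smooth_power e (q - 1) f z * (norm (deriv f z))\<^sup>2
     + 4 * q * (q - 1) * smooth_power e (q - 2) f z * (norm (f z))\<^sup>2 * (norm (deriv f z))\<^sup>2"

text \<open>
  At \<open>z = r cis t\<close> this is \<open>r\<close> times the derivative in \<open>r\<close> of \<^const>\<open>smooth_power\<close>.
\<close>

definition radial_flux :: "real \<Rightarrow> real \<Rightarrow> (complex \<Rightarrow> complex) \<Rightarrow> complex \<Rightarrow> real" where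
  "radial_flux e q f z = 2 * q * smooth_power e (q - 1) f z * Re (cnj (f z) * (z * deriv f z))"

text \<open>
  The lower bound makes the circle means increase.  The upper bound is a product of a power of
  \<open>smooth_power e q f\<close> and a power of \<open>smooth_power e q (deriv f)\<close>, ready for Hoelder's inequality.
\<close>

lemma smooth_laplacian_bounds:
  assumes "1 \<le> q" "0 < e"
  shows "0 \<le> smooth_laplacian e q f z"
    "smooth_laplacian e q f z \<le> 4 * q\<^sup>2 * (smooth_power e (q - 1) f z * smooth_power e 1 (deriv f) z)"
proof -
  let ?Q = "e + (norm (f z))\<^sup>2" and ?d = "(norm (deriv f z))\<^sup>2"
  have Q: "0 < ?Q" using assms by (simp add: add_pos_nonneg)
  show "0 \<le> smooth_laplacian e q f z"
    using assms by (auto simp: smooth_laplacian_def smooth_power_def intro!: add_nonneg_nonneg mult_nonneg_nonneg)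
  have "smooth_power e (q - 2) f z * (norm (f z))\<^sup>2 \<le> ?Q powr (q - 2) * ?Q"
    unfolding smooth_power_def using assms by (intro mult_left_mono) auto
  also have "\<dots> = ?Q powr (q - 1)"
    using Q powr_add[of ?Q "q - 2" 1] by simp
  finally have 1: "smooth_power e (q - 2) f z * (norm (f z))\<^sup>2 \<le> ?Q powr (q - 1)" .
  have "smooth_laplacian e q f z =
      4 * q * ?Q powr (q - 1) * ?d + 4 * q * (q - 1) * ?d * (smooth_power e (q - 2) f z * (norm (f z))\<^sup>2)"
    by (simp add: smooth_laplacian_def smooth_power_def)
  also have "\<dots> \<le> 4 * q * ?Q powr (q - 1) * ?d + 4 * q * (q - 1) * ?d * ?Q powr (q - 1)"
    using assms by (intro add_left_mono mult_left_mono 1) auto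
  also have "\<dots> = 4 * q\<^sup>2 * (?Q powr (q - 1) * ?d)"
    by (simp add: algebra_simps power2_eq_square)
  also have "\<dots> \<le> 4 * q\<^sup>2 * (?Q powr (q - 1) * (e + ?d))"
    using assms by (intro mult_left_mono) auto
  also have "\<dots> = 4 * q\<^sup>2 * (smooth_power e (q - 1) f z * smooth_power e 1 (deriv f) z)"
    using assms by (simp add: smooth_power_def add_nonneg_nonneg)
  finally show "smooth_laplacian e q f z \<le> 4 * q\<^sup>2 * (smooth_power e (q - 1) f z * smooth_power e 1 (deriv f) z)" .
qed

lemma continuous_on_radial_flux:
  assumes "f holomorphic_on ball 0 1" "0 < e"
  shows "continuous_on (ball 0 1) (radial_flux e q f)"
  unfolding radial_flux_def[abs_def]
  using assms by (intro continuous_intros continuous_on_smooth_power holomorphic_on_imp_continuous_on holomorphic_deriv) auto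

lemma continuous_on_smooth_laplacian:
  assumes "f holomorphic_on ball 0 1" "0 < e"
  shows "continuous_on (ball 0 1) (smooth_laplacian e q f)"
  unfolding smooth_laplacian_def[abs_def]
  using assms by (intro continuous_intros continuous_on_smooth_power holomorphic_on_imp_continuous_on holomorphic_deriv) auto

lemma circle_integral_smooth_power_deriv:
  assumes f: "f holomorphic_on ball 0 1" and e: "0 < e" and r: "0 < r" "r < 1"
  shows "(circle_integral (smooth_power e q f) has_real_derivative circle_integral (radial_flux e q f) r / r) (at r)"
proof -
  let ?g' = "\<lambda>r t. 2 * q * smooth_power e (q - 1) f (of_real r * cis t)
              * Re (cnj (f (of_real r * cis t)) * (cis t * deriv f (of_real r * cis t)))"
  have "((\<lambda>r. integral {0..2*pi} (\<lambda>t. smooth_power e q f (of_real r * cis t))) has_real_derivative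
      integral {0..2*pi} (?g' r)) (at r)"
  proof (rule DERIV_circle_integral[where U = "{-1<..<1}"])
    fix r t :: real assume "r \<in> {-1<..<1}"
    then show "((\<lambda>r. smooth_power e q f (of_real r * cis t)) has_real_derivative ?g' r t) (at r)"
      unfolding smooth_power_def
      by (intro DERIV_smooth_power_comp ray_vector_derivative f e) auto
    show "continuous_on {0..2*pi} (\<lambda>t. smooth_power e q f (of_real r * cis t))"
      using \<open>r \<in> {-1<..<1}\<close> by (intro continuous_on_circle continuous_on_smooth_power f e) auto
  next
    have *: "continuous_on ({-1<..<1} \<times> {0..2*pi}) (\<lambda>x. G (of_real (fst x) * cis (snd x)))"
      if "continuous_on (ball 0 1) G" for G :: "complex \<Rightarrow> 'b::topological_space"
      using continuous_on_polar[OF that] by (simp add: case_prod_beta)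
    show "continuous_on ({-1<..<1} \<times> {0..2*pi}) (\<lambda>(r, t). ?g' r t)"
      unfolding case_prod_beta
      by (intro continuous_intros * continuous_on_smooth_power holomorphic_on_imp_continuous_on[OF f] f e
            holomorphic_on_imp_continuous_on[OF holomorphic_deriv[OF f]]) auto
  qed (use r in auto)
  moreover have "integral {0..2*pi} (?g' r) = circle_integral (radial_flux e q f) r / r"
  proof -
    have "radial_flux e q f (of_real r * cis t) = r * ?g' r t" for t
    proof -
      have "Re (cnj (f (of_real r * cis t)) * (of_real r * cis t * deriv f (of_real r * cis t))) =
            Re (of_real r * (cnj (f (of_real r * cis t)) * (cis t * deriv f (of_real r * cis t))))"
        by (simp add: mult_ac)
      also have "\<dots> = r * Re (cnj (f (of_real r * cis t)) * (cis t * deriv f (of_real r * cis t)))"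
        by simp
      finally show ?thesis by (simp add: radial_flux_def)
    qed
    then show ?thesis using r by (simp add: circle_integral_def)
  qed
  ultimately show ?thesis
    by (simp add: circle_integral_def[abs_def])
qed

lemma integral_periodic_derivative_0:
  fixes S S' :: "real \<Rightarrow> real"
  assumes "\<And>t. (S has_real_derivative S' t) (at t)" "S (2 * pi) = S 0"
  shows "(S' has_integral 0) {0..2*pi}"
  using fundamental_theorem_of_calculus[of 0 "2*pi" S S'] assms
  by (auto simp: has_real_derivative_iff_has_vector_derivative intro: has_vector_derivative_at_within)

lemma Re_cnj_mult_square_sum:
  "(Re (cnj a * b))\<^sup>2 + (Re (cnj a * (\<i> * b)))\<^sup>2 = (norm a)\<^sup>2 * (norm b)\<^sup>2"
proof -
  have "(Re (cnj a * b))\<^sup>2 + (Im (cnj a * b))\<^sup>2 = (norm (cnj a * b))\<^sup>2"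
    by (simp only: cmod_power2)
  moreover have "Re (cnj a * (\<i> * b)) = - Im (cnj a * b)"
    by simp
  ultimately show ?thesis
    by (simp only: power2_minus norm_mult power_mult_distrib complex_mod_cnj)
qed

text \<open>
  In polar coordinates \<open>r\<^sup>2\<close> times the Laplacian is the square of \<open>r d/dr\<close> plus the square of
  \<open>d/dt\<close>; the second summand is the derivative of a periodic function and integrates to \<open>0\<close>.
  The factor \<open>\<i>\<close> in the tangential derivatives exchanges real and imaginary parts, so that the two
  squares of first derivatives add up to \<open>|f|\<^sup>2 * |z f'|\<^sup>2\<close>.
\<close>

lemma circle_integral_flux_deriv:
  assumes f: "f holomorphic_on ball 0 1" and e: "0 < e" and r: "0 < r" "r < 1"
  shows "(circle_integral (radial_flux e q f) has_real_derivative r * circle_integral (smooth_laplacian e q f) r) (at r)"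
proof -
  define g where "g = (\<lambda>z. z * deriv f z)"
  have f': "deriv f holomorphic_on ball 0 1"
    using f by (intro holomorphic_deriv) auto
  have g: "g holomorphic_on ball 0 1"
    unfolding g_def by (intro holomorphic_intros f')
  have g'h: "deriv g holomorphic_on ball 0 1"
    using g by (intro holomorphic_deriv) auto
  define Q where "Q = (\<lambda>c. smooth_power e c f)"
  define dr where "dr = (\<lambda>r t. let z = of_real r * cis t in
      2 * q * (2 * (q - 1) * Q (q - 2) z * Re (cnj (f z) * (cis t * deriv f z)) * Re (cnj (f z) * g z)
       + Q (q - 1) z * (Re (cnj (f z) * (cis t * deriv g z)) + Re (cnj (cis t * deriv f z) * g z))))"
  define S' where "S' = (\<lambda>t. let z = of_real r * cis t in
      2 * q * (2 * (q - 1) * Q (q - 2) z * Re (cnj (f z) * (\<i> * z * deriv f z)) * Re (cnj (f z) * (\<i> * g z))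
       + Q (q - 1) z * (Re (cnj (f z) * (\<i> * (\<i> * z * deriv g z))) + Re (cnj (\<i> * z * deriv f z) * (\<i> * g z)))))"
  have cont: "continuous_on ({-1<..<1} \<times> {0..2*pi}) (\<lambda>x. G (of_real (fst x) * cis (snd x)))"
    if "continuous_on (ball 0 1) G" for G :: "complex \<Rightarrow> 'b::topological_space"
    using continuous_on_polar[OF that] by (simp add: case_prod_beta)
  have contQ: "continuous_on (ball 0 1) (Q c)" for c
    unfolding Q_def by (intro continuous_on_smooth_power f e)
  have cdr: "continuous_on ({-1<..<1} \<times> {0..2*pi}) (\<lambda>(r, t). dr r t)"
    unfolding case_prod_beta dr_def Let_def
    by (intro continuous_intros cont contQ holomorphic_on_imp_continuous_on f f' g g'h)
  have "((\<lambda>r. integral {0..2*pi} (\<lambda>t. radial_flux e q f (of_real r * cis t))) has_real_derivative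
      integral {0..2*pi} (dr r)) (at r)"
  proof (rule DERIV_circle_integral[where U = "{-1<..<1}"])
    fix r t :: real assume r: "r \<in> {-1<..<1}"
    have Qd: "((\<lambda>r. Q (q - 1) (of_real r * cis t)) has_real_derivative
        2 * (q - 1) * Q (q - 1 - 1) (of_real r * cis t) * Re (cnj (f (of_real r * cis t)) * (cis t * deriv f (of_real r * cis t)))) (at r)"
      unfolding Q_def smooth_power_def
      using r by (intro DERIV_smooth_power_comp ray_vector_derivative f e) auto
    have Rd: "((\<lambda>r. Re (cnj (f (of_real r * cis t)) * g (of_real r * cis t))) has_real_derivative
        Re (cnj (f (of_real r * cis t)) * (cis t * deriv g (of_real r * cis t)))
        + Re (cnj (cis t * deriv f (of_real r * cis t)) * g (of_real r * cis t))) (at r)"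
      using r by (intro has_vector_derivative_Re_cnj_mult ray_vector_derivative f g) auto
    have fl: "radial_flux e q f = (\<lambda>z. 2 * q * (Q (q - 1) z * Re (cnj (f z) * g z)))"
      by (simp add: radial_flux_def Q_def g_def fun_eq_iff)
    show "((\<lambda>r. radial_flux e q f (of_real r * cis t)) has_real_derivative dr r t) (at r)"
      unfolding fl
      by (rule DERIV_cong[OF DERIV_cmult[OF DERIV_mult[OF Qd Rd]]])
         (simp add: dr_def Let_def algebra_simps)
    show "continuous_on {0..2*pi} (\<lambda>t. radial_flux e q f (of_real r * cis t))"
      using r by (intro continuous_on_circle continuous_on_radial_flux f e) auto
  qed (use cdr r in auto)
  moreover have "integral {0..2*pi} (dr r) = r * circle_integral (smooth_laplacian e q f) r"
  proof -
    have Sd: "((\<lambda>t. 2 * q * (Q (q - 1) (of_real r * cis t) * Re (cnj (f (of_real r * cis t)) * (\<i> * g (of_real r * cis t)))))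
        has_real_derivative S' t) (at t)" for t
    proof -
      have Qd: "((\<lambda>t. Q (q - 1) (of_real r * cis t)) has_real_derivative
          2 * (q - 1) * Q (q - 1 - 1) (of_real r * cis t)
            * Re (cnj (f (of_real r * cis t)) * (\<i> * (of_real r * cis t) * deriv f (of_real r * cis t)))) (at t)"
        unfolding Q_def smooth_power_def
        using r by (intro DERIV_smooth_power_comp circle_vector_derivative f e) auto
      have ig: "((\<lambda>t. \<i> * g (of_real r * cis t)) has_vector_derivative
          \<i> * (\<i> * (of_real r * cis t) * deriv g (of_real r * cis t))) (at t)"
        using r by (intro has_vector_derivative_mult_right circle_vector_derivative g) auto
      have Rd: "((\<lambda>t. Re (cnj (f (of_real r * cis t)) * (\<i> * g (of_real r * cis t)))) has_real_derivative
          Re (cnj (f (of_real r * cis t)) * (\<i> * (\<i> * (of_real r * cis t) * deriv g (of_real r * cis t))))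
          + Re (cnj (\<i> * (of_real r * cis t) * deriv f (of_real r * cis t)) * (\<i> * g (of_real r * cis t)))) (at t)"
        using r by (intro has_vector_derivative_Re_cnj_mult circle_vector_derivative f ig) auto
      show ?thesis
        by (rule DERIV_cong[OF DERIV_cmult[OF DERIV_mult[OF Qd Rd]]])
           (simp add: S'_def Let_def algebra_simps)
    qed
    have S0: "(S' has_integral 0) {0..2*pi}"
      by (rule integral_periodic_derivative_0[OF Sd]) simp
    have pt: "r * dr r t + S' t = r\<^sup>2 * smooth_laplacian e q f (of_real r * cis t)" for t
    proof -
      define z where "z = of_real r * cis t"
      define a b c where "a = f z" and "b = g z" and "c = z * deriv g z"
      have rb: "r * Re (cnj (f z) * (cis t * deriv f z)) = Re (cnj a * b)"
        and rc: "r * Re (cnj (f z) * (cis t * deriv g z)) = Re (cnj a * c)"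
        and rbb: "r * Re (cnj (cis t * deriv f z) * g z) = (norm b)\<^sup>2"
      proof -
        have *: "r * Re w = Re (of_real r * w)" for w by simp
        show "r * Re (cnj (f z) * (cis t * deriv f z)) = Re (cnj a * b)"
          "r * Re (cnj (f z) * (cis t * deriv g z)) = Re (cnj a * c)"
          unfolding * a_def b_def c_def g_def z_def by (simp_all only: mult_ac)
        have "r * Re (cnj (cis t * deriv f z) * g z) = Re (cnj b * b)"
          unfolding * b_def g_def z_def by (simp only: complex_cnj_mult complex_cnj_complex_of_real mult_ac)
        then show "r * Re (cnj (cis t * deriv f z) * g z) = (norm b)\<^sup>2"
          by (simp only: mult.commute[of "cnj b"] complex_norm_square[symmetric] Re_complex_of_real)
      qed
      have nb: "(norm b)\<^sup>2 = r\<^sup>2 * (norm (deriv f z))\<^sup>2"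
        using r by (simp add: b_def g_def z_def norm_mult power_mult_distrib)
      have "r * dr r t = 2 * q * (2 * (q - 1) * Q (q - 2) z * (r * Re (cnj (f z) * (cis t * deriv f z))) * Re (cnj a * b)
          + Q (q - 1) z * (r * Re (cnj (f z) * (cis t * deriv g z)) + r * Re (cnj (cis t * deriv f z) * g z)))"
        unfolding dr_def Let_def z_def[symmetric] a_def b_def by (simp only: algebra_simps)
      also have "\<dots> = 2 * q * (2 * (q - 1) * Q (q - 2) z * (Re (cnj a * b))\<^sup>2
          + Q (q - 1) z * (Re (cnj a * c) + (norm b)\<^sup>2))"
        unfolding rb rc rbb by (simp only: power2_eq_square mult.assoc)
      finally have 1: "r * dr r t = \<dots>" .
      have ib: "\<i> * z * deriv f z = \<i> * b" "\<i> * (\<i> * z * deriv g z) = - c"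
        by (simp add: b_def g_def, simp add: c_def flip: mult.assoc)
      have ibb: "Re (cnj (\<i> * b) * (\<i> * b)) = (norm b)\<^sup>2"
      proof -
        have "cnj (\<i> * b) * (\<i> * b) = b * cnj b" by (simp add: complex_eq_iff algebra_simps)
        then show ?thesis by (simp only: complex_norm_square[symmetric] Re_complex_of_real)
      qed
      have 2: "S' t = 2 * q * (2 * (q - 1) * Q (q - 2) z * (Re (cnj a * (\<i> * b)))\<^sup>2
          + Q (q - 1) z * (- Re (cnj a * c) + (norm b)\<^sup>2))"
        unfolding S'_def Let_def z_def[symmetric] ib a_def[symmetric] b_def[symmetric] ibb
        by (simp only: power2_eq_square mult.assoc mult_minus_right uminus_complex.sel)
      have "r * dr r t + S' t = 4 * q * (q - 1) * Q (q - 2) z * ((Re (cnj a * b))\<^sup>2 + (Re (cnj a * (\<i> * b)))\<^sup>2)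
          + 4 * q * Q (q - 1) z * (norm b)\<^sup>2"
      proof -
        have "2 * q * (2 * (q - 1) * A * x + B * (y + n)) + 2 * q * (2 * (q - 1) * A * w + B * (- y + n))
            = 4 * q * (q - 1) * A * (x + w) + 4 * q * B * n" for A B x y w n :: real
          by (simp add: algebra_simps)
        then show ?thesis unfolding 1 2 .
      qed
      also have "\<dots> = r\<^sup>2 * smooth_laplacian e q f z"
        unfolding Re_cnj_mult_square_sum nb smooth_laplacian_def Q_def a_def by (simp add: algebra_simps)
      finally show ?thesis unfolding z_def .
    qed
    have cdr': "continuous_on {0..2*pi} (dr r)"
    proof -
      have "continuous_on {0..2*pi} (\<lambda>t. (\<lambda>(r, t). dr r t) (r, t))"
        by (rule continuous_on_compose2[OF cdr]) (use r in \<open>auto intro!: continuous_intros\<close>)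
      then show ?thesis by simp
    qed
    have "((\<lambda>t. r * dr r t + S' t) has_integral r * integral {0..2*pi} (dr r) + 0) {0..2*pi}"
      by (intro has_integral_add has_integral_mult_right integrable_integral integrable_continuous_real cdr' S0)
    moreover have "((\<lambda>t. r * dr r t + S' t) has_integral r\<^sup>2 * circle_integral (smooth_laplacian e q f) r) {0..2*pi}"
      unfolding pt circle_integral_def
      using r by (intro has_integral_mult_right integrable_integral integrable_continuous_real
          continuous_on_circle continuous_on_smooth_laplacian f e) auto
    ultimately have "r * integral {0..2*pi} (dr r) = r * (r * circle_integral (smooth_laplacian e q f) r)"
      by (auto simp: power2_eq_square mult.assoc dest: has_integral_unique)
    then show ?thesis using r by simp
  qed
  ultimately show ?thesis
    by (simp add: circle_integral_def[abs_def])
qed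

lemma circle_integral_flux_0: "circle_integral (radial_flux e q f) 0 = 0"
  by (simp add: circle_integral_def radial_flux_def)

text \<open>
  Integrating \<open>W' = s m\<close> and \<open>u' = W / s\<close> gives a double integral of \<open>(\<tau> / s) * m \<tau>\<close> over
  \<open>\<tau> \<le> s \<le> r\<close>.  Replacing \<open>\<tau> / s\<close> by \<open>1\<close> leaves the kernel \<open>r - \<tau>\<close>, which is as good near the
  boundary as the exact kernel \<open>\<tau> * ln (r / \<tau>)\<close> and avoids a logarithm.
\<close>

lemma radial_growth:
  fixes u W m :: "real \<Rightarrow> real"
  assumes cont: "continuous_on {0..r} u" "continuous_on {0..r} W" "continuous_on {0..r} m"
    and du: "\<And>s. 0 < s \<Longrightarrow> s < r \<Longrightarrow> (u has_real_derivative W s / s) (at s)"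
    and dW: "\<And>s. 0 < s \<Longrightarrow> s < r \<Longrightarrow> (W has_real_derivative s * m s) (at s)"
    and W0: "W 0 = 0" and m: "\<And>s. 0 \<le> s \<Longrightarrow> s \<le> r \<Longrightarrow> 0 \<le> m s" and r: "0 \<le> r"
  shows "\<And>s. 0 \<le> s \<Longrightarrow> s \<le> r \<Longrightarrow> u s \<le> u r" "u r \<le> u 0 + integral {0..r} (\<lambda>s. (r - s) * m s)"
proof -
  define M where "M = (\<lambda>s. integral {0..s} m)"
  define N where "N = (\<lambda>s. integral {0..s} (\<lambda>s. s * m s))"
  have cm': "continuous_on {0..r} (\<lambda>s. s * m s)"
    by (intro continuous_intros cont)
  have dM: "(M has_real_derivative m s) (at s)" and dN: "(N has_real_derivative s * m s) (at s)"
    if "0 < s" "s < r" for s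
    using integral_has_real_derivative[OF cont(3), of s] integral_has_real_derivative[OF cm', of s] that
    by (auto simp: M_def N_def at_within_Icc_at)
  have cM: "continuous_on {0..r} M" and cN: "continuous_on {0..r} N"
    unfolding M_def N_def
    by (intro indefinite_integral_continuous_1 integrable_continuous_real cont cm')+
  have sub: "{0..s} \<subseteq> {0..r}" if "s \<le> r" for s :: real using that by auto
  have M0: "0 \<le> M s" if "0 \<le> s" "s \<le> r" for s
    unfolding M_def using that m by (intro integral_nonneg integrable_continuous_real continuous_on_subset[OF cont(3)]) auto
  have Wnn: "0 \<le> W s" and WM: "W s \<le> s * M s" if s: "0 < s" "s < r" for s
  proof -
    have "W 0 \<le> W s"
    proof (rule DERIV_nonneg_imp_increasing_open[where f = W])
      show "\<exists>y. (W has_real_derivative y) (at x) \<and> 0 \<le> y" if "0 < x" "x < s" for x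
        using dW[of x] m[of x] that s by (intro exI[of _ "x * m x"]) auto
      show "continuous_on {0..s} W" using s by (intro continuous_on_subset[OF cont(2)]) auto
    qed (use s in auto)
    then show "0 \<le> W s" using W0 by simp
    have "0 * M 0 - W 0 \<le> s * M s - W s"
    proof (rule DERIV_nonneg_imp_increasing_open[where f = "\<lambda>s. s * M s - W s"])
      show "\<exists>y. ((\<lambda>s. s * M s - W s) has_real_derivative y) (at x) \<and> 0 \<le> y" if "0 < x" "x < s" for x
      proof (intro exI conjI)
        show "((\<lambda>s. s * M s - W s) has_real_derivative (1 * M x + m x * x) - x * m x) (at x)"
          using that s by (intro DERIV_diff DERIV_mult DERIV_ident dM dW) auto
        show "0 \<le> (1 * M x + m x * x) - x * m x"
          using M0[of x] that s by simp
      qed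
      show "continuous_on {0..s} (\<lambda>s. s * M s - W s)"
        using s by (intro continuous_intros continuous_on_subset[OF cont(2) sub] continuous_on_subset[OF cM sub]) auto
    qed (use s in auto)
    then show "W s \<le> s * M s" using W0 by simp
  qed
  show "u s \<le> u r" if s: "0 \<le> s" "s \<le> r" for s
  proof (rule DERIV_nonneg_imp_increasing_open[where f = u])
    show "\<exists>y. (u has_real_derivative y) (at x) \<and> 0 \<le> y" if "s < x" "x < r" for x
      using du[of x] Wnn[of x] that s by (intro exI[of _ "W x / x"]) auto
    show "continuous_on {s..r} u"
      using s by (intro continuous_on_subset[OF cont(1)]) auto
  qed (use s in auto)
  have "(0 * M 0 - N 0) - u 0 \<le> (r * M r - N r) - u r"
  proof (rule DERIV_nonneg_imp_increasing_open[where f = "\<lambda>s. (s * M s - N s) - u s"])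
    show "\<exists>y. ((\<lambda>s. (s * M s - N s) - u s) has_real_derivative y) (at x) \<and> 0 \<le> y" if "0 < x" "x < r" for x
    proof (intro exI conjI)
      show "((\<lambda>s. (s * M s - N s) - u s) has_real_derivative ((1 * M x + m x * x) - x * m x) - W x / x) (at x)"
        using that by (intro DERIV_diff DERIV_mult DERIV_ident dM dN du) auto
      show "0 \<le> ((1 * M x + m x * x) - x * m x) - W x / x"
        using WM[of x] that by (simp add: field_simps)
    qed
    show "continuous_on {0..r} (\<lambda>s. (s * M s - N s) - u s)"
      by (intro continuous_intros cM cN cont)
  qed (use r in auto)
  moreover have "integral {0..r} (\<lambda>s. (r - s) * m s) = r * M r - N r"
  proof -
    have "((\<lambda>s. r * m s - s * m s) has_integral r * M r - N r) {0..r}"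
      unfolding M_def N_def
      by (intro has_integral_diff has_integral_mult_right integrable_integral integrable_continuous_real cont cm')
    then show ?thesis by (simp add: left_diff_distrib integral_unique)
  qed
  ultimately show "u r \<le> u 0 + integral {0..r} (\<lambda>s. (r - s) * m s)"
    by (simp add: M_def N_def)
qed

text \<open>
  Hoelder's inequality with the exponents \<open>1 / (1 - \<theta>)\<close> and \<open>1 / \<theta>\<close>, from Young's inequality
  applied to the two functions divided by their integrals.
\<close>

lemma Holder_integral_Icc:
  fixes f g :: "real \<Rightarrow> real"
  assumes cf: "continuous_on {a..b} f" and cg: "continuous_on {a..b} g"
    and f: "\<And>x. x \<in> {a..b} \<Longrightarrow> 0 < f x" and g: "\<And>x. x \<in> {a..b} \<Longrightarrow> 0 < g x"
    and \<theta>: "0 \<le> \<theta>" "\<theta> \<le> 1" and ab: "a < b"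
  shows "integral {a..b} (\<lambda>x. f x powr (1 - \<theta>) * g x powr \<theta>)
    \<le> integral {a..b} f powr (1 - \<theta>) * integral {a..b} g powr \<theta>"
proof -
  define A B where "A = integral {a..b} f" and "B = integral {a..b} g"
  have A: "0 < A" and B: "0 < B"
    unfolding A_def B_def by (intro integral_Icc_pos cf cg f g ab; assumption)+
  have "integral {a..b} (\<lambda>x. (f x / A) powr (1 - \<theta>) * (g x / B) powr \<theta>)
      \<le> integral {a..b} (\<lambda>x. (1 - \<theta>) * (f x / A) + \<theta> * (g x / B))"
  proof (rule integral_le)
    show "(\<lambda>x. (f x / A) powr (1 - \<theta>) * (g x / B) powr \<theta>) integrable_on {a..b}"
      using A B f g by (intro integrable_continuous_real continuous_intros cf cg) force+
    show "(\<lambda>x. (1 - \<theta>) * (f x / A) + \<theta> * (g x / B)) integrable_on {a..b}"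
      using A B by (intro integrable_continuous_real continuous_intros cf cg) auto
    show "(f x / A) powr (1 - \<theta>) * (g x / B) powr \<theta> \<le> (1 - \<theta>) * (f x / A) + \<theta> * (g x / B)"
      if "x \<in> {a..b}" for x
      using f[OF that] g[OF that] A B \<theta> by (intro Youngs_inequality_0) auto
  qed
  also have "\<dots> = 1"
  proof -
    have "((\<lambda>x. (1 - \<theta>) * (f x / A) + \<theta> * (g x / B)) has_integral (1 - \<theta>) * (A / A) + \<theta> * (B / B)) {a..b}"
      unfolding A_def B_def
      by (intro has_integral_add has_integral_mult_right has_integral_divide integrable_integral
          integrable_continuous_real cf cg)
    then show ?thesis using A B by (simp add: integral_unique)
  qed
  finally have "integral {a..b} (\<lambda>x. (f x / A) powr (1 - \<theta>) * (g x / B) powr \<theta>) \<le> 1" .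
  moreover have "integral {a..b} (\<lambda>x. (f x / A) powr (1 - \<theta>) * (g x / B) powr \<theta>)
      = integral {a..b} (\<lambda>x. f x powr (1 - \<theta>) * g x powr \<theta> / (A powr (1 - \<theta>) * B powr \<theta>))"
    using A B f g by (intro Henstock_Kurzweil_Integration.integral_cong) (auto simp: powr_divide less_imp_le)
  ultimately show ?thesis
    using A B by (simp add: A_def[symmetric] B_def[symmetric] pos_divide_le_eq)
qed

lemma continuous_on_circle_integral_Icc:
  assumes "continuous_on (ball 0 1) G" "0 \<le> a" "b < 1"
  shows "continuous_on {a..b} (circle_integral G)"
  by (rule continuous_on_subset[OF circle_integral_continuous[OF assms(1)]]) (use assms(2,3) in auto)

lemma circle_integral_mono:
  assumes "continuous_on (ball 0 1) G" "continuous_on (ball 0 1) H" "\<bar>r\<bar> < 1"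
    and "\<And>z. G z \<le> H z"
  shows "circle_integral G r \<le> circle_integral H r"
  unfolding circle_integral_def
  using assms by (intro integral_le integrable_continuous_real continuous_on_circle) auto

lemma circle_integral_pos:
  assumes G: "continuous_on (ball 0 1) G" "\<bar>r\<bar> < 1" and pos: "\<And>z. 0 < G z"
  shows "0 < circle_integral G r"
  unfolding circle_integral_def by (intro integral_Icc_pos continuous_on_circle G pos) simp

lemma circle_integral_laplacian_le:
  assumes f: "f holomorphic_on ball 0 1" and e: "0 < e" and q: "1 \<le> q" and s: "\<bar>s\<bar> < 1"
  shows "circle_integral (smooth_laplacian e q f) s
    \<le> 4 * q\<^sup>2 * (circle_integral (smooth_power e q f) s powr (1 - 1 / q)
                * circle_integral (smooth_power e q (deriv f)) s powr (1 / q))"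
proof -
  have f': "deriv f holomorphic_on ball 0 1"
    using f by (intro holomorphic_deriv) auto
  note cont = continuous_on_smooth_power[OF f e] continuous_on_smooth_power[OF f' e]
    continuous_on_smooth_laplacian[OF f e]
  have "circle_integral (smooth_laplacian e q f) s
      \<le> circle_integral (\<lambda>z. 4 * q\<^sup>2 * (smooth_power e (q - 1) f z * smooth_power e 1 (deriv f) z)) s"
    using smooth_laplacian_bounds(2)[OF q e] s by (intro circle_integral_mono continuous_intros cont) auto
  also have "\<dots> = 4 * q\<^sup>2 * integral {0..2*pi} (\<lambda>t.
      smooth_power e q f (of_real s * cis t) powr (1 - 1 / q) * smooth_power e q (deriv f) (of_real s * cis t) powr (1 / q))"
    using q e by (simp add: circle_integral_def smooth_power_def powr_powr right_diff_distrib add_nonneg_nonneg)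
  also have "\<dots> \<le> 4 * q\<^sup>2 * (circle_integral (smooth_power e q f) s powr (1 - 1 / q)
                * circle_integral (smooth_power e q (deriv f)) s powr (1 / q))"
    unfolding circle_integral_def using q s
    by (intro mult_left_mono Holder_integral_Icc continuous_on_circle cont smooth_power_pos e) auto
  finally show ?thesis .
qed

text \<open>
  The bound for the Laplacian contains \<open>u s powr (1 - 1 / q)\<close>.  As \<open>u\<close> increases, this factor is at
  most its value at \<open>r\<close>, and dividing by it turns an estimate of \<open>u r\<close> into one of
  \<open>u r powr (1 / q)\<close>.
\<close>

lemma
  assumes f: "f holomorphic_on ball 0 1" and e: "0 < e" and q: "1 \<le> q" and r: "r < 1"
  shows circle_integral_smooth_power_mono:
      "0 \<le> s \<Longrightarrow> s \<le> r \<Longrightarrow> circle_integral (smooth_power e q f) s \<le> circle_integral (smooth_power e q f) r"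
    and circle_integral_smooth_power_growth:
      "0 \<le> r \<Longrightarrow> circle_integral (smooth_power e q f) r powr (1 / q) \<le> circle_integral (smooth_power e q f) 0 powr (1 / q)
        + 4 * q\<^sup>2 * integral {0..r} (\<lambda>s. (1 - s) * circle_integral (smooth_power e q (deriv f)) s powr (1 / q))"
proof -
  define u where "u = circle_integral (smooth_power e q f)"
  define v where "v = circle_integral (smooth_power e q (deriv f))"
  define m where "m = circle_integral (smooth_laplacian e q f)"
  have f': "deriv f holomorphic_on ball 0 1"
    using f by (intro holomorphic_deriv) auto
  note cont = continuous_on_smooth_power[OF f e] continuous_on_smooth_power[OF f' e]
    continuous_on_smooth_laplacian[OF f e] continuous_on_radial_flux[OF f e]
  have c: "continuous_on {0..r} u" "continuous_on {0..r} v" "continuous_on {0..r} m"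
    "continuous_on {0..r} (circle_integral (radial_flux e q f))"
    unfolding u_def v_def m_def using r by (intro continuous_on_circle_integral_Icc cont; simp)+
  have m0: "0 \<le> m s" if "0 \<le> s" "s \<le> r" for s
    unfolding m_def circle_integral_def using that r smooth_laplacian_bounds(1)[OF q e]
    by (intro integral_nonneg integrable_continuous_real continuous_on_circle cont) auto
  have du: "(u has_real_derivative circle_integral (radial_flux e q f) s / s) (at s)"
    and dW: "(circle_integral (radial_flux e q f) has_real_derivative s * m s) (at s)" if "0 < s" "s < r" for s
    unfolding u_def m_def using that r f e
    by (auto intro!: circle_integral_smooth_power_deriv circle_integral_flux_deriv)
  have mono: "u s \<le> u t" and growth: "u t \<le> u 0 + integral {0..t} (\<lambda>s. (t - s) * m s)" if "0 \<le> s" "s \<le> t" "t \<le> r" for s t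
    using radial_growth[of t u "circle_integral (radial_flux e q f)" m, OF continuous_on_subset[OF c(1)]
        continuous_on_subset[OF c(4)] continuous_on_subset[OF c(3)] du dW circle_integral_flux_0 m0] that
    by auto
  show "0 \<le> s \<Longrightarrow> s \<le> r \<Longrightarrow> circle_integral (smooth_power e q f) s \<le> circle_integral (smooth_power e q f) r"
    using mono[of s r] by (simp add: u_def)
  assume r0: "0 \<le> r"
  have upos: "0 < u s" and vpos: "0 < v s" if "0 \<le> s" "s \<le> r" for s
    unfolding u_def v_def using that r e by (auto intro!: circle_integral_pos cont smooth_power_pos)
  have "u r \<le> u 0 + integral {0..r} (\<lambda>s. (r - s) * m s)"
    using growth[of r r] r0 by simp
  also have "integral {0..r} (\<lambda>s. (r - s) * m s) \<le> integral {0..r} (\<lambda>s. 4 * q\<^sup>2 * u r powr (1 - 1 / q) * ((1 - s) * v s powr (1 / q)))"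
  proof (rule integral_le)
    show "(\<lambda>s. (r - s) * m s) integrable_on {0..r}"
      by (intro integrable_continuous_real continuous_intros c)
    show "(\<lambda>s. 4 * q\<^sup>2 * u r powr (1 - 1 / q) * ((1 - s) * v s powr (1 / q))) integrable_on {0..r}"
      using vpos by (intro integrable_continuous_real continuous_intros c) force
    fix s assume s: "s \<in> {0..r}"
    have "m s \<le> 4 * q\<^sup>2 * (u s powr (1 - 1 / q) * v s powr (1 / q))"
      unfolding m_def u_def v_def using s r by (intro circle_integral_laplacian_le f e q) auto
    also have "\<dots> \<le> 4 * q\<^sup>2 * (u r powr (1 - 1 / q) * v s powr (1 / q))"
      using s r0 q mono[of s r] upos[of s] by (intro mult_left_mono mult_right_mono powr_mono2) auto
    finally have "(r - s) * m s \<le> (1 - s) * (4 * q\<^sup>2 * (u r powr (1 - 1 / q) * v s powr (1 / q)))"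
      using s r m0[of s] by (intro mult_mono) auto
    then show "(r - s) * m s \<le> 4 * q\<^sup>2 * u r powr (1 - 1 / q) * ((1 - s) * v s powr (1 / q))"
      by (simp add: mult_ac)
  qed
  also have "\<dots> = 4 * q\<^sup>2 * u r powr (1 - 1 / q) * integral {0..r} (\<lambda>s. (1 - s) * v s powr (1 / q))"
    by simp
  finally have main: "u r \<le> u 0 + u r powr (1 - 1 / q) * (4 * q\<^sup>2 * integral {0..r} (\<lambda>s. (1 - s) * v s powr (1 / q)))"
    by (simp add: mult_ac)
  have eq: "u s = u s powr (1 - 1 / q) * u s powr (1 / q)" if "0 \<le> s" "s \<le> r" for s
    using upos[OF that] by (simp flip: powr_add)
  have "u 0 = u 0 powr (1 - 1 / q) * u 0 powr (1 / q)" using eq[of 0] r0 by simp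
  also have "\<dots> \<le> u r powr (1 - 1 / q) * u 0 powr (1 / q)"
    using mono[of 0 r] upos[of 0] r0 q by (intro mult_right_mono powr_mono2) auto
  finally have "u r powr (1 - 1 / q) * u r powr (1 / q)
      \<le> u r powr (1 - 1 / q) * (u 0 powr (1 / q) + 4 * q\<^sup>2 * integral {0..r} (\<lambda>s. (1 - s) * v s powr (1 / q)))"
    using main eq[of r] r0 by (simp add: distrib_left)
  then show "circle_integral (smooth_power e q f) r powr (1 / q) \<le> circle_integral (smooth_power e q f) 0 powr (1 / q)
        + 4 * q\<^sup>2 * integral {0..r} (\<lambda>s. (1 - s) * circle_integral (smooth_power e q (deriv f)) s powr (1 / q))"
    using upos[of r] r0 unfolding u_def[symmetric] v_def[symmetric] by (subst (asm) mult_le_cancel_left_pos) auto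
qed

section \<open>Hardy's inequality on a logarithmic scale\<close>

text \<open>
  Hoelder's inequality against the measure \<open>1 / (1 - s)\<close>, whose mass on the block is a logarithm;
  the remaining powers of \<open>1 - s\<close> are those of the norm of the Dirichlet-type space.
\<close>

lemma Holder_log_block:
  fixes v :: "real \<Rightarrow> real"
  assumes v: "continuous_on {a..b} v" "\<And>s. s \<in> {a..b} \<Longrightarrow> 0 < v s" and ab: "a < b" "b < 1" and q: "1 \<le> q"
  shows "integral {a..b} (\<lambda>s. (1 - s) * v s powr (1 / q))
    \<le> ln ((1 - a) / (1 - b)) powr (1 - 1 / q) * integral {a..b} (\<lambda>s. (1 - s) powr (2 * q - 1) * v s) powr (1 / q)"
proof -
  have "integral {a..b} (\<lambda>s. (1 - s) * v s powr (1 / q))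
      = integral {a..b} (\<lambda>s. (1 / (1 - s)) powr (1 - 1 / q) * ((1 - s) powr (2 * q - 1) * v s) powr (1 / q))"
  proof (rule Henstock_Kurzweil_Integration.integral_cong)
    fix s assume s: "s \<in> {a..b}"
    then have 1: "0 < 1 - s" using ab by auto
    have inv: "(1 / (1 - s)) powr c = (1 - s) powr (- c)" for c
      using 1 by (simp add: powr_divide powr_minus_divide)
    have "(1 / (1 - s)) powr (1 - 1 / q) * ((1 - s) powr (2 * q - 1) * v s) powr (1 / q)
       = (1 - s) powr (- (1 - 1 / q)) * (1 - s) powr ((2 * q - 1) / q) * v s powr (1 / q)"
      unfolding inv using 1 v(2)[OF s] by (simp add: powr_mult powr_powr)
    also have "\<dots> = (1 - s) powr (- (1 - 1 / q) + (2 * q - 1) / q) * v s powr (1 / q)"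
      by (simp only: powr_add)
    also have "- (1 - 1 / q) + (2 * q - 1) / q = 1" using q by (simp add: field_simps)
    finally show "(1 - s) * v s powr (1 / q)
        = (1 / (1 - s)) powr (1 - 1 / q) * ((1 - s) powr (2 * q - 1) * v s) powr (1 / q)"
      using 1 by simp
  qed
  also have "\<dots> \<le> integral {a..b} (\<lambda>s. 1 / (1 - s)) powr (1 - 1 / q)
      * integral {a..b} (\<lambda>s. (1 - s) powr (2 * q - 1) * v s) powr (1 / q)"
    using ab q v(2) by (intro Holder_integral_Icc continuous_intros v) (auto simp: field_simps)
  also have "integral {a..b} (\<lambda>s. 1 / (1 - s)) = ln ((1 - a) / (1 - b))"
  proof -
    have "((\<lambda>s. 1 / (1 - s)) has_integral - ln (1 - b) - - ln (1 - a)) {a..b}"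
      using ab by (intro fundamental_theorem_of_calculus)
        (auto intro!: derivative_eq_intros simp flip: has_real_derivative_iff_has_vector_derivative)
    then show ?thesis using ab by (simp add: integral_unique ln_div)
  qed
  finally show ?thesis .
qed

text \<open>
  Discrete form of Hardy's inequality: convolution with a geometric sequence is bounded on \<open>q\<close>-summable
  sequences, by Jensen's inequality for the weights \<open>x ^ (k - j)\<close>.
\<close>

lemma geometric_convolution_powr_le:
  fixes b :: "nat \<Rightarrow> real"
  assumes b: "\<And>j. 0 < b j" and x: "0 < x" "x < 1" and q: "1 \<le> q"
  shows "(\<Sum>k\<le>N. (\<Sum>j\<le>k. x ^ (k - j) * b j) powr q) \<le> (1 / (1 - x)) powr q * (\<Sum>j\<le>N. b j powr q)"
proof -
  define A where "A = 1 / (1 - x)"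
  have A: "0 < A" using x by (simp add: A_def)
  have geo: "(\<Sum>i\<le>n. x ^ i) \<le> A" for n
  proof -
    have "(\<Sum>i\<le>n. x ^ i) = (1 - x ^ Suc n) / (1 - x)"
      using x by (subst lessThan_Suc_atMost[symmetric], subst sum_gp_strict) auto
    also have "\<dots> \<le> A" unfolding A_def using x by (intro divide_right_mono) auto
    finally show ?thesis .
  qed
  have one: "(\<Sum>j\<le>k. x ^ (k - j) * b j) powr q \<le> A powr (q - 1) * (\<Sum>j\<le>k. x ^ (k - j) * b j powr q)" for k
  proof -
    define w where "w = (\<Sum>j\<le>k. x ^ (k - j))"
    have w: "0 < w" unfolding w_def using x by (intro sum_pos) auto
    have wA: "w \<le> A"
      unfolding w_def using geo[of k] by (subst sum.nat_diff_reindex[symmetric, of "\<lambda>i. x ^ (k - i)" "Suc k", unfolded lessThan_Suc_atMost]) simp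
    have "(\<Sum>j\<le>k. (x ^ (k - j) / w) *\<^sub>R b j) powr q \<le> (\<Sum>j\<le>k. (x ^ (k - j) / w) * b j powr q)"
      using x w b
      by (intro convex_on_sum[OF _ _ powr_convex[OF q]])
         (auto simp: w_def simp flip: sum_divide_distrib)
    also have "(\<Sum>j\<le>k. (x ^ (k - j) / w) *\<^sub>R b j) = (\<Sum>j\<le>k. x ^ (k - j) * b j) / w"
      by (simp add: sum_divide_distrib)
    also have "(\<Sum>j\<le>k. (x ^ (k - j) / w) * b j powr q) = (\<Sum>j\<le>k. x ^ (k - j) * b j powr q) / w"
      by (simp add: sum_divide_distrib)
    finally have "(\<Sum>j\<le>k. x ^ (k - j) * b j) powr q \<le> w powr q * ((\<Sum>j\<le>k. x ^ (k - j) * b j powr q) / w)"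
      using w x b by (simp add: powr_divide sum_nonneg less_imp_le pos_divide_le_eq mult.commute)
    also have "\<dots> = w powr (q - 1) * (\<Sum>j\<le>k. x ^ (k - j) * b j powr q)"
      using w by (simp add: powr_diff)
    also have "\<dots> \<le> A powr (q - 1) * (\<Sum>j\<le>k. x ^ (k - j) * b j powr q)"
      using w wA q x by (intro mult_right_mono powr_mono2 sum_nonneg) auto
    finally show ?thesis .
  qed
  have "(\<Sum>k\<le>N. (\<Sum>j\<le>k. x ^ (k - j) * b j) powr q)
      \<le> (\<Sum>k\<le>N. A powr (q - 1) * (\<Sum>j\<le>k. x ^ (k - j) * b j powr q))"
    by (intro sum_mono one)
  also have "\<dots> = A powr (q - 1) * (\<Sum>j\<le>N. \<Sum>k\<in>{j..N}. x ^ (k - j) * b j powr q)"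
  proof -
    have "(\<Sum>k\<le>N. \<Sum>j\<le>k. x ^ (k - j) * b j powr q) = (\<Sum>j\<le>N. \<Sum>k\<in>{j..N}. x ^ (k - j) * b j powr q)"
      unfolding sum.Sigma[OF finite_atMost, simplified] sum.Sigma
      by (subst sum.Sigma; (simp; fail)?; subst sum.Sigma; (simp; fail)?)
         (rule sum.reindex_bij_witness[where i = "\<lambda>(a, b). (b, a)" and j = "\<lambda>(a, b). (b, a)"]; auto)
    then show ?thesis by (simp only: sum_distrib_left[symmetric])
  qed
  also have "\<dots> \<le> A powr (q - 1) * (\<Sum>j\<le>N. A * b j powr q)"
  proof (intro mult_left_mono sum_mono)
    fix j assume j: "j \<in> {..N}"
    have "(\<Sum>k\<in>{j..N}. x ^ (k - j) * b j powr q) = (\<Sum>i\<le>N - j. x ^ i) * b j powr q"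
      unfolding sum_distrib_right
      by (rule sum.reindex_bij_witness[where i = "\<lambda>i. i + j" and j = "\<lambda>k. k - j"]) (use j in auto)
    also have "\<dots> \<le> A * b j powr q" by (intro mult_right_mono geo) simp
    finally show "(\<Sum>k\<in>{j..N}. x ^ (k - j) * b j powr q) \<le> A * b j powr q" .
  qed simp
  also have "\<dots> = A powr q * (\<Sum>j\<le>N. b j powr q)"
    using A by (simp add: powr_diff sum_distrib_left)
  finally show ?thesis unfolding A_def .
qed

text \<open>
  The scales on which the weight \<open>log (e / t)\<close> doubles: its value at \<open>log_scale k\<close> is \<open>2 ^ k\<close>.
\<close>

definition log_scale :: "nat \<Rightarrow> real" where "log_scale k = exp (1 - 2 ^ k)"

lemma log_scale_pos: "0 < log_scale k" by (simp add: log_scale_def)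
lemma log_scale_0: "log_scale 0 = 1" by (simp add: log_scale_def)
lemma log_scale_Suc_less: "log_scale (Suc k) < log_scale k"
  by (simp add: log_scale_def)
lemma log_scale_le_1: "log_scale k \<le> 1"
  by (simp add: log_scale_def)
lemma ln_log_scale: "ln (log_scale j / log_scale (Suc j)) = 2 ^ j"
  by (simp add: log_scale_def ln_div)

lemma integral_blocks_sum:
  fixes g :: "real \<Rightarrow> real"
  assumes "continuous_on {0..1 - log_scale (Suc n)} g"
  shows "integral {0..1 - log_scale (Suc n)} g = (\<Sum>j\<le>n. integral {1 - log_scale j..1 - log_scale (Suc j)} g)"
  using assms
proof (induction n)
  case 0
  then show ?case by (simp add: log_scale_0)
next
  case (Suc n)
  have le: "1 - log_scale (Suc n) \<le> 1 - log_scale (Suc (Suc n))" "0 \<le> 1 - log_scale (Suc n)"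
    using log_scale_Suc_less[of "Suc n"] log_scale_le_1[of "Suc n"] by auto
  have "integral {0..1 - log_scale (Suc (Suc n))} g = integral {0..1 - log_scale (Suc n)} g
      + integral {1 - log_scale (Suc n)..1 - log_scale (Suc (Suc n))} g"
    using Suc.prems le by (intro Henstock_Kurzweil_Integration.integral_combine[symmetric] integrable_continuous_real) auto
  also have "integral {0..1 - log_scale (Suc n)} g = (\<Sum>j\<le>n. integral {1 - log_scale j..1 - log_scale (Suc j)} g)"
    using le by (intro Suc.IH continuous_on_subset[OF Suc.prems]) auto
  finally show ?case by simp
qed

text \<open>
  The area element carries a factor \<open>s\<close> that degenerates at the centre.  For an increasing \<open>v\<close> the
  part near the centre is dominated by the part over \<open>{1/4..1/2}\<close>.
\<close>

lemma integral_radial_weight_le: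
  fixes v :: "real \<Rightarrow> real"
  assumes v: "continuous_on {0..R} v" "\<And>s t. 0 \<le> s \<Longrightarrow> s \<le> t \<Longrightarrow> t \<le> R \<Longrightarrow> v s \<le> v t"
      "\<And>s. 0 \<le> s \<Longrightarrow> s \<le> R \<Longrightarrow> 0 \<le> v s"
    and R: "1 / 2 \<le> R" "R < 1" and c: "0 \<le> c"
  shows "integral {0..R} (\<lambda>s. (1 - s) powr c * v s) \<le> (4 * 2 powr c + 4) * integral {0..R} (\<lambda>s. (1 - s) powr c * v s * s)"
proof -
  let ?g = "\<lambda>s. (1 - s) powr c * v s" and ?h = "\<lambda>s. (1 - s) powr c * v s * s"
  have cont: "continuous_on {0..R} ?g" "continuous_on {0..R} ?h"
    using R by (auto intro!: continuous_intros v)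
  have int: "?g integrable_on {a..b}" "?h integrable_on {a..b}" if "0 \<le> a" "b \<le> R" for a b
    using that by (intro integrable_continuous_real continuous_on_subset[OF cont(1)] continuous_on_subset[OF cont(2)]; auto)+
  have split: "integral {0..R} k = integral {0..1/4} k + integral {1/4..R} k" if "continuous_on {0..R} k" for k :: "real \<Rightarrow> real"
    using that R by (intro Henstock_Kurzweil_Integration.integral_combine[symmetric] integrable_continuous_real) auto
  have h0: "0 \<le> ?h s" if "0 \<le> s" "s \<le> R" for s using that v by auto
  have H: "integral {1/4..R} ?h \<le> integral {0..R} ?h"
    using R h0 by (intro integral_subset_le int) auto
  have "integral {1/4..R} ?g \<le> integral {1/4..R} (\<lambda>s. 4 * ?h s)"
  proof (rule integral_le)
    show "?g integrable_on {1/4..R}" using int by auto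
    show "(\<lambda>s. 4 * ?h s) integrable_on {1/4..R}"
      using int(2)[of "1/4" R] by (intro integrable_on_mult_right) auto
    fix s assume s: "s \<in> {1/4..R}"
    then have "?g s * 1 \<le> ?g s * (4 * s)" using v(3)[of s] by (intro mult_left_mono) auto
    then show "?g s \<le> 4 * ?h s" by (simp add: mult_ac)
  qed
  then have far: "integral {1/4..R} ?g \<le> 4 * integral {1/4..R} ?h" by simp
  have "integral {0..1/4} ?g \<le> integral {0..1/4 :: real} (\<lambda>s. v (1/4))"
  proof (rule integral_le)
    fix s :: real assume s: "s \<in> {0..1/4}"
    then have "(1 - s) powr c * v s \<le> 1 * v (1/4)"
      using R c v(3)[of s] by (intro mult_mono v(2)) (auto intro: powr_le1)
    then show "?g s \<le> v (1/4)" by simp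
  qed (use int R in auto)
  also have "\<dots> = integral {1/4..1/2 :: real} (\<lambda>s. v (1/4))" by simp
  also have "\<dots> \<le> integral {1/4..1/2} (\<lambda>s. 4 * 2 powr c * ?h s)"
  proof (rule integral_le)
    show "(\<lambda>s. 4 * 2 powr c * ?h s) integrable_on {1/4..1/2}"
      using int(2)[of "1/4" "1/2"] R by (intro integrable_on_mult_right) auto
    fix s :: real assume s: "s \<in> {1/4..1/2}"
    have "1 = 2 powr c * (1/2) powr c" by (simp add: powr_divide)
    also have "\<dots> \<le> 2 powr c * (1 - s) powr c" using s c by (intro mult_left_mono powr_mono2) auto
    also have "\<dots> \<le> 2 powr c * (1 - s) powr c * (4 * s)" using s mult_left_mono[of 1 "4 * s" "2 powr c * (1 - s) powr c"] by auto
    finally have "1 \<le> 2 powr c * (1 - s) powr c * (4 * s)" .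
    moreover have "v (1/4) \<le> v s" "0 \<le> v (1/4)" using s R by (auto intro!: v)
    ultimately have "1 * v (1/4) \<le> 2 powr c * (1 - s) powr c * (4 * s) * v s"
      using s by (intro mult_mono) auto
    then show "v (1/4) \<le> 4 * 2 powr c * ?h s" by (simp add: mult_ac)
  qed auto
  also have "\<dots> = 4 * 2 powr c * integral {1/4..1/2} ?h" by simp
  also have "\<dots> \<le> 4 * 2 powr c * integral {1/4..R} ?h"
    using R h0 by (intro mult_left_mono integral_subset_le int) auto
  finally have "integral {0..R} ?g \<le> (4 * 2 powr c + 4) * integral {1/4..R} ?h"
    using far split[OF cont(1)] by (simp add: algebra_simps)
  also have "\<dots> \<le> (4 * 2 powr c + 4) * integral {0..R} ?h"
    using H by (intro mult_left_mono) auto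
  finally show ?thesis .
qed

lemma sum_powr_le_powr_mult:
  fixes a b :: real
  assumes "0 \<le> a" "0 \<le> b" "0 \<le> q"
  shows "(a + b) powr q \<le> 2 powr q * (a powr q + b powr q)"
proof -
  have "(a + b) powr q \<le> (2 * max a b) powr q"
    using assms by (intro powr_mono2) auto
  also have "\<dots> = 2 powr q * max a b powr q" using assms by (simp add: powr_mult)
  also have "\<dots> \<le> 2 powr q * (a powr q + b powr q)"
    by (intro mult_left_mono) (auto simp: max_def)
  finally show ?thesis .
qed

text \<open>
  With \<open>y = 2 powr (1 - 1 / q)\<close> the block estimates say that \<open>u (1 - log_scale (n + 1)) powr (1 / q)\<close> is
  at most the sum of \<open>y ^ j * b j\<close> over \<open>j \<le> n\<close>, where \<open>b j powr q\<close> is comparable to the \<open>j\<close>-th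
  block of the integral of \<open>v\<close>.  The weight \<open>2 powr (- n * (q - 1))\<close> is \<open>y ^ n\<close> to the
  power \<open>- q\<close>, so that after multiplication by it a convolution with powers of \<open>1 / y < 1\<close> remains.
\<close>

lemma dyadic_log_means_le:
  assumes q: "1 < q"
  obtains C where "0 < C"
    "\<And>f e N. f holomorphic_on ball 0 1 \<Longrightarrow> 0 < e \<Longrightarrow>
      (\<Sum>n\<le>N. 2 powr (- (real n * (q - 1))) * circle_integral (smooth_power e q f) (1 - log_scale (Suc n)))
      \<le> C * (circle_integral (smooth_power e q f) 0
          + integral {0..1 - log_scale (Suc N)} (\<lambda>s. (1 - s) powr (2 * q - 1) * circle_integral (smooth_power e q (deriv f)) s * s))"
proof -
  define y x where "y = (2::real) powr (1 - 1 / q)" and "x = 1 / y"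
  have y: "1 < y" using q by (simp add: y_def)
  have x: "0 < x" "x < 1" using y by (auto simp: x_def)
  define A where "A = (1 / (1 - x)) powr q"
  define B where "B = 2 powr q * (4 * q\<^sup>2) powr q + 2 powr q"
  define D where "D = 4 * 2 powr (2 * q - 1) + (4::real)"
  have A: "0 < A" and B: "0 < B" and D: "1 \<le> D"
    using x q by (auto simp: A_def B_def D_def add_pos_pos)
  show thesis
  proof
    show "0 < A * B * D" using A B D by simp
    fix f e and N :: nat assume f: "f holomorphic_on ball 0 1" and e: "0 < (e::real)"
    define u where "u = circle_integral (smooth_power e q f)"
    define v where "v = circle_integral (smooth_power e q (deriv f))"
    let ?V = "integral {0..1 - log_scale (Suc N)} (\<lambda>s. (1 - s) powr (2 * q - 1) * v s * s)"
    have f': "deriv f holomorphic_on ball 0 1"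
      using f by (intro holomorphic_deriv) auto
    have cv: "continuous_on {a..b} v" if "0 \<le> a" "b < 1" for a b
      unfolding v_def by (intro continuous_on_circle_integral_Icc continuous_on_smooth_power f' e that)
    have u: "0 < u s" and v: "0 < v s" if "0 \<le> s" "s < 1" for s
      unfolding u_def v_def using that f f' e by (auto intro!: circle_integral_pos continuous_on_smooth_power smooth_power_pos)
    define E where "E = (\<lambda>j. integral {1 - log_scale j..1 - log_scale (Suc j)} (\<lambda>s. (1 - s) powr (2 * q - 1) * v s))"
    \<comment> \<open>The value at the centre is absorbed into the zeroth block.\<close>
    define b where "b = (\<lambda>j. 4 * q\<^sup>2 * E j powr (1 / q) + (if j = 0 then u 0 powr (1 / q) else 0))"
    have L: "0 \<le> 1 - log_scale j" "1 - log_scale j < 1 - log_scale (Suc j)" "1 - log_scale j < 1" for j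
      using log_scale_le_1[of j] log_scale_Suc_less[of j] log_scale_pos[of j] by auto
    have E: "0 < E j" for j
    proof -
      let ?a = "1 - log_scale j" and ?b = "1 - log_scale (Suc j)"
      have c: "continuous_on {?a..?b} (\<lambda>s. (1 - s) powr (2 * q - 1) * v s)"
        using L[of j] L[of "Suc j"] by (intro continuous_intros cv) (auto simp del: diff_ge_0_iff_ge)
      show ?thesis
        unfolding E_def using L[of j] L[of "Suc j"]
        by (intro integral_Icc_pos c mult_pos_pos v) (auto simp del: diff_ge_0_iff_ge)
    qed
    have b: "0 < b j" for j
      using E[of j] q by (auto simp: b_def intro!: add_pos_nonneg)
    have bq: "b j powr q \<le> 2 powr q * (4 * q\<^sup>2) powr q * E j + (if j = 0 then 2 powr q * u 0 else 0)" for j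
    proof -
      have "b j powr q \<le> 2 powr q * ((4 * q\<^sup>2 * E j powr (1 / q)) powr q + (if j = 0 then u 0 powr (1 / q) else 0) powr q)"
        unfolding b_def using E[of j] q by (intro sum_powr_le_powr_mult) auto
      also have "\<dots> = 2 powr q * (4 * q\<^sup>2) powr q * E j + (if j = 0 then 2 powr q * u 0 else 0)"
        using E[of j] u[of 0] q by (auto simp: powr_mult powr_powr distrib_left)
      finally show ?thesis .
    qed
    have term_le: "2 powr (- (real n * (q - 1))) * u (1 - log_scale (Suc n)) \<le> (\<Sum>j\<le>n. x ^ (n - j) * b j) powr q" for n
    proof -
      let ?r = "1 - log_scale (Suc n)"
      have "u ?r powr (1 / q) \<le> u 0 powr (1 / q) + 4 * q\<^sup>2 * integral {0..?r} (\<lambda>s. (1 - s) * v s powr (1 / q))"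
        unfolding u_def v_def using L[of "Suc n"] q by (intro circle_integral_smooth_power_growth f e) (auto simp del: diff_ge_0_iff_ge)
      also have "integral {0..?r} (\<lambda>s. (1 - s) * v s powr (1 / q))
          = (\<Sum>j\<le>n. integral {1 - log_scale j..1 - log_scale (Suc j)} (\<lambda>s. (1 - s) * v s powr (1 / q)))"
        using L[of "Suc n"] v by (intro integral_blocks_sum continuous_intros cv) (force simp del: diff_ge_0_iff_ge)+
      also have "\<dots> \<le> (\<Sum>j\<le>n. y ^ j * E j powr (1 / q))"
      proof (rule sum_mono)
        fix j
        have "integral {1 - log_scale j..1 - log_scale (Suc j)} (\<lambda>s. (1 - s) * v s powr (1 / q))
            \<le> ln ((1 - (1 - log_scale j)) / (1 - (1 - log_scale (Suc j)))) powr (1 - 1 / q) * E j powr (1 / q)"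
          unfolding E_def using L[of j] L[of "Suc j"] q
          by (intro Holder_log_block cv v) (auto simp del: diff_ge_0_iff_ge)
        also have "ln ((1 - (1 - log_scale j)) / (1 - (1 - log_scale (Suc j)))) powr (1 - 1 / q) = y ^ j"
          using ln_log_scale[of j] by (simp add: y_def powr_power powr_powr flip: powr_realpow) (simp add: mult.commute)
        finally show "integral {1 - log_scale j..1 - log_scale (Suc j)} (\<lambda>s. (1 - s) * v s powr (1 / q)) \<le> y ^ j * E j powr (1 / q)" .
      qed
      also have "u 0 powr (1 / q) + 4 * q\<^sup>2 * (\<Sum>j\<le>n. y ^ j * E j powr (1 / q)) = (\<Sum>j\<le>n. y ^ j * b j)"
        by (simp add: b_def distrib_left sum.distrib sum_distrib_left mult_ac if_distrib[of "\<lambda>x. _ * x"] cong: if_cong)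
      finally have main: "u ?r powr (1 / q) \<le> (\<Sum>j\<le>n. y ^ j * b j)" using q by simp
      have "x ^ n * u ?r powr (1 / q) \<le> (\<Sum>j\<le>n. x ^ (n - j) * b j)"
      proof -
        have "x ^ n * u ?r powr (1 / q) \<le> x ^ n * (\<Sum>j\<le>n. y ^ j * b j)"
          using x main by (intro mult_left_mono) auto
        also have "\<dots> = (\<Sum>j\<le>n. x ^ (n - j) * b j)"
          unfolding sum_distrib_left using y by (intro sum.cong) (auto simp: x_def power_diff field_simps)
        finally show ?thesis .
      qed
      then have "(x ^ n * u ?r powr (1 / q)) powr q \<le> (\<Sum>j\<le>n. x ^ (n - j) * b j) powr q"
        using x q by (intro powr_mono2) auto
      also have "(x ^ n * u ?r powr (1 / q)) powr q = (x ^ n) powr q * u ?r"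
        using u[of ?r] L[of "Suc n"] q x by (simp add: powr_mult powr_powr)
      also have "(x ^ n) powr q = 2 powr (- (real n * (q - 1)))"
      proof -
        have "x ^ n = 2 powr (- (1 - 1 / q) * real n)"
          using x by (simp add: x_def y_def powr_minus_divide powr_powr[symmetric] powr_realpow powr_divide power_one_over flip: powr_minus_divide)
        moreover have "- (1 - 1 / q) * real n * q = - (real n * (q - 1))"
          using q by (simp add: field_simps)
        ultimately show ?thesis by (simp only: powr_powr)
      qed
      finally show ?thesis .
    qed
    have "(\<Sum>n\<le>N. 2 powr (- (real n * (q - 1))) * u (1 - log_scale (Suc n)))
        \<le> (\<Sum>n\<le>N. (\<Sum>j\<le>n. x ^ (n - j) * b j) powr q)"
      by (intro sum_mono term_le)
    also have "\<dots> \<le> A * (\<Sum>j\<le>N. b j powr q)"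
      unfolding A_def using b x q by (intro geometric_convolution_powr_le) auto
    also have "\<dots> \<le> A * (\<Sum>j\<le>N. 2 powr q * (4 * q\<^sup>2) powr q * E j + (if j = 0 then 2 powr q * u 0 else 0))"
      using A by (intro mult_left_mono sum_mono bq) auto
    also have "\<dots> = A * (2 powr q * (4 * q\<^sup>2) powr q * (\<Sum>j\<le>N. E j) + 2 powr q * u 0)"
      by (simp add: sum.distrib sum_distrib_left)
    also have "\<dots> \<le> A * (B * (\<Sum>j\<le>N. E j) + B * u 0)"
      using A u[of 0] E by (intro mult_left_mono add_mono mult_right_mono) (auto simp: B_def less_imp_le intro: sum_nonneg)
    also have "(\<Sum>j\<le>N. E j) = integral {0..1 - log_scale (Suc N)} (\<lambda>s. (1 - s) powr (2 * q - 1) * v s)"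
      unfolding E_def using L[of "Suc N"]
      by (intro integral_blocks_sum[symmetric] continuous_intros cv) (auto simp del: diff_ge_0_iff_ge)
    also have "\<dots> \<le> D * ?V"
      unfolding D_def
    proof (rule integral_radial_weight_le)
      have "log_scale (Suc N) \<le> log_scale 1"
        by (simp add: log_scale_def)
      also have "log_scale 1 \<le> 1 / 2"
      proof -
        have "(2::real) \<le> exp 1" using exp_ge_add_one_self[of 1] by simp
        then show ?thesis by (simp add: log_scale_def exp_minus field_simps)
      qed
      finally show "1 / 2 \<le> 1 - log_scale (Suc N)" by simp
      show "v s \<le> v t" if "0 \<le> s" "s \<le> t" "t \<le> 1 - log_scale (Suc N)" for s t
        unfolding v_def using that L[of "Suc N"] q by (intro circle_integral_smooth_power_mono f' e) auto
      show "0 \<le> v s" if "0 \<le> s" "s \<le> 1 - log_scale (Suc N)" for s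
        using v[of s] that L[of "Suc N"] by (auto simp: less_imp_le)
    qed (use q L[of "Suc N"] cv in \<open>auto simp del: diff_ge_0_iff_ge\<close>)
    also have "A * (B * (D * ?V) + B * u 0)
        \<le> A * (B * (D * ?V) + B * (D * u 0))"
      using A B D u[of 0] by (intro mult_left_mono add_mono order_refl) auto
    also have "\<dots> = A * B * D * (u 0 + ?V)"
      by (simp add: algebra_simps)
    finally show "(\<Sum>n\<le>N. 2 powr (- (real n * (q - 1))) * circle_integral (smooth_power e q f) (1 - log_scale (Suc n)))
      \<le> A * B * D * (circle_integral (smooth_power e q f) 0
          + integral {0..1 - log_scale (Suc N)} (\<lambda>s. (1 - s) powr (2 * q - 1) * circle_integral (smooth_power e q (deriv f)) s * s))"
      using A B by (simp add: u_def v_def)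
  qed
qed

section \<open>Carleson boxes\<close>

text \<open>
  The angle is a real number and not a class modulo \<open>2 * pi\<close>: coverings and selections of boxes
  become coverings and selections of intervals of the line.
\<close>

definition polar_box :: "real \<Rightarrow> real \<Rightarrow> real \<Rightarrow> complex set" where
  "polar_box c w d = {of_real r * cis t | r t. \<bar>t - c\<bar> \<le> w \<and> 1 - d \<le> r \<and> 0 \<le> r \<and> r < 1}"

lemma polar_boxI:
  assumes "\<bar>t - c\<bar> \<le> w" "1 - d \<le> r" "0 \<le> r" "r < 1"
  shows "of_real r * cis t \<in> polar_box c w d"
  using assms unfolding polar_box_def by blast

lemma polar_box_subset_disc: "polar_box c w d \<subseteq> ball 0 1"
  by (auto simp: polar_box_def norm_mult)

lemma borel_truncated_cone:
  assumes "compact T" "0 \<le> a"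
  shows "{of_real r * cis t | r t. t \<in> T \<and> a \<le> r \<and> r < 1} \<in> sets borel"
proof -
  define K where "K = (\<lambda>x. of_real (fst x) * cis (snd x)) ` ({a..1} \<times> T)"
  have K: "of_real r * cis t \<in> K" if "a \<le> r" "r \<le> 1" "t \<in> T" for r t
    unfolding K_def by (rule image_eqI[of _ _ "(r, t)"]) (use that in simp_all)
  have "compact K"
    unfolding K_def
    by (intro compact_continuous_image continuous_intros compact_Times compact_Icc assms)
  then have "K \<inter> ball 0 1 \<in> sets borel"
    by (intro sets.Int[OF borel_compact borel_open] open_ball)
  moreover have "{of_real r * cis t | r t. t \<in> T \<and> a \<le> r \<and> r < 1} = K \<inter> ball 0 1"
  proof (intro subset_antisym subsetI)
    fix z assume "z \<in> {of_real r * cis t | r t. t \<in> T \<and> a \<le> r \<and> r < 1}"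
    then obtain r t where "z = of_real r * cis t" "t \<in> T" "a \<le> r" "r < 1" by blast
    then show "z \<in> K \<inter> ball 0 1" using assms(2) K[of r t] by (simp add: norm_mult)
  next
    fix z assume "z \<in> K \<inter> ball 0 1"
    then obtain r t where z: "z = of_real r * cis t" "t \<in> T" "a \<le> r" "norm z < 1"
      unfolding K_def by auto
    then have "r < 1" using assms(2) by (simp add: norm_mult)
    then show "z \<in> {of_real r * cis t | r t. t \<in> T \<and> a \<le> r \<and> r < 1}" using z by blast
  qed
  ultimately show ?thesis by (simp only:)
qed

lemma borel_polar_box: "polar_box c w d \<in> sets borel"
proof -
  have "polar_box c w d = {of_real r * cis t | r t. t \<in> {c - w..c + w} \<and> max 0 (1 - d) \<le> r \<and> r < 1}"
    unfolding polar_box_def by (rule Collect_cong) (auto simp: abs_le_iff algebra_simps)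
  then show ?thesis using borel_truncated_cone[of "{c - w..c + w}" "max 0 (1 - d)"] by simp
qed

lemma cis_eq_imp: assumes "cis s = cis t" obtains n :: int where "s = t + 2 * pi * n"
proof -
  have "cos s = cos t \<and> sin s = sin t" using assms by (simp add: complex_eq_iff)
  then show thesis using that sin_cos_eq_iff[of s t] by auto
qed

lemma cis_add_2pi_int: "cis (t + 2 * pi * of_int n) = cis t"
  by (simp flip: cis_mult)

lemma polar_box_periodic: "polar_box (c + 2 * pi * of_int n) w d \<subseteq> polar_box c w d"
proof
  fix z assume "z \<in> polar_box (c + 2 * pi * of_int n) w d"
  then obtain r t where z: "z = of_real r * cis t" "\<bar>t - (c + 2 * pi * of_int n)\<bar> \<le> w" "1 - d \<le> r" "0 \<le> r" "r < 1"
    unfolding polar_box_def by blast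
  have "z = of_real r * cis (t - 2 * pi * of_int n)"
    using cis_add_2pi_int[of "t - 2 * pi * of_int n" n] z(1) by simp
  moreover have "\<bar>(t - 2 * pi * of_int n) - c\<bar> \<le> w" using z(2) by (simp add: algebra_simps)
  ultimately show "z \<in> polar_box c w d" using z polar_boxI by blast
qed

lemma arc_length_le_1: "arc_length I \<le> 1"
proof (cases "{t \<in> {0..<2 * pi}. cis t \<in> I} \<in> sets lborel")
  case True
  have "measure lborel {t \<in> {0..<2 * pi}. cis t \<in> I} \<le> measure lborel {0..<2 * pi}"
    by (rule measure_mono_fmeasurable[OF _ True]) (auto intro!: fmeasurableI)
  then show ?thesis by (simp add: arc_length_def)
qed (simp add: arc_length_def measure_notin_sets)

lemma sets_cis_preimage:
  assumes "compact J"
  shows "{t \<in> {0..<2 * pi}. cis t \<in> cis ` J} \<in> sets borel"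
proof -
  have "closed (cis ` J)"
    using assms by (intro compact_imp_closed compact_continuous_image continuous_intros)
  then have cl: "closed (cis -` (cis ` J))"
    by (intro closed_vimage continuous_intros)
  have "{0..<2 * pi} \<inter> cis -` (cis ` J) \<in> sets borel"
    by (rule sets.Int[OF atLeastLessThan_borel borel_closed[OF cl]])
  moreover have "{0..<2 * pi} \<inter> cis -` (cis ` J) = {t \<in> {0..<2 * pi}. cis t \<in> cis ` J}" by blast
  ultimately show ?thesis by (simp only:)
qed

text \<open>
  At least one half of the interval lies in \<open>{0..<2 * pi}\<close>, and the points of that fundamental domain
  that it represents lie in at most three of its translates.  The loss of a constant is harmless.
\<close>

lemma arc_length_centred_bounds:
  assumes c: "0 \<le> c" "c < 2 * pi" and w: "0 < w" "w \<le> pi"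
  shows "w / (2 * pi) \<le> arc_length (cis ` {c - w..c + w})" "arc_length (cis ` {c - w..c + w}) \<le> 6 * w / (2 * pi)"
proof -
  define J where "J = {c - w..c + w}"
  define T where "T = {t \<in> {0..<2 * pi}. cis t \<in> cis ` J}"
  have T: "T \<in> sets borel" unfolding T_def by (rule sets_cis_preimage) (simp add: J_def)
  have Tsub: "T \<subseteq> {0..2 * pi}" by (auto simp: T_def)
  have fT: "T \<in> fmeasurable lborel"
    by (rule fmeasurableI2[OF fmeasurable_compact[OF compact_Icc] Tsub]) (use T in simp)
  have TI: "t \<in> T" if "0 \<le> t" "t < 2 * pi" "t \<in> J" for t
    unfolding T_def using that by (auto intro: imageI)
  have "w \<le> measure lborel T"
  proof (cases "c \<le> pi")
    case True
    have "{c..<c + w} \<subseteq> T"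
    proof
      fix t assume "t \<in> {c..<c + w}"
      then show "t \<in> T" using c w True by (intro TI) (auto simp: J_def)
    qed
    then have "measure lborel {c..<c + w} \<le> measure lborel T"
      by (intro measure_mono_fmeasurable fT) simp_all
    then show ?thesis using w by simp
  next
    case False
    have "{c - w<..c} \<subseteq> T"
    proof
      fix t assume "t \<in> {c - w<..c}"
      then show "t \<in> T" using c w False by (intro TI) (auto simp: J_def)
    qed
    then have "measure lborel {c - w<..c} \<le> measure lborel T"
      by (intro measure_mono_fmeasurable fT) simp_all
    then show ?thesis using w by simp
  qed
  then show "w / (2 * pi) \<le> arc_length (cis ` {c - w..c + w})"
    unfolding arc_length_def J_def[symmetric] T_def[symmetric] by (rule divide_right_mono) simp
  define U V where "U = {c - w + 2 * pi..c + w + 2 * pi}" and "V = {c - w - 2 * pi..c + w - 2 * pi}"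
  have st: "J \<in> sets lborel" "U \<in> sets lborel" "V \<in> sets lborel"
    unfolding J_def U_def V_def by simp_all
  have fm: "J \<in> fmeasurable lborel" "U \<in> fmeasurable lborel" "V \<in> fmeasurable lborel"
    unfolding J_def U_def V_def by (rule fmeasurable_compact[OF compact_Icc])+
  have sub: "T \<subseteq> J \<union> (U \<union> V)"
  proof
    fix t assume t: "t \<in> T"
    then obtain s where s: "s \<in> J" "cis t = cis s" unfolding T_def by blast
    from s(2) obtain n :: int where n: "t = s + 2 * pi * n" by (rule cis_eq_imp)
    have "- pi \<le> s" "s < 3 * pi" using s(1) c w by (auto simp: J_def)
    moreover have "0 \<le> t" "t < 2 * pi" using t by (auto simp: T_def)
    ultimately have "2 * pi * n < 2 * pi * 2" "2 * pi * (-2) < 2 * pi * n"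
      using n pi_gt_zero by linarith+
    then have "real_of_int n < 2" "-2 < real_of_int n"
      by (metis mult_less_cancel_left_pos pi_gt_zero zero_less_mult_iff zero_less_numeral of_int_numeral of_int_minus)+
    then have "n < 2" "-2 < n" by simp_all
    then have "n = -1 \<or> n = 0 \<or> n = 1" by linarith
    then show "t \<in> J \<union> (U \<union> V)"
      using s(1) n by (auto simp: J_def U_def V_def)
  qed
  have "measure lborel T \<le> measure lborel (J \<union> (U \<union> V))"
    by (rule measure_mono_fmeasurable[OF sub _ fmeasurable.Un[OF fm(1) fmeasurable.Un[OF fm(2,3)]]]) (simp add: T)
  also have "\<dots> \<le> measure lborel J + measure lborel (U \<union> V)"
    by (rule measure_Un_le[OF st(1) sets.Un[OF st(2,3)]])
  also have "\<dots> \<le> measure lborel J + (measure lborel U + measure lborel V)"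
    by (rule add_left_mono[OF measure_Un_le[OF st(2,3)]])
  also have "\<dots> = 6 * w" using w by (simp add: J_def U_def V_def)
  finally show "arc_length (cis ` {c - w..c + w}) \<le> 6 * w / (2 * pi)"
    unfolding arc_length_def J_def[symmetric] T_def[symmetric] by (rule divide_right_mono) simp
qed

text \<open>
  For \<open>h > 1 / 2\<close> the arc is the whole circle, because the interval of angles is then longer than a period.
\<close>

lemma polar_box_in_carleson_square:
  assumes h: "0 < h" "h \<le> 1" and c: "0 \<le> c" "c < 2 * pi"
  obtains I where "circle_arc I" "h \<le> arc_length I" "arc_length I \<le> 6 * h"
    "polar_box c (2 * pi * h) h \<subseteq> carleson_square I" "carleson_square I \<in> sets borel"
proof -
  have sq: "carleson_square (cis ` J) \<in> sets borel" if "compact J" for J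
  proof -
    have "carleson_square (cis ` J) = {of_real r * cis t | r t. t \<in> J \<and> 1 - arc_length (cis ` J) \<le> r \<and> r < 1}"
    proof (intro subset_antisym subsetI)
      fix z assume "z \<in> carleson_square (cis ` J)"
      then obtain r t s where z: "z = of_real r * cis t" "cis t = cis s" "s \<in> J" "1 - arc_length (cis ` J) \<le> r" "r < 1"
        unfolding carleson_square_def by blast
      then have "z = of_real r * cis s" by simp
      then show "z \<in> {of_real r * cis t | r t. t \<in> J \<and> 1 - arc_length (cis ` J) \<le> r \<and> r < 1}" using z by blast
    qed (auto simp: carleson_square_def)
    then show ?thesis
      using borel_truncated_cone[OF that, of "1 - arc_length (cis ` J)"] arc_length_le_1[of "cis ` J"] by simp
  qed
  show thesis
  proof (cases "h \<le> 1 / 2")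
    case True
    define J where "J = {c - 2 * pi * h..c + 2 * pi * h}"
    have J: "t \<in> J" if "\<bar>t - c\<bar> \<le> 2 * pi * h" for t using that by (auto simp: J_def abs_le_iff)
    have w: "0 < 2 * pi * h" "2 * pi * h \<le> pi" using h True by auto
    have 1: "h \<le> arc_length (cis ` J)" "arc_length (cis ` J) \<le> 6 * h"
      using arc_length_centred_bounds[OF c w, folded J_def] by simp_all
    show thesis
    proof (rule that[of "cis ` J"])
      have "is_interval J" by (simp add: J_def is_interval_cc)
      moreover have "0 < arc_length (cis ` J)" using 1(1) h(1) by linarith
      ultimately show "circle_arc (cis ` J)"
        unfolding circle_arc_def by blast
      show "polar_box c (2 * pi * h) h \<subseteq> carleson_square (cis ` J)"
      proof
        fix z assume "z \<in> polar_box c (2 * pi * h) h"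
        then obtain r t where z: "z = of_real r * cis t" "\<bar>t - c\<bar> \<le> 2 * pi * h" "1 - h \<le> r" "r < 1"
          unfolding polar_box_def by blast
        have "cis t \<in> cis ` J" using z(2) by (intro imageI J)
        moreover have "1 - arc_length (cis ` J) \<le> r" using 1 z(3) by linarith
        ultimately show "z \<in> carleson_square (cis ` J)" unfolding carleson_square_def using z by blast
      qed
      show "carleson_square (cis ` J) \<in> sets borel" by (rule sq) (simp add: J_def)
    qed (rule 1)+
  next
    case False
    define J where "J = {0..2 * pi}"
    have J: "t \<in> J" if "0 \<le> t" "t < 2 * pi" for t using that by (simp add: J_def)
    have "cis t \<in> cis ` J" if "t \<in> {0..<2 * pi}" for t
      using that by (intro imageI J) simp_all
    then have eq: "{t \<in> {0..<2 * pi}. cis t \<in> cis ` J} = {0..<2 * pi}" by blast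
    have "arc_length (cis ` J) = measure lborel {0..<2 * pi} / (2 * pi)"
      unfolding arc_length_def eq ..
    also have "\<dots> = 1" by simp
    finally have 1: "arc_length (cis ` J) = 1" .
    have all: "cis t \<in> cis ` J" for t
    proof -
      have "cis (Arg2pi (cis t)) = cis t"
        using Arg2pi_eq[of "cis t"] by (simp add: cis_conv_exp)
      moreover have "cis (Arg2pi (cis t)) \<in> cis ` J"
        using Arg2pi[of "cis t"] by (intro imageI J) auto
      ultimately show ?thesis by (simp only:)
    qed
    show thesis
    proof (rule that[of "cis ` J"])
      have "is_interval J" by (simp add: J_def is_interval_cc)
      then show "circle_arc (cis ` J)"
        unfolding circle_arc_def 1 by (intro conjI exI[of _ J]) simp_all
      show "polar_box c (2 * pi * h) h \<subseteq> carleson_square (cis ` J)"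
        unfolding polar_box_def carleson_square_def 1 using all by fastforce
      show "carleson_square (cis ` J) \<in> sets borel" by (rule sq) (simp add: J_def)
    qed (use h False in \<open>simp_all add: 1\<close>)
  qed
qed

lemma log_weight_comparable:
  fixes h l :: real
  assumes "0 < h" "h \<le> l" "l \<le> 6 * h" "l \<le> 1" "0 \<le> a"
  shows "ln (exp 1 / l) powr (- a) \<le> 3 powr a * (1 - ln h) powr (- a)"
proof -
  have L: "ln (exp 1 / l) = 1 - ln l" using assms by (simp add: ln_div)
  have l1: "1 \<le> 1 - ln l" using assms by simp
  have "ln (6::real) \<le> 2"
  proof -
    have "(6::real) \<le> (5 / 2) * (5 / 2)" by simp
    also have "\<dots> \<le> exp 1 * exp 1"
      using exp_lower_Taylor_quadratic[of 1] by (intro mult_mono) auto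
    also have "\<dots> = exp (2::real)" by (simp flip: exp_add)
    finally have "ln 6 \<le> ln (exp (2::real))" by (subst ln_le_cancel_iff) auto
    then show ?thesis by simp
  qed
  moreover have "ln l \<le> ln 6 + ln h"
  proof -
    have "ln l \<le> ln (6 * h)" using assms by simp
    then show ?thesis using assms by (simp add: ln_mult)
  qed
  moreover have "1 - y \<le> 3 * (1 - x)" if "b \<le> 2" "x \<le> b + y" "1 \<le> 1 - x" for b x y :: real
    using that by argo
  ultimately have le: "1 - ln h \<le> 3 * (1 - ln l)" using l1 by blast
  have h1: "0 < 1 - ln h" using assms ln_le_zero_iff[of h] by linarith
  have "m powr (- a) = 3 powr a * (3 * m) powr (- a)" if "1 \<le> m" for m :: real
    using that by (simp add: powr_mult powr_minus)
  from this[OF l1] have "(1 - ln l) powr (- a) = 3 powr a * (3 * (1 - ln l)) powr (- a)" .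
  also have "\<dots> \<le> 3 powr a * (1 - ln h) powr (- a)"
    using powr_mono2'[OF _ h1 le, of "- a"] assms(5) by (intro mult_left_mono) auto
  finally show ?thesis unfolding L .
qed

lemma emeasure_polar_box_le:
  assumes sets: "sets M = sets (restrict_space borel (ball 0 1))"
    and bound: "\<And>I. circle_arc I \<Longrightarrow> emeasure M (carleson_square I)
        \<le> ennreal (B * (arc_length I * ln (exp 1 / arc_length I) powr (- a)))"
    and a: "0 \<le> a" and B: "0 \<le> B" and h: "0 < h" "h \<le> 1"
  shows "emeasure M (polar_box c (2 * pi * h) h) \<le> ennreal (6 * 3 powr a * B * h * (1 - ln h) powr (- a))"
proof -
  define n where "n = \<lfloor>c / (2 * pi)\<rfloor>"
  define c' where "c' = c - 2 * pi * of_int n"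
  have "of_int n \<le> c / (2 * pi)" "c / (2 * pi) < of_int n + 1"
    by (auto simp: n_def)
  then have c': "0 \<le> c'" "c' < 2 * pi"
    by (simp_all add: c'_def field_simps)
  have sub: "polar_box c (2 * pi * h) h \<subseteq> polar_box c' (2 * pi * h) h"
    using polar_box_periodic[of c' n] by (simp add: c'_def)
  obtain I where I: "circle_arc I" "h \<le> arc_length I" "arc_length I \<le> 6 * h"
    "polar_box c' (2 * pi * h) h \<subseteq> carleson_square I" "carleson_square I \<in> sets borel"
    using polar_box_in_carleson_square[OF h c'] by blast
  have "carleson_square I \<subseteq> ball 0 1"
  proof
    fix z assume "z \<in> carleson_square I"
    then obtain r t where "z = of_real r * cis t" "1 - arc_length I \<le> r" "r < 1"
      unfolding carleson_square_def by blast
    then show "z \<in> ball 0 1" using arc_length_le_1[of I] by (simp add: norm_mult)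
  qed
  then have "carleson_square I \<in> sets M"
    unfolding sets using I(5) by (simp add: sets_restrict_space_iff)
  then have "emeasure M (polar_box c (2 * pi * h) h) \<le> emeasure M (carleson_square I)"
    using sub I(4) by (intro emeasure_mono) auto
  also have "\<dots> \<le> ennreal (B * (arc_length I * ln (exp 1 / arc_length I) powr (- a)))"
    by (rule bound[OF I(1)])
  also have "\<dots> \<le> ennreal (B * ((6 * h) * (3 powr a * (1 - ln h) powr (- a))))"
    using I h B a arc_length_le_1[of I]
    by (intro ennreal_leI mult_left_mono mult_mono log_weight_comparable) auto
  finally show ?thesis by (simp add: mult_ac)
qed

text \<open>
  Near the boundary the logarithmic gain at height \<open>\<tau>\<close> is available for boxes of any width: a box wider
  than \<open>\<tau>\<close> is cut into pieces of width \<open>\<tau>\<close>, and the logarithmic weight at a smaller height is better still.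
\<close>

lemma emeasure_polar_box_shell_le:
  assumes sets: "sets M = sets (restrict_space borel (ball 0 1))"
    and bound: "\<And>c h. 0 < h \<Longrightarrow> h \<le> 1 \<Longrightarrow> emeasure M (polar_box c (2 * pi * h) h) \<le> ennreal (K * h * (1 - ln h) powr (- a))"
    and a: "0 \<le> a" and K: "0 \<le> K" and h: "0 < h" and \<tau>: "0 < \<tau>" "\<tau> \<le> 1"
  shows "emeasure M (polar_box c (2 * pi * h) (min h \<tau>)) \<le> ennreal (2 * K * (1 - ln \<tau>) powr (- a) * h)"
proof -
  define L where "L = (1 - ln \<tau>) powr (- a)"
  have L0: "0 \<le> L" by (simp add: L_def)
  have l\<tau>: "0 < 1 - ln \<tau>" using \<tau> ln_le_zero_iff[of \<tau>] by linarith
  have meas: "polar_box c w d \<in> sets M" for c w d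
    unfolding sets using borel_polar_box polar_box_subset_disc by (simp add: sets_restrict_space_iff)
  show ?thesis
  proof (cases "h < \<tau>")
    case True
    have "ln h \<le> ln \<tau>" using h True by simp
    then have "(1 - ln h) powr (- a) \<le> L"
      unfolding L_def using a l\<tau> by (intro powr_mono2') auto
    then have "K * h * (1 - ln h) powr (- a) \<le> K * h * L"
      using K h by (intro mult_left_mono) auto
    also have "\<dots> \<le> 2 * K * L * h" using K h L0 by simp
    finally have "ennreal (K * h * (1 - ln h) powr (- a)) \<le> ennreal (2 * K * L * h)" by (rule ennreal_leI)
    with bound[of h c] True h \<tau> show ?thesis unfolding L_def by (auto intro: order_trans)
  next
    case False
    define n where "n = nat (\<lfloor>h / \<tau>\<rfloor> + 1)"
    have n: "h / \<tau> < real n" "real n \<le> 2 * (h / \<tau>)"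
    proof -
      have "1 \<le> h / \<tau>" using False \<tau> by simp
      moreover have "real n = of_int \<lfloor>h / \<tau>\<rfloor> + 1" using h \<tau> by (simp add: n_def)
      ultimately show "h / \<tau> < real n" "real n \<le> 2 * (h / \<tau>)"
        using of_int_floor_le[of "h / \<tau>"] floor_correct[of "h / \<tau>"] by linarith+
    qed
    define d where "d = (\<lambda>i::nat. c - 2 * pi * h + 2 * pi * \<tau> * (2 * real i + 1))"
    have sub: "polar_box c (2 * pi * h) (min h \<tau>) \<subseteq> (\<Union>i\<in>{..<n}. polar_box (d i) (2 * pi * \<tau>) \<tau>)"
    proof
      fix z assume "z \<in> polar_box c (2 * pi * h) (min h \<tau>)"
      then obtain r t where z: "z = of_real r * cis t" "\<bar>t - c\<bar> \<le> 2 * pi * h" "1 - \<tau> \<le> r" "0 \<le> r" "r < 1"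
        using False unfolding polar_box_def by auto
      define s where "s = (t - (c - 2 * pi * h)) / (4 * pi * \<tau>)"
      have t: "t = c - 2 * pi * h + 4 * pi * \<tau> * s" using \<tau> by (simp add: s_def)
      have s0: "0 \<le> s" using z(2) \<tau> by (simp add: s_def abs_le_iff)
      have "s \<le> (4 * pi * h) / (4 * pi * \<tau>)"
        unfolding s_def using z(2) \<tau> by (intro divide_right_mono) auto
      then have sn: "s < real n" using n by simp
      define i where "i = nat \<lfloor>s\<rfloor>"
      have i: "real i \<le> s" "s < real i + 1" using s0 by (auto simp: i_def)
      then have "i < n" using sn by linarith
      moreover have "\<bar>t - d i\<bar> \<le> 2 * pi * \<tau>"
      proof -
        have "t - d i = 2 * pi * \<tau> * (2 * s - (2 * real i + 1))" by (simp add: t d_def algebra_simps)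
        then have "\<bar>t - d i\<bar> = 2 * pi * \<tau> * \<bar>2 * s - (2 * real i + 1)\<bar>" using \<tau> by (simp add: abs_mult)
        also have "\<dots> \<le> 2 * pi * \<tau> * 1" using i \<tau> by (intro mult_left_mono) (auto simp: abs_le_iff)
        finally show ?thesis by simp
      qed
      ultimately show "z \<in> (\<Union>i\<in>{..<n}. polar_box (d i) (2 * pi * \<tau>) \<tau>)"
        using z polar_boxI by blast
    qed
    have "emeasure M (polar_box c (2 * pi * h) (min h \<tau>)) \<le> emeasure M (\<Union>i\<in>{..<n}. polar_box (d i) (2 * pi * \<tau>) \<tau>)"
      using meas by (intro emeasure_mono sub sets.finite_UN) auto
    also have "\<dots> \<le> (\<Sum>i\<in>{..<n}. emeasure M (polar_box (d i) (2 * pi * \<tau>) \<tau>))"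
      using meas by (intro emeasure_subadditive_finite) auto
    also have "\<dots> \<le> (\<Sum>i\<in>{..<n}. ennreal (K * \<tau> * L))"
      unfolding L_def by (intro sum_mono bound \<tau>)
    also have "\<dots> = ennreal (real n * (K * \<tau> * L))"
      using K \<tau> L0 by (subst sum_ennreal) auto
    also have "\<dots> \<le> ennreal (2 * (h / \<tau>) * (K * \<tau> * L))"
      using n K \<tau> L0 by (intro ennreal_leI mult_right_mono) auto
    also have "2 * (h / \<tau>) * (K * \<tau> * L) = 2 * K * L * h" using \<tau> by simp
    finally show ?thesis unfolding L_def .
  qed
qed

section \<open>The Poisson kernel\<close>

definition poisson_kernel :: "real \<Rightarrow> real \<Rightarrow> real \<Rightarrow> real" where
  "poisson_kernel R r x = (R\<^sup>2 - r\<^sup>2) / (R\<^sup>2 + r\<^sup>2 - 2 * R * r * cos x)"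

lemma poisson_denominator_ge:
  fixes r R x :: real
  assumes "0 \<le> r" "0 \<le> R"
  shows "(R - r)\<^sup>2 \<le> R\<^sup>2 + r\<^sup>2 - 2 * R * r * cos x"
proof -
  have "R * r * cos x \<le> R * r * 1" using assms by (intro mult_left_mono[OF cos_le_one]) auto
  then show ?thesis by (simp add: power2_diff)
qed

lemma norm_square_add_real_cis: "(norm (of_real R * cis t + of_real r))\<^sup>2 = R\<^sup>2 + r\<^sup>2 + 2 * R * r * cos t"
proof -
  have "(norm (of_real R * cis t + of_real r))\<^sup>2 = (R * cos t + r)\<^sup>2 + (R * sin t)\<^sup>2"
    by (simp add: cmod_power2)
  also have "\<dots> = R\<^sup>2 + r\<^sup>2 + 2 * R * r * cos t"
    unfolding power_mult_distrib sin_squared_eq by (simp add: algebra_simps power2_eq_square)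
  finally show ?thesis .
qed

text \<open>
  Cauchy's formula on the circle of radius \<open>R\<close> for the function \<open>w \<mapsto> f (\<omega> w) / (R\<^sup>2 + r w)\<close> at the
  point \<open>- r\<close>: on the circle \<open>(R\<^sup>2 + r w) * (w + r) = w * |w + r|\<^sup>2\<close>.  The rotation \<open>\<omega>\<close> puts the
  point on the negative axis, so that the parameter interval \<open>{0..2 * pi}\<close> becomes the interval of
  length \<open>2 * pi\<close> centred at the angle \<open>\<alpha>\<close>, and no distances modulo \<open>2 * pi\<close> occur.
\<close>

lemma poisson_formula:
  assumes f: "f holomorphic_on ball 0 1" and r: "0 \<le> r" "r < R" "R < 1"
  shows "((\<lambda>s. of_real (poisson_kernel R r (s - \<alpha>)) * f (of_real R * cis s)) has_integral
            of_real (2 * pi) * f (of_real r * cis \<alpha>)) {\<alpha> - pi..\<alpha> + pi}"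
proof -
  define \<omega> where "\<omega> = cis (\<alpha> - pi)"
  define F where "F = (\<lambda>w. f (\<omega> * w) / (of_real (R\<^sup>2) + of_real r * w))"
  have R: "0 < R" using r by simp
  have nz: "of_real (R\<^sup>2) + of_real r * w \<noteq> 0" if "norm w \<le> R" for w :: complex
  proof
    assume "of_real (R\<^sup>2) + of_real r * w = 0"
    then have "of_real r * w = - of_real (R\<^sup>2)" by (simp add: add_eq_0_iff)
    then have "norm (of_real r * w) = norm (of_real (R\<^sup>2) :: complex)" by (simp only: norm_minus_cancel)
    then have "r * norm w = R\<^sup>2" using r by (simp add: norm_mult norm_power)
    moreover have "r * norm w \<le> r * R" using that r by (intro mult_left_mono) auto
    moreover have "r * R < R * R" using r R by simp
    ultimately show False by (simp add: power2_eq_square)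
  qed
  have "(\<lambda>w. f (\<omega> * w)) holomorphic_on cball 0 R"
    using holomorphic_on_compose_gen[of "\<lambda>w. \<omega> * w" "cball 0 R" f "ball 0 1"] r f
    by (force simp: o_def norm_mult \<omega>_def intro!: holomorphic_intros)
  then have "F holomorphic_on cball 0 R"
    unfolding F_def using nz by (intro holomorphic_intros) auto
  then have "((\<lambda>u. F u / (u - (- of_real r))) has_contour_integral 2 * of_real pi * \<i> * F (- of_real r)) (circlepath 0 R)"
    using r by (intro Cauchy_integral_circlepath_simple) auto
  then have 1: "((\<lambda>t. F (of_real R * cis t) / (of_real R * cis t + of_real r) * of_real R * \<i> * cis t) has_integral
      2 * of_real pi * \<i> * F (- of_real r)) {0..2 * pi}"
    unfolding circlepath_def by (subst (asm) has_contour_integral_part_circlepath_iff) auto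
  have F0: "F (- of_real r) = f (of_real r * cis \<alpha>) / of_real (R\<^sup>2 - r\<^sup>2)"
    by (simp add: F_def \<omega>_def power2_eq_square cis_divide[symmetric] mult.commute)
  have int: "F (of_real R * cis t) / (of_real R * cis t + of_real r) * of_real R * \<i> * cis t
      = \<i> * (f (\<omega> * (of_real R * cis t)) / of_real (R\<^sup>2 + r\<^sup>2 + 2 * R * r * cos t))" for t
  proof -
    let ?w = "of_real R * cis t"
    have w: "?w \<noteq> 0" using R by simp
    have "cnj ?w * ?w = of_real (R\<^sup>2)" 
      using complex_norm_square[of ?w] by (simp add: norm_mult mult.commute power2_eq_square)
    then have "of_real (R\<^sup>2) + of_real r * ?w = ?w * cnj (?w + of_real r)"
      by (simp add: algebra_simps)
    then have "(of_real (R\<^sup>2) + of_real r * ?w) * (?w + of_real r) = ?w * ((?w + of_real r) * cnj (?w + of_real r))"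
      by (simp only: mult_ac)
    also have "\<dots> = ?w * of_real (R\<^sup>2 + r\<^sup>2 + 2 * R * r * cos t)"
      by (simp only: complex_norm_square[symmetric] norm_square_add_real_cis)
    finally have den: "(of_real (R\<^sup>2) + of_real r * ?w) * (?w + of_real r) = ?w * of_real (R\<^sup>2 + r\<^sup>2 + 2 * R * r * cos t)" .
    have "F ?w / (?w + of_real r) * of_real R * \<i> * cis t = \<i> * (?w * f (\<omega> * ?w)) / ((of_real (R\<^sup>2) + of_real r * ?w) * (?w + of_real r))"
      by (simp add: F_def)
    also have "\<dots> = \<i> * (f (\<omega> * ?w) / of_real (R\<^sup>2 + r\<^sup>2 + 2 * R * r * cos t))"
      unfolding den using w by simp
    finally show ?thesis .
  qed
  have "r\<^sup>2 < R\<^sup>2" using r by (intro power_strict_mono) auto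
  then have "R\<^sup>2 - r\<^sup>2 \<noteq> 0" by simp
  then have nz': "of_real (R\<^sup>2 - r\<^sup>2) \<noteq> (0::complex)" by (simp only: of_real_eq_0_iff) simp
  define c :: complex where "c = of_real (R\<^sup>2 - r\<^sup>2)"
  have c: "c \<noteq> 0" using nz' by (simp only: c_def not_False_eq_True)
  have "2 * of_real pi * \<i> * F (- of_real r) = (\<i> / c) * (of_real (2 * pi) * f (of_real r * cis \<alpha>))"
    unfolding F0 c_def[symmetric] by simp
  then have rhs: "c / \<i> * (2 * of_real pi * \<i> * F (- of_real r)) = of_real (2 * pi) * f (of_real r * cis \<alpha>)"
    using c by simp
  have lhs: "c / \<i> * (\<i> * x) = c * x" for x
  proof -
    have "c / d * (d * x) = c * x" if "d \<noteq> 0" for d using that by simp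
    from this[OF complex_i_not_zero] show ?thesis .
  qed
  have 2: "((\<lambda>t. of_real (R\<^sup>2 - r\<^sup>2) * (f (\<omega> * (of_real R * cis t)) / of_real (R\<^sup>2 + r\<^sup>2 + 2 * R * r * cos t))) has_integral
      of_real (2 * pi) * f (of_real r * cis \<alpha>)) {0..2 * pi}"
    using has_integral_mult_right[OF 1[unfolded int], of "c / \<i>"]
    by (simp only: lhs rhs c_def[symmetric])
  have 3: "of_real (R\<^sup>2 - r\<^sup>2) * (f (\<omega> * (of_real R * cis t)) / of_real (R\<^sup>2 + r\<^sup>2 + 2 * R * r * cos t))
      = of_real (poisson_kernel R r (t + (\<alpha> - pi) - \<alpha>)) * f (of_real R * cis (t + (\<alpha> - pi)))" for t
  proof -
    have "cos (t + (\<alpha> - pi) - \<alpha>) = - cos t" by simp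
    moreover have "\<omega> * (of_real R * cis t) = of_real R * cis (t + (\<alpha> - pi))"
      by (simp add: \<omega>_def cis_mult mult.left_commute add.commute)
    ultimately show ?thesis by (simp only: poisson_kernel_def) (simp del: of_real_diff of_real_power)
  qed
  show ?thesis
    using has_integral_affinity'[OF 2[unfolded 3 cbox_interval[symmetric]], of 1 "- (\<alpha> - pi)"]
    by (simp add: algebra_simps)
qed

lemma sin_ge_chord:
  assumes "0 \<le> y" "y \<le> pi / 2"
  shows "2 * y / pi \<le> sin y"
proof -
  have "concave_on {0..pi} sin"
    by (rule f''_le0_imp_concave[where f' = cos and f'' = "\<lambda>x. - sin x"])
       (auto intro!: derivative_eq_intros sin_ge_zero)
  then have "(1 - t) * sin 0 + t * sin (pi / 2) \<le> sin ((1 - t) *\<^sub>R 0 + t *\<^sub>R (pi / 2))" if "0 \<le> t" "t \<le> 1" for t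
    using that concave_onD[of "{0..pi}" sin t 0 "pi / 2"] by simp
  from this[of "2 * y / pi"] show ?thesis using assms by (simp add: field_simps)
qed

lemma poisson_kernel_bounds:
  assumes r: "0 \<le> r" and R: "3 / 4 \<le> R" "R < 1" "1 - R \<le> (1 - r) / 2"
  shows "0 \<le> poisson_kernel R r x" "poisson_kernel R r x \<le> 4 / (1 - r)"
    "x \<noteq> 0 \<Longrightarrow> \<bar>x\<bar> \<le> pi \<Longrightarrow> poisson_kernel R r x \<le> 4 * pi\<^sup>2 * (1 - r) / x\<^sup>2"
proof -
  let ?D = "R\<^sup>2 + r\<^sup>2 - 2 * R * r * cos x"
  have rR: "r < R" "(1 - r) / 2 \<le> R - r" "0 < 1 - r" "0 < R - r" using R r by (auto simp: field_simps)
  have D: "(R - r)\<^sup>2 \<le> ?D" using poisson_denominator_ge[of r R x] r R by simp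
  have D0: "0 < ?D" using D rR zero_less_power[of "R - r" 2] by linarith
  have num: "R\<^sup>2 - r\<^sup>2 = (R + r) * (R - r)" by (simp add: power2_eq_square algebra_simps)
  have num0: "0 \<le> R\<^sup>2 - r\<^sup>2" unfolding num using rR r by simp
  show "0 \<le> poisson_kernel R r x" unfolding poisson_kernel_def using D0 num0 by simp
  have "poisson_kernel R r x \<le> (R + r) * (R - r) / (R - r)\<^sup>2"
    unfolding poisson_kernel_def num[symmetric] using D rR num0 D0 by (intro divide_left_mono) auto
  also have "\<dots> = (R + r) / (R - r)" using rR by (simp add: power2_eq_square)
  also have "\<dots> \<le> 2 / ((1 - r) / 2)" using rR R r by (intro frac_le) auto
  finally show "poisson_kernel R r x \<le> 4 / (1 - r)" by simp
  assume x: "x \<noteq> 0" "\<bar>x\<bar> \<le> pi"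
  have D2: "R\<^sup>2 * ((1 - cos x) / 2) \<le> ?D"
  proof (cases "0 \<le> cos x")
    case True
    have "R\<^sup>2 * ((1 - cos x) / 2) \<le> R\<^sup>2 * ((1 - cos x) * (1 + cos x))"
      using True mult_left_mono[of "1/2" "1 + cos x" "1 - cos x"] by (intro mult_left_mono) auto
    also have "\<dots> = ?D - (r - R * cos x)\<^sup>2" by (simp add: power2_eq_square algebra_simps)
    finally show ?thesis using zero_le_power2[of "r - R * cos x"] by linarith
  next
    case False
    have "R\<^sup>2 * ((1 - cos x) / 2) \<le> R\<^sup>2 * 1"
      using cos_ge_minus_one[of x] by (intro mult_left_mono) auto
    moreover have "2 * R * r * cos x \<le> 0" using False R r by (intro mult_nonneg_nonpos) auto
    ultimately show ?thesis using zero_le_power2[of r] by linarith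
  qed
  have "1 - cos x = 2 * (sin (\<bar>x\<bar> / 2))\<^sup>2"
    using cos_double_sin[of "x / 2"] by (auto simp: abs_if)
  moreover have "\<bar>x\<bar> / pi \<le> sin (\<bar>x\<bar> / 2)"
    using sin_ge_chord[of "\<bar>x\<bar> / 2"] x by simp
  ultimately have "(\<bar>x\<bar> / pi)\<^sup>2 \<le> (1 - cos x) / 2"
    by (simp add: power_mono)
  then have "x\<^sup>2 / pi\<^sup>2 \<le> (1 - cos x) / 2" by (simp add: power_divide)
  then have "(3 / 4)\<^sup>2 * (x\<^sup>2 / pi\<^sup>2) \<le> R\<^sup>2 * ((1 - cos x) / 2)"
    using R by (intro mult_mono power_mono) auto
  moreover have "(1 / 2) * (x\<^sup>2 / pi\<^sup>2) \<le> (3 / 4)\<^sup>2 * (x\<^sup>2 / pi\<^sup>2)"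
    by (intro mult_right_mono) (auto simp: power2_eq_square)
  ultimately have D3: "(1 / 2) * (x\<^sup>2 / pi\<^sup>2) \<le> ?D"
    using D2 by linarith
  have "poisson_kernel R r x \<le> (2 * (1 - r)) / ((1 / 2) * (x\<^sup>2 / pi\<^sup>2))"
    unfolding poisson_kernel_def num using D3 x rR R r by (intro frac_le mult_mono) auto
  then show "poisson_kernel R r x \<le> 4 * pi\<^sup>2 * (1 - r) / x\<^sup>2"
    by (simp add: algebra_simps)
qed

lemma nn_integral_Icc_continuous:
  fixes h :: "real \<Rightarrow> real"
  assumes c: "continuous_on {a..b} h" and n: "\<And>x. x \<in> {a..b} \<Longrightarrow> 0 \<le> h x"
  shows "(\<integral>\<^sup>+x. ennreal (h x) * indicator {a..b} x \<partial>lborel) = ennreal (integral {a..b} h)"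
proof -
  let ?k = "\<lambda>x. indicator {a..b} x *\<^sub>R h x"
  have "(\<integral>\<^sup>+x. ennreal (h x) * indicator {a..b} x \<partial>lborel) = (\<integral>\<^sup>+x. ennreal (?k x) \<partial>lborel)"
    by (intro nn_integral_cong) (simp split: split_indicator)
  also have "\<dots> = ennreal (integral {a..b} h)"
  proof (rule nn_integral_has_integral_lborel)
    show "?k \<in> borel_measurable borel"
      by (rule borel_measurable_continuous_on_indicator[OF _ c]) simp
    show "0 \<le> ?k x" for x using n by (simp split: split_indicator)
    have "((\<lambda>x. if x \<in> {a..b} then h x else 0) has_integral integral {a..b} h) UNIV"
      using integrable_integral[OF integrable_continuous_real[OF c]] by (simp only: has_integral_restrict_UNIV)
    moreover have "(\<lambda>x. if x \<in> {a..b} then h x else 0) = ?k" by (simp add: fun_eq_iff split: split_indicator)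
    ultimately show "(?k has_integral integral {a..b} h) UNIV" by simp
  qed
  finally show ?thesis .
qed

text \<open>
  The kernel decays quadratically at distances beyond \<open>1 - r\<close>: it is dominated by a geometric
  combination of normalised indicator functions of centred intervals.
\<close>

lemma poisson_kernel_dyadic_bound:
  assumes r: "0 \<le> r" and R: "3 / 4 \<le> R" "R < 1" "1 - R \<le> (1 - r) / 2"
    and N: "1 / 2 \<le> 2 ^ N * (1 - r)" and x: "\<bar>x\<bar> \<le> pi"
  shows "poisson_kernel R r x \<le> (\<Sum>k\<le>N. 4 / (1 - r) * (1 / 4) ^ k * indicator {- (2 * pi * (2 ^ k * (1 - r)))..2 * pi * (2 ^ k * (1 - r))} x)"
proof -
  define d where "d = 1 - r"
  have d: "0 < d" using R by (simp add: d_def)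
  define P where "P = (\<lambda>k. \<bar>x\<bar> \<le> 2 * pi * (2 ^ k * d))"
  have "2 * pi * (1 / 2) \<le> 2 * pi * (2 ^ N * d)"
    using N by (intro mult_left_mono) (auto simp: d_def)
  then have "P N" using x unfolding P_def by linarith
  define k where "k = (LEAST k. P k)"
  have Pk: "P k" and kN: "k \<le> N" unfolding k_def using \<open>P N\<close> by (auto intro: LeastI Least_le)
  have le: "poisson_kernel R r x \<le> 4 / d * (1 / 4) ^ k"
  proof (cases k)
    case 0
    then show ?thesis using poisson_kernel_bounds(2)[OF r R, of x] by (simp add: d_def)
  next
    case (Suc j)
    then have "\<not> P j" using not_less_Least[of j P] by (simp add: k_def)
    then have xj: "2 * pi * (2 ^ j * d) < \<bar>x\<bar>" by (simp add: P_def)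
    have pos: "0 < 2 * pi * (2 ^ j * d)" using d by simp
    have "(2 * pi * (2 ^ j * d))\<^sup>2 \<le> x\<^sup>2"
      using xj pos by (subst abs_le_square_iff[symmetric]) simp
    then have sq: "pi\<^sup>2 * (4 ^ k * d\<^sup>2) \<le> x\<^sup>2"
      using Suc by (simp add: power_mult_distrib power_even_eq[symmetric] power2_eq_square mult_ac flip: power_mult_distrib)
    have x0: "x \<noteq> 0" using xj pos by (metis abs_zero less_asym)
    then have "poisson_kernel R r x \<le> 4 * pi\<^sup>2 * d / x\<^sup>2"
      using poisson_kernel_bounds(3)[OF r R, of x] x by (simp add: d_def)
    also have "\<dots> \<le> 4 * pi\<^sup>2 * d / (pi\<^sup>2 * (4 ^ k * d\<^sup>2))"
      using d sq x0 by (intro divide_left_mono) auto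
    also have "\<dots> = 4 / d * (1 / 4) ^ k"
      using d by (simp add: power2_eq_square power_one_over field_simps)
    finally show ?thesis .
  qed
  also have "\<dots> = 4 / d * (1 / 4) ^ k * indicator {- (2 * pi * (2 ^ k * d))..2 * pi * (2 ^ k * d)} x"
    using Pk by (auto simp: P_def abs_le_iff indicator_def)
  also have "\<dots> \<le> (\<Sum>k\<le>N. 4 / d * (1 / 4) ^ k * indicator {- (2 * pi * (2 ^ k * d))..2 * pi * (2 ^ k * d)} x)"
    using kN d by (intro member_le_sum) auto
  finally show ?thesis by (simp add: d_def)
qed

lemma poisson_integral_le_averages:
  fixes g :: "real \<Rightarrow> real"
  assumes r: "0 \<le> r" and R: "3 / 4 \<le> R" "R < 1" "1 - R \<le> (1 - r) / 2"
    and g: "continuous_on UNIV g" "\<And>s. 0 \<le> g s" and \<kappa>: "0 \<le> \<kappa>"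
    and avg: "\<And>h. 1 - r \<le> h \<Longrightarrow> h \<le> 1 \<Longrightarrow> integral {\<alpha> - 2 * pi * h..\<alpha> + 2 * pi * h} g \<le> \<kappa> * h"
  shows "integral {\<alpha> - pi..\<alpha> + pi} (\<lambda>s. poisson_kernel R r (s - \<alpha>) * g s) \<le> 8 * \<kappa>"
proof -
  define d where "d = 1 - r"
  have d: "0 < d" "d \<le> 1" using R r by (auto simp: d_def)
  obtain N :: nat where N: "1 / 2 \<le> 2 ^ N * d" "2 ^ N * d \<le> 1"
  proof -
    obtain M :: nat where "1 / d < 2 ^ M" using real_arch_pow[of 2 "1 / d"] by auto
    then have M: "1 / 2 \<le> 2 ^ M * d" using d by (simp add: field_simps)
    define N where "N = (LEAST n. 1 / 2 \<le> 2 ^ n * d)"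
    have "1 / 2 \<le> 2 ^ N * d" unfolding N_def using M by (rule LeastI)
    moreover have "2 ^ N * d \<le> 1"
    proof (cases N)
      case (Suc j)
      then have "\<not> 1 / 2 \<le> 2 ^ j * d" using not_less_Least[of j "\<lambda>n. 1 / 2 \<le> 2 ^ n * d"] by (simp add: N_def)
      then show ?thesis using Suc by simp
    qed (use d in simp)
    ultimately show ?thesis using that by blast
  qed
  have gm[measurable]: "g \<in> borel_measurable borel" by (rule borel_measurable_continuous_onI[OF g(1)])
  have cg: "continuous_on A g" for A by (rule continuous_on_subset[OF g(1)]) simp
  have den: "R\<^sup>2 + r\<^sup>2 - 2 * R * r * cos x \<noteq> 0" for x
  proof -
    have "0 < (R - r)\<^sup>2" using R by simp
    then show ?thesis using poisson_denominator_ge[of r R x] r R by linarith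
  qed
  let ?P = "\<lambda>s. poisson_kernel R r (s - \<alpha>) * g s"
  have cP: "continuous_on {\<alpha> - pi..\<alpha> + pi} ?P"
    unfolding poisson_kernel_def by (intro continuous_intros cg) (use den in auto)
  let ?J = "\<lambda>k. {\<alpha> - 2 * pi * (2 ^ k * d)..\<alpha> + 2 * pi * (2 ^ k * d)}"
  have "ennreal (integral {\<alpha> - pi..\<alpha> + pi} ?P) = (\<integral>\<^sup>+s. ennreal (?P s) * indicator {\<alpha> - pi..\<alpha> + pi} s \<partial>lborel)"
    using g(2) poisson_kernel_bounds(1)[OF r R] by (intro nn_integral_Icc_continuous[symmetric] cP) auto
  also have "\<dots> \<le> (\<integral>\<^sup>+s. (\<Sum>k\<le>N. ennreal (4 / d * (1 / 4) ^ k) * (ennreal (g s) * indicator (?J k) s)) \<partial>lborel)"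
  proof (rule nn_integral_mono)
    fix s
    show "ennreal (?P s) * indicator {\<alpha> - pi..\<alpha> + pi} s \<le> (\<Sum>k\<le>N. ennreal (4 / d * (1 / 4) ^ k) * (ennreal (g s) * indicator (?J k) s))"
    proof (cases "s \<in> {\<alpha> - pi..\<alpha> + pi}")
      case True
      then have x: "\<bar>s - \<alpha>\<bar> \<le> pi" by (auto simp: abs_le_iff)
      have "?P s \<le> (\<Sum>k\<le>N. 4 / d * (1 / 4) ^ k * indicator {- (2 * pi * (2 ^ k * d))..2 * pi * (2 ^ k * d)} (s - \<alpha>)) * g s"
        using poisson_kernel_dyadic_bound[OF r R N(1)[unfolded d_def] x] g(2) unfolding d_def
        by (intro mult_right_mono) auto
      also have "\<dots> = (\<Sum>k\<le>N. 4 / d * (1 / 4) ^ k * (g s * indicator (?J k) s))"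
        unfolding sum_distrib_right by (intro sum.cong) (auto simp: indicator_def algebra_simps)
      finally have "ennreal (?P s) \<le> ennreal (\<Sum>k\<le>N. 4 / d * (1 / 4) ^ k * (g s * indicator (?J k) s))"
        by (rule ennreal_leI)
      also have "\<dots> = (\<Sum>k\<le>N. ennreal (4 / d * (1 / 4) ^ k * (g s * indicator (?J k) s)))"
        using g(2) d by (intro sum_ennreal[symmetric]) auto
      also have "\<dots> = (\<Sum>k\<le>N. ennreal (4 / d * (1 / 4) ^ k) * (ennreal (g s) * indicator (?J k) s))"
      proof (rule sum.cong[OF refl])
        fix k
        have "0 \<le> 4 / d * (1 / 4) ^ k" using d by simp
        from ennreal_mult[OF this g(2)[of s]]
        show "ennreal (4 / d * (1 / 4) ^ k * (g s * indicator (?J k) s)) = ennreal (4 / d * (1 / 4) ^ k) * (ennreal (g s) * indicator (?J k) s)"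
          by (cases "s \<in> ?J k") simp_all
      qed
      finally show ?thesis using True by simp
    qed simp
  qed
  also have "\<dots> = (\<Sum>k\<le>N. \<integral>\<^sup>+s. ennreal (4 / d * (1 / 4) ^ k) * (ennreal (g s) * indicator (?J k) s) \<partial>lborel)"
    by (rule nn_integral_sum) measurable
  also have "\<dots> = (\<Sum>k\<le>N. ennreal (4 / d * (1 / 4) ^ k) * ennreal (integral (?J k) g))"
    using g by (intro sum.cong refl) (simp add: nn_integral_cmult nn_integral_Icc_continuous[OF cg])
  also have "\<dots> \<le> (\<Sum>k\<le>N. ennreal (4 / d * (1 / 4) ^ k) * ennreal (\<kappa> * (2 ^ k * d)))"
  proof (intro sum_mono mult_left_mono ennreal_leI avg)
    fix k assume "k \<in> {..N}"
    then have "2 ^ k * d \<le> 2 ^ N * d" using d by (intro mult_right_mono power_increasing) auto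
    then show "2 ^ k * d \<le> 1" using N by linarith
    have "1 * d \<le> 2 ^ k * d" using d by (intro mult_right_mono) auto
    then show "1 - r \<le> 2 ^ k * d" by (simp add: d_def)
  qed simp_all
  also have "\<dots> = (\<Sum>k\<le>N. ennreal (4 * \<kappa> * (1 / 2) ^ k))"
  proof (rule sum.cong[OF refl])
    fix k
    have "(1 / 4) ^ k * 2 ^ k = (1 / 2 :: real) ^ k" by (simp flip: power_mult_distrib)
    then have "4 / d * (1 / 4) ^ k * (\<kappa> * (2 ^ k * d)) = 4 * \<kappa> * (1 / 2) ^ k"
      using d by (simp add: mult_ac) 
    then show "ennreal (4 / d * (1 / 4) ^ k) * ennreal (\<kappa> * (2 ^ k * d)) = ennreal (4 * \<kappa> * (1 / 2) ^ k)"
      using d \<kappa> by (simp flip: ennreal_mult)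
  qed
  also have "\<dots> = ennreal (4 * \<kappa> * (\<Sum>k\<le>N. (1 / 2) ^ k))"
    using \<kappa> by (subst sum_ennreal) (auto simp: sum_distrib_left)
  also have "\<dots> \<le> ennreal (4 * \<kappa> * 2)"
  proof (intro ennreal_leI mult_left_mono)
    have "(\<Sum>k\<le>N. (1 / 2 :: real) ^ k) = 2 - (1 / 2) ^ N"
      by (induction N) (auto simp: field_simps)
    then show "(\<Sum>k\<le>N. (1 / 2 :: real) ^ k) \<le> 2" by simp
  qed (use \<kappa> in simp)
  finally show ?thesis using \<kappa> by (simp add: ennreal_le_iff)
qed

text \<open>
  Subtracting \<open>l / 2\<close> from the boundary values costs only \<open>l / 2\<close>, because the Poisson kernel has mean one.
  What remains is supported where the boundary values exceed \<open>l / 2\<close>, and this truncation makes the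
  integration over the levels \<open>l\<close> converge.
\<close>

lemma large_value_imp_large_average:
  assumes f: "f holomorphic_on ball 0 1"
    and r: "0 \<le> r" and R: "3 / 4 \<le> R" "R < 1" "1 - R \<le> (1 - r) / 2" "r < 1"
    and l: "0 < l" "l < norm (f (of_real r * cis \<alpha>))"
  obtains h where "1 - r \<le> h" "h \<le> 1"
    "pi / 8 * l * h < integral {\<alpha> - 2 * pi * h..\<alpha> + 2 * pi * h} (\<lambda>s. max 0 (norm (f (of_real R * cis s)) - l / 2))"
proof (rule ccontr)
  note big = that
  assume "\<not> thesis"
  then have avg: "integral {\<alpha> - 2 * pi * h..\<alpha> + 2 * pi * h} (\<lambda>s. max 0 (norm (f (of_real R * cis s)) - l / 2)) \<le> pi / 8 * l * h"
    if "1 - r \<le> h" "h \<le> 1" for h using that big by (meson not_less)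
  define g where "g = (\<lambda>s. norm (f (of_real R * cis s)))"
  let ?g1 = "\<lambda>s. max 0 (g s - l / 2)"
  let ?P = "\<lambda>s. poisson_kernel R r (s - \<alpha>)"
  have rR: "r < R" using R r by (simp add: field_simps)
  have cg: "continuous_on A g" for A
    unfolding g_def
    using R by (intro continuous_intros continuous_on_circle holomorphic_on_imp_continuous_on f) auto
  have den: "R\<^sup>2 + r\<^sup>2 - 2 * R * r * cos x \<noteq> 0" for x
  proof -
    have "0 < (R - r)\<^sup>2" using rR by simp
    then show ?thesis using poisson_denominator_ge[of r R x] r R by linarith
  qed
  have cP: "continuous_on A ?P" for A
    unfolding poisson_kernel_def by (intro continuous_intros) (use den in auto)
  have P0: "0 \<le> ?P s" for s using poisson_kernel_bounds(1)[OF r R(1-3)] by simp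
  note F = poisson_formula[OF f r rR R(2), of \<alpha>]
  have "((\<lambda>s. of_real (?P s) * (1::complex)) has_integral of_real (2 * pi) * 1) {\<alpha> - pi..\<alpha> + pi}"
    by (rule poisson_formula[OF _ r rR R(2), of "\<lambda>_. 1"]) simp
  from has_integral_Re[OF this] have one: "(?P has_integral 2 * pi) {\<alpha> - pi..\<alpha> + pi}"
    by simp
  have "2 * pi * norm (f (of_real r * cis \<alpha>)) = norm (integral {\<alpha> - pi..\<alpha> + pi} (\<lambda>s. of_real (?P s) * f (of_real R * cis s)))"
    using F by (simp add: integral_unique norm_mult)
  also have "\<dots> \<le> integral {\<alpha> - pi..\<alpha> + pi} (\<lambda>s. ?P s * g s)"
  proof (rule integral_norm_bound_integral[OF has_integral_integrable[OF F]])
    show "(\<lambda>s. ?P s * g s) integrable_on {\<alpha> - pi..\<alpha> + pi}"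
      by (intro integrable_continuous_real continuous_intros cP cg)
  qed (use P0 in \<open>simp add: norm_mult g_def\<close>)
  also have "\<dots> \<le> integral {\<alpha> - pi..\<alpha> + pi} (\<lambda>s. ?P s * ?g1 s + l / 2 * ?P s)"
  proof (intro integral_le integrable_continuous_real continuous_intros cP cg)
    fix s
    have "?P s * g s \<le> ?P s * (?g1 s + l / 2)" using P0 by (intro mult_left_mono) auto
    then show "?P s * g s \<le> ?P s * ?g1 s + l / 2 * ?P s" by (simp add: algebra_simps)
  qed
  also have "\<dots> = integral {\<alpha> - pi..\<alpha> + pi} (\<lambda>s. ?P s * ?g1 s) + l / 2 * (2 * pi)"
  proof (rule integral_unique)
    show "((\<lambda>s. ?P s * ?g1 s + l / 2 * ?P s) has_integral
        integral {\<alpha> - pi..\<alpha> + pi} (\<lambda>s. ?P s * ?g1 s) + l / 2 * (2 * pi)) {\<alpha> - pi..\<alpha> + pi}"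
      by (intro has_integral_add has_integral_mult_right one integrable_integral integrable_continuous_real continuous_intros cP cg)
  qed
  also have "integral {\<alpha> - pi..\<alpha> + pi} (\<lambda>s. ?P s * ?g1 s) \<le> 8 * (pi / 8 * l)"
    using avg l by (intro poisson_integral_le_averages[OF r R(1-3)] continuous_intros cg) (auto simp: g_def)
  finally have "2 * pi * norm (f (of_real r * cis \<alpha>)) \<le> 2 * pi * l" by simp
  then show False using l by simp
qed

section \<open>The Carleson embedding on a circle\<close>

text \<open>
  Sums a comparison of measures over the countable family that a Vitali selection yields.
\<close>

lemma emeasure_UN_le_disjoint_UN:
  assumes C: "countable C"
    and A: "\<And>i. i \<in> C \<Longrightarrow> A i \<in> sets M" and B: "\<And>i. i \<in> C \<Longrightarrow> B i \<in> sets D"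
    and disj: "disjoint_family_on B C"
    and le: "\<And>i. i \<in> C \<Longrightarrow> emeasure M (A i) \<le> a * emeasure D (B i)"
  shows "emeasure M (\<Union>i\<in>C. A i) \<le> a * emeasure D (\<Union>i\<in>C. B i)"
proof -
  define I where "I = to_nat_on C ` C"
  define A' B' where "A' = (\<lambda>n. if n \<in> I then A (from_nat_into C n) else {})"
    and "B' = (\<lambda>n. if n \<in> I then B (from_nat_into C n) else {})"
  have inI: "from_nat_into C n \<in> C" "to_nat_on C (from_nat_into C n) = n" if "n \<in> I" for n
    using that C by (auto simp: I_def)
  have UN: "(\<Union>i\<in>C. X i) = (\<Union>n. if n \<in> I then X (from_nat_into C n) else {})" for X :: "'a \<Rightarrow> 'x set"
  proof (intro subset_antisym subsetI)
    fix x assume "x \<in> (\<Union>i\<in>C. X i)"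
    then obtain i where i: "i \<in> C" "x \<in> X i" by blast
    then have "to_nat_on C i \<in> I" "from_nat_into C (to_nat_on C i) = i" using C by (auto simp: I_def)
    then show "x \<in> (\<Union>n. if n \<in> I then X (from_nat_into C n) else {})" using i by force
  next
    fix x assume "x \<in> (\<Union>n. if n \<in> I then X (from_nat_into C n) else {})"
    then show "x \<in> (\<Union>i\<in>C. X i)" using inI by (auto split: if_splits)
  qed
  have "emeasure M (\<Union>i\<in>C. A i) = emeasure M (\<Union>n. A' n)" unfolding A'_def UN[symmetric] ..
  also have "\<dots> \<le> (\<Sum>n. emeasure M (A' n))"
    using A inI by (intro emeasure_subadditive_countably) (auto simp: A'_def)
  also have "\<dots> \<le> (\<Sum>n. a * emeasure D (B' n))"
    using le inI by (intro suminf_le) (auto simp: A'_def B'_def)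
  also have "\<dots> = a * (\<Sum>n. emeasure D (B' n))" by simp
  also have "(\<Sum>n. emeasure D (B' n)) = emeasure D (\<Union>n. B' n)"
  proof (rule suminf_emeasure)
    show "range B' \<subseteq> sets D" using B inI by (auto simp: B'_def)
    show "disjoint_family B'"
      unfolding disjoint_family_on_def
    proof (intro ballI impI)
      fix m n :: nat assume "m \<noteq> n"
      show "B' m \<inter> B' n = {}"
      proof (cases "m \<in> I \<and> n \<in> I")
        case True
        then have "from_nat_into C m \<noteq> from_nat_into C n" using inI \<open>m \<noteq> n\<close> by metis
        then show ?thesis using True inI disj by (auto simp: B'_def disjoint_family_on_def)
      qed (auto simp: B'_def)
    qed
  qed
  also have "(\<Union>n. B' n) = (\<Union>i\<in>C. B i)" unfolding B'_def UN[symmetric] ..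
  finally show ?thesis .
qed

lemma complex_polar_Arg2pi: "of_real (norm z) * cis (Arg2pi z) = z"
  using Arg2pi_eq[of z] by (simp add: cis_conv_exp)

lemma nn_integral_three_periods:
  fixes g :: "real \<Rightarrow> real"
  assumes [measurable]: "g \<in> borel_measurable borel" and per: "\<And>t. g (t + 2 * pi) = g t"
  shows "(\<integral>\<^sup>+t. ennreal (g t) * indicator {- (2 * pi)..4 * pi} t \<partial>lborel) \<le> 3 * (\<integral>\<^sup>+t. ennreal (g t) * indicator {0..2 * pi} t \<partial>lborel)"
proof -
  let ?I = "\<lambda>c. \<integral>\<^sup>+t. ennreal (g t) * indicator {c..c + 2 * pi} t \<partial>lborel"
  have shift: "?I c = ?I 0" if "\<And>t. g (c + t) = g t" for c
  proof -
    have "?I c = (\<integral>\<^sup>+t. ennreal (g (c + 1 * t)) * indicator {c..c + 2 * pi} (c + 1 * t) \<partial>lborel)"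
      by (subst nn_integral_real_affine[where c = 1 and t = c]) auto
    also have "\<dots> = ?I 0" using that by (intro nn_integral_cong) (simp split: split_indicator)
    finally show ?thesis .
  qed
  have "g (- (2 * pi) + t) = g t" "g (2 * pi + t) = g t" for t
    using per[of "- (2 * pi) + t"] per[of t] by (simp_all add: add.commute)
  then have eq: "?I (- (2 * pi)) = ?I 0" "?I (2 * pi) = ?I 0" using shift by blast+
  have "(\<integral>\<^sup>+t. ennreal (g t) * indicator {- (2 * pi)..4 * pi} t \<partial>lborel)
      \<le> (\<integral>\<^sup>+t. (ennreal (g t) * indicator {- (2 * pi)..- (2 * pi) + 2 * pi} t + ennreal (g t) * indicator {0..0 + 2 * pi} t)
          + ennreal (g t) * indicator {2 * pi..2 * pi + 2 * pi} t \<partial>lborel)"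
    by (intro nn_integral_mono) (auto simp: indicator_def)
  also have "\<dots> = (?I (- (2 * pi)) + ?I 0) + ?I (2 * pi)"
  proof -
    have m: "(\<lambda>t. ennreal (g t) * indicator {c..c + 2 * pi} t) \<in> borel_measurable lborel" for c
      by measurable
    show ?thesis
      unfolding nn_integral_add[OF borel_measurable_add[OF m m] m] nn_integral_add[OF m m] ..
  qed
  also have "\<dots> = 3 * ?I 0"
  proof -
    have "(x + x) + x = 3 * x" for x :: ennreal
      using distrib_right[of 2 1 x] by (simp add: mult_2)
    then show ?thesis unfolding eq .
  qed
  finally show ?thesis by simp
qed

text \<open>
  Every point of the level set lies above the centre of an interval with a large average, whose half
  length is at least \<open>2 * pi\<close> times the distance of the point to the boundary.  Among these intervals
  Vitali's lemma selects disjoint ones such that the boxes over their fivefold enlargements cover the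
  level set.
\<close>

lemma weak_type_bound:
  assumes sets: "sets M = sets (restrict_space borel (ball 0 1))"
    and bound: "\<And>c h. 0 < h \<Longrightarrow> emeasure M (polar_box c (2 * pi * h) h) \<le> ennreal (K * h)" and K: "0 \<le> K"
    and E: "\<And>z. z \<in> E \<Longrightarrow> norm z < 1 \<and> 1 - R \<le> (1 - norm z) / 2" and R: "3 / 4 \<le> R" "R < 1"
    and f: "f holomorphic_on ball 0 1" and l: "0 < l"
  shows "emeasure M {z \<in> E. l < norm (f z)}
    \<le> ennreal (40 * K / l) * (\<integral>\<^sup>+t. ennreal (max 0 (norm (f (of_real R * cis t)) - l / 2)) * indicator {0..2 * pi} t \<partial>lborel)"
proof -
  define S where "S = {z \<in> E. l < norm (f z)}"
  define g where "g = (\<lambda>t. max 0 (norm (f (of_real R * cis t)) - l / 2))"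
  have cg: "continuous_on A g" for A
    unfolding g_def
    using R by (intro continuous_intros continuous_on_circle holomorphic_on_imp_continuous_on f) auto
  have gm[measurable]: "g \<in> borel_measurable borel" by (rule borel_measurable_continuous_onI[OF cg])
  have g0: "0 \<le> g t" for t by (simp add: g_def)
  have gper: "g (t + 2 * pi) = g t" for t by (simp add: g_def cis.code)
  have "\<exists>h. 1 - norm z \<le> h \<and> h \<le> 1 \<and> pi / 8 * l * h < integral {Arg2pi z - 2 * pi * h..Arg2pi z + 2 * pi * h} g"
    if "z \<in> S" for z
  proof -
    have z: "z \<in> E" "l < norm (f z)" using that by (auto simp: S_def)
    have "norm z < 1" "1 - R \<le> (1 - norm z) / 2" using E[OF z(1)] by auto
    then show ?thesis unfolding g_def
      using z l R large_value_imp_large_average[OF f norm_ge_zero R _ _ l, of z "Arg2pi z"] complex_polar_Arg2pi[of z]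
      by metis
  qed
  then obtain h where h: "\<And>z. z \<in> S \<Longrightarrow> 1 - norm z \<le> h z" "\<And>z. z \<in> S \<Longrightarrow> h z \<le> 1"
    "\<And>z. z \<in> S \<Longrightarrow> pi / 8 * l * h z < integral {Arg2pi z - 2 * pi * h z..Arg2pi z + 2 * pi * h z} g"
    by metis
  have hpos: "0 < h z" if "z \<in> S" for z using h(1)[OF that] E[of z] that by (auto simp: S_def)
  obtain C where C: "countable C" "C \<subseteq> S"
    "pairwise (\<lambda>i j. disjnt (cball (Arg2pi i) (2 * pi * h i)) (cball (Arg2pi j) (2 * pi * h j))) C"
    "\<And>i. i \<in> S \<Longrightarrow> \<exists>j. j \<in> C \<and> \<not> disjnt (cball (Arg2pi i) (2 * pi * h i)) (cball (Arg2pi j) (2 * pi * h j)) \<and>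
        cball (Arg2pi i) (2 * pi * h i) \<subseteq> ball (Arg2pi j) (5 * (2 * pi * h j))"
    by (rule Vitali_covering_lemma_cballs_balls[of S "\<lambda>z. 2 * pi * h z" "2 * pi" Arg2pi])
       (use hpos h(2) in auto)
  define I where "I = (\<lambda>z. {Arg2pi z - 2 * pi * h z..Arg2pi z + 2 * pi * h z})"
  have Icball: "cball (Arg2pi z) (2 * pi * h z) = I z" for z by (simp add: I_def cball_eq_atLeastAtMost)
  define D where "D = density lborel (\<lambda>t. ennreal (g t))"
  have D: "emeasure D X = (\<integral>\<^sup>+t. ennreal (g t) * indicator X t \<partial>lborel)" if "X \<in> sets borel" for X
    unfolding D_def using that by (subst emeasure_density) auto
  have meas: "polar_box c w d \<in> sets M" for c w d
    unfolding sets using borel_polar_box polar_box_subset_disc by (simp add: sets_restrict_space_iff)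
  let ?A = "\<lambda>z. polar_box (Arg2pi z) (2 * pi * (5 * h z)) (5 * h z)"
  have cover: "S \<subseteq> (\<Union>z\<in>C. ?A z)"
  proof
    fix z assume z: "z \<in> S"
    then obtain j where j: "j \<in> C" "cball (Arg2pi z) (2 * pi * h z) \<subseteq> ball (Arg2pi j) (5 * (2 * pi * h j))"
      using C(4) by blast
    have "dist (Arg2pi z) (Arg2pi j) + 2 * pi * h z < 5 * (2 * pi * h j)"
      using j(2) hpos[OF z] by (subst (asm) cball_subset_ball_iff) (auto simp: mult_less_0_iff)
    moreover have "0 < 2 * pi * h z" using hpos[OF z] by simp
    moreover have "2 * pi * (5 * h j) = 5 * (2 * pi * h j)" by simp
    ultimately have 1: "\<bar>Arg2pi z - Arg2pi j\<bar> \<le> 2 * pi * (5 * h j)" "2 * pi * h z < 2 * pi * (5 * h j)"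
      unfolding dist_real_def by linarith+
    from 1(2) have "h z < 5 * h j"
      using pi_gt_zero mult_less_cancel_left_pos[of "2 * pi" "h z" "5 * h j"] by simp
    then have "of_real (norm z) * cis (Arg2pi z) \<in> ?A j"
      using 1 h(1)[OF z] E[of z] z by (intro polar_boxI) (auto simp: S_def)
    then show "z \<in> (\<Union>z\<in>C. ?A z)" using j(1) complex_polar_Arg2pi[of z] by auto
  qed
  have "emeasure M S \<le> emeasure M (\<Union>z\<in>C. ?A z)"
    using C(1) meas by (intro emeasure_mono cover sets.countable_UN') auto
  also have "\<dots> \<le> ennreal (40 * K / (pi * l)) * emeasure D (\<Union>z\<in>C. I z)"
  proof (rule emeasure_UN_le_disjoint_UN[OF C(1)])
    show "disjoint_family_on I C"
      using C(3) by (auto simp: disjoint_family_on_def pairwise_def disjnt_def Icball)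
    fix z assume "z \<in> C"
    then have z: "z \<in> S" using C(2) by blast
    have "h z \<le> 8 / (pi * l) * integral (I z) g"
      using h(3)[OF z] l by (simp add: I_def field_simps)
    then have "K * (5 * h z) \<le> K * (5 * (8 / (pi * l) * integral (I z) g))"
      using K by (intro mult_left_mono) auto
    also have "\<dots> = 40 * K / (pi * l) * integral (I z) g" by simp
    finally have "emeasure M (?A z) \<le> ennreal (40 * K / (pi * l) * integral (I z) g)"
      using bound[of "5 * h z" "Arg2pi z"] hpos[OF z] by (auto intro: order_trans ennreal_leI)
    also have "\<dots> = ennreal (40 * K / (pi * l)) * ennreal (integral (I z) g)"
      using K l g0 by (intro ennreal_mult) (auto simp: I_def intro!: integral_nonneg integrable_continuous_real cg)
    also have "ennreal (integral (I z) g) = emeasure D (I z)"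
      unfolding I_def by (subst D) (auto simp: nn_integral_Icc_continuous[OF cg] g0)
    finally show "emeasure M (?A z) \<le> ennreal (40 * K / (pi * l)) * emeasure D (I z)" .
  qed (auto simp: meas D_def I_def)
  also have "\<dots> \<le> ennreal (40 * K / (pi * l)) * emeasure D {- (2 * pi)..4 * pi}"
  proof (intro mult_left_mono emeasure_mono)
    show "(\<Union>z\<in>C. I z) \<subseteq> {- (2 * pi)..4 * pi}"
    proof safe
      fix z t assume "z \<in> C" "t \<in> I z"
      then have "2 * pi * h z \<le> 2 * pi * 1" "Arg2pi z - 2 * pi * h z \<le> t" "t \<le> Arg2pi z + 2 * pi * h z"
        using C(2) h(2)[of z] by (auto simp: I_def)
      then show "t \<in> {- (2 * pi)..4 * pi}"
        using Arg2pi_ge_0[of z] Arg2pi_lt_2pi[of z] unfolding atLeastAtMost_iff by (intro conjI) linarith+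
    qed
  qed (auto simp: D_def)
  also have "\<dots> \<le> ennreal (40 * K / (pi * l)) * (3 * (\<integral>\<^sup>+t. ennreal (g t) * indicator {0..2 * pi} t \<partial>lborel))"
    by (intro mult_left_mono) (auto simp: D intro!: nn_integral_three_periods gper)
  also have "\<dots> = ennreal (40 * K / (pi * l) * 3) * (\<integral>\<^sup>+t. ennreal (g t) * indicator {0..2 * pi} t \<partial>lborel)"
    using K l by (subst ennreal_mult) (auto simp: mult.assoc)
  also have "\<dots> \<le> ennreal (40 * K / l) * (\<integral>\<^sup>+t. ennreal (g t) * indicator {0..2 * pi} t \<partial>lborel)"
  proof (intro mult_right_mono ennreal_leI)
    have "40 * K / (pi * l) * 3 = 40 * K / l * (3 / pi)" by simp
    also have "\<dots> \<le> 40 * K / l * 1" using K l pi_gt3 by (intro mult_left_mono) auto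
    finally show "40 * K / (pi * l) * 3 \<le> 40 * K / l" by simp
  qed simp
  finally show ?thesis unfolding S_def g_def .
qed

lemma holomorphic_borel_measurable:
  assumes sets: "sets M = sets (restrict_space borel (ball 0 1))" and f: "f holomorphic_on ball 0 1"
  shows "f \<in> borel_measurable M"
  using borel_measurable_continuous_on_restrict[OF holomorphic_on_imp_continuous_on[OF f]]
  by (simp cong: measurable_cong_sets add: sets)

lemma nn_integral_powr_layer:
  fixes y p :: real
  assumes p: "1 < p" and y: "0 \<le> y"
  shows "(\<integral>\<^sup>+l. ennreal (p * l powr (p - 1)) * indicator {0<..<y} l \<partial>lborel) = ennreal (y powr p)"
proof -
  have c: "continuous_on {0..y} (\<lambda>l. p * l powr (p - 1))"
    using p by (intro continuous_intros continuous_on_powr') auto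
  have "(\<integral>\<^sup>+l. ennreal (p * l powr (p - 1)) * indicator {0<..<y} l \<partial>lborel)
      = (\<integral>\<^sup>+l. ennreal (p * l powr (p - 1)) * indicator {0..y} l \<partial>lborel)"
  proof (rule nn_integral_cong_AE)
    show "AE l in lborel. ennreal (p * l powr (p - 1)) * indicator {0<..<y} l = ennreal (p * l powr (p - 1)) * indicator {0..y} l"
      using AE_lborel_singleton[of 0] AE_lborel_singleton[of y]
      by eventually_elim (auto simp: indicator_def)
  qed
  also have "\<dots> = ennreal (integral {0..y} (\<lambda>l. p * l powr (p - 1)))"
    using p by (intro nn_integral_Icc_continuous c) auto
  also have "integral {0..y} (\<lambda>l. p * l powr (p - 1)) = y powr p"
  proof -
    have "((\<lambda>l. p * l powr (p - 1)) has_integral y powr p - 0 powr p) {0..y}"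
    proof (rule fundamental_theorem_of_calculus_interior[OF y])
      show "continuous_on {0..y} (\<lambda>l. l powr p)"
        using p by (intro continuous_intros continuous_on_powr') auto
      show "((\<lambda>l. l powr p) has_vector_derivative p * l powr (p - 1)) (at l)" if "l \<in> {0<..<y}" for l
        using that by (auto intro!: derivative_eq_intros simp flip: has_real_derivative_iff_has_vector_derivative)
    qed
    from integral_unique[OF this] show ?thesis using p by simp
  qed
  finally show ?thesis .
qed

text \<open>
  Marcinkiewicz interpolation: multiply the weak type bound by \<open>p * l powr (p - 1)\<close> and integrate over
  \<open>l\<close>.  By the truncation only the levels \<open>l < 2 * g t\<close> contribute at the boundary point \<open>t\<close>.
\<close>

lemma carleson_embedding_circle:
  assumes sets: "sets M = sets (restrict_space borel (ball 0 1))"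
    and bound: "\<And>c h. 0 < h \<Longrightarrow> emeasure M (polar_box c (2 * pi * h) h) \<le> ennreal (K * h)" and K: "0 \<le> K"
    and E: "AE z in M. 1 - R \<le> (1 - norm z) / 2" and R: "3 / 4 \<le> R" "R < 1"
    and f: "f holomorphic_on ball 0 1" and p: "2 \<le> p"
  shows "(\<integral>\<^sup>+z. ennreal (norm (f z) powr p) \<partial>M) \<le> ennreal (40 * 2 powr p * K * integral {0..2 * pi} (\<lambda>t. norm (f (of_real R * cis t)) powr p))"
proof -
  have space: "space M = ball 0 1" using sets_eq_imp_space_eq[OF sets] by (simp add: space_restrict_space)
  have disc: "space M \<subseteq> polar_box 0 (2 * pi * 1) 1"
  proof
    fix z assume "z \<in> space M"
    then have "of_real (norm z) * cis (Arg2pi z) \<in> polar_box 0 (2 * pi * 1) 1"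
      using Arg2pi_ge_0[of z] Arg2pi_lt_2pi[of z] by (intro polar_boxI) (auto simp: space)
    then show "z \<in> polar_box 0 (2 * pi * 1) 1" by (simp add: complex_polar_Arg2pi)
  qed
  have "emeasure M (space M) \<le> emeasure M (polar_box 0 (2 * pi * 1) 1)"
    using disc polar_box_subset_disc borel_polar_box
    by (intro emeasure_mono) (auto simp: sets sets_restrict_space_iff)
  also have "\<dots> \<le> ennreal (K * 1)" by (rule bound) simp
  finally have "emeasure M (space M) \<noteq> \<infinity>" by (auto simp: top_unique)
  then interpret finite_measure M by (rule finite_measureI)
  interpret P: pair_sigma_finite M "lborel :: real measure" ..
  have fm[measurable]: "f \<in> borel_measurable M"
    by (rule holomorphic_borel_measurable[OF sets f])
  define g where "g = (\<lambda>t. norm (f (of_real R * cis t)))"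
  have cg: "continuous_on A g" for A
    unfolding g_def
    using R by (intro continuous_intros continuous_on_circle holomorphic_on_imp_continuous_on f) auto
  have gm[measurable]: "g \<in> borel_measurable borel" by (rule borel_measurable_continuous_onI[OF cg])
  have g0: "0 \<le> g t" for t by (simp add: g_def)
  let ?T = "{0..2 * pi}"
  let ?F = "\<lambda>l t. ennreal (40 * K * (p * l powr (p - 2)) * max 0 (g t - l / 2)) * indicator {0<..} l * indicator ?T t"
  have weak: "emeasure M {z \<in> space M. l < norm (f z)}
      \<le> ennreal (40 * K / l) * (\<integral>\<^sup>+t. ennreal (max 0 (g t - l / 2)) * indicator ?T t \<partial>lborel)" if l: "0 < l" for l
  proof -
    have "emeasure M {z \<in> space M. l < norm (f z)} = emeasure M {z \<in> {z \<in> space M. 1 - R \<le> (1 - norm z) / 2}. l < norm (f z)}"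
    proof (rule emeasure_eq_AE)
      show "AE z in M. z \<in> {z \<in> space M. l < norm (f z)} \<longleftrightarrow> z \<in> {z \<in> {z \<in> space M. 1 - R \<le> (1 - norm z) / 2}. l < norm (f z)}"
        using E by eventually_elim auto
      have [measurable]: "norm \<in> borel_measurable M"
        using borel_measurable_continuous_on_restrict[of "ball 0 1 :: complex set" norm]
        by (simp cong: measurable_cong_sets add: sets continuous_intros)
      have "{z \<in> {z \<in> space M. 1 - R \<le> (1 - norm z) / 2}. l < norm (f z)} = {z \<in> space M. 1 - R \<le> (1 - norm z) / 2 \<and> l < norm (f z)}" by auto
      also have "\<dots> \<in> sets M" by measurable
      finally show "{z \<in> {z \<in> space M. 1 - R \<le> (1 - norm z) / 2}. l < norm (f z)} \<in> sets M" .
    qed measurable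
    also have "\<dots> \<le> ennreal (40 * K / l) * (\<integral>\<^sup>+t. ennreal (max 0 (g t - l / 2)) * indicator ?T t \<partial>lborel)"
      unfolding g_def using l by (intro weak_type_bound sets bound K R f) (auto simp: space)
    finally show ?thesis .
  qed
  have "(\<integral>\<^sup>+z. ennreal (norm (f z) powr p) \<partial>M)
      = (\<integral>\<^sup>+z. \<integral>\<^sup>+l. ennreal (p * l powr (p - 1)) * indicator {0<..<norm (f z)} l \<partial>lborel \<partial>M)"
    using p by (simp add: nn_integral_powr_layer)
  also have "\<dots> = (\<integral>\<^sup>+l. \<integral>\<^sup>+z. ennreal (p * l powr (p - 1)) * indicator {0<..<norm (f z)} l \<partial>M \<partial>lborel)"
  proof (rule P.Fubini'[symmetric])
    have eq: "indicator {0<..<norm (f z)} l = (indicator {0<..} l * indicator {0<..} (norm (f z) - l) :: ennreal)" for z l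
      by (simp add: indicator_def)
    show "(\<lambda>(z, l). ennreal (p * l powr (p - 1)) * indicator {0<..<norm (f z)} l) \<in> borel_measurable (M \<Otimes>\<^sub>M lborel)"
      unfolding eq by measurable
  qed
  also have "\<dots> = (\<integral>\<^sup>+l. ennreal (p * l powr (p - 1)) * indicator {0<..} l * emeasure M {z \<in> space M. l < norm (f z)} \<partial>lborel)"
  proof (rule nn_integral_cong)
    fix l :: real
    have "(\<integral>\<^sup>+z. ennreal (p * l powr (p - 1)) * indicator {0<..<norm (f z)} l \<partial>M)
        = (\<integral>\<^sup>+z. ennreal (p * l powr (p - 1)) * indicator {0<..} l * indicator {z \<in> space M. l < norm (f z)} z \<partial>M)"
      by (intro nn_integral_cong) (auto simp: indicator_def)
    also have "\<dots> = ennreal (p * l powr (p - 1)) * indicator {0<..} l * emeasure M {z \<in> space M. l < norm (f z)}"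
      by (rule nn_integral_cmult_indicator) measurable
    finally show "(\<integral>\<^sup>+z. ennreal (p * l powr (p - 1)) * indicator {0<..<norm (f z)} l \<partial>M)
        = ennreal (p * l powr (p - 1)) * indicator {0<..} l * emeasure M {z \<in> space M. l < norm (f z)}" .
  qed
  also have "\<dots> \<le> (\<integral>\<^sup>+l. \<integral>\<^sup>+t. ?F l t \<partial>lborel \<partial>lborel)"
  proof (rule nn_integral_mono)
    fix l :: real
    show "ennreal (p * l powr (p - 1)) * indicator {0<..} l * emeasure M {z \<in> space M. l < norm (f z)}
        \<le> (\<integral>\<^sup>+t. ?F l t \<partial>lborel)"
    proof (cases "0 < l")
      case True
      have "ennreal (p * l powr (p - 1)) * indicator {0<..} l * emeasure M {z \<in> space M. l < norm (f z)}
          \<le> ennreal (p * l powr (p - 1)) * (ennreal (40 * K / l) * (\<integral>\<^sup>+t. ennreal (max 0 (g t - l / 2)) * indicator ?T t \<partial>lborel))"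
        using True weak[OF True] by (auto intro: mult_left_mono)
      also have "\<dots> = ennreal (40 * K * (p * l powr (p - 2))) * (\<integral>\<^sup>+t. ennreal (max 0 (g t - l / 2)) * indicator ?T t \<partial>lborel)"
      proof -
        have "p * l powr (p - 1) * (40 * K / l) = 40 * K * (p * l powr (p - 2))"
          using True powr_diff[of l "p - 1" 1] by simp
        then show ?thesis using True K p
          by (simp add: mult.assoc[symmetric] ennreal_mult[symmetric])
      qed
      also have "\<dots> = (\<integral>\<^sup>+t. ennreal (40 * K * (p * l powr (p - 2))) * (ennreal (max 0 (g t - l / 2)) * indicator ?T t) \<partial>lborel)"
        by (rule nn_integral_cmult[symmetric]) measurable
      also have "\<dots> = (\<integral>\<^sup>+t. ?F l t \<partial>lborel)"
      proof (rule nn_integral_cong)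
        fix t
        have "0 \<le> 40 * K * (p * l powr (p - 2))" using K p by simp
        from ennreal_mult[OF this, of "max 0 (g t - l / 2)"]
        show "ennreal (40 * K * (p * l powr (p - 2))) * (ennreal (max 0 (g t - l / 2)) * indicator ?T t)
            = ?F l t"
          using True by (simp add: mult.assoc)
      qed
      finally show ?thesis .
    qed simp
  qed
  also have "\<dots> = (\<integral>\<^sup>+t. \<integral>\<^sup>+l. ?F l t \<partial>lborel \<partial>lborel)"
    by (rule lborel_pair.Fubini') measurable
  also have "\<dots> \<le> (\<integral>\<^sup>+t. ennreal (40 * 2 powr p * K * g t powr p) * indicator ?T t \<partial>lborel)"
  proof (rule nn_integral_mono)
    fix t :: real
    let ?c = "40 * K * 2 * g t"
    have nonneg: "0 \<le> ?c" using K g0 by simp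
    have "(\<integral>\<^sup>+l. ?F l t \<partial>lborel)
        \<le> (\<integral>\<^sup>+l. ennreal ?c * (ennreal ((p - 1) * l powr (p - 1 - 1)) * indicator {0<..<2 * g t} l) * indicator ?T t \<partial>lborel)"
    proof (rule nn_integral_mono)
      fix l :: real
      show "?F l t
          \<le> ennreal ?c * (ennreal ((p - 1) * l powr (p - 1 - 1)) * indicator {0<..<2 * g t} l) * indicator ?T t"
      proof (cases "0 < l \<and> l < 2 * g t \<and> t \<in> ?T")
        case True
        have "40 * K * (p * l powr (p - 2)) * max 0 (g t - l / 2) \<le> 40 * K * ((2 * (p - 1)) * l powr (p - 2)) * g t"
          using True K p g0 by (intro mult_mono) auto
        also have "\<dots> = ?c * ((p - 1) * l powr (p - 1 - 1))" by simp
        finally have "ennreal (40 * K * (p * l powr (p - 2)) * max 0 (g t - l / 2)) \<le> ennreal (?c * ((p - 1) * l powr (p - 1 - 1)))"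
          by (rule ennreal_leI)
        also have "\<dots> = ennreal ?c * ennreal ((p - 1) * l powr (p - 1 - 1))"
          using nonneg p by (intro ennreal_mult) auto
        finally show ?thesis using True by simp
      next
        case False
        then have "indicator {0<..} l * indicator ?T t = (0 :: ennreal) \<or> max 0 (g t - l / 2) = 0" by (auto simp: indicator_def)
        then show ?thesis by (auto simp: mult.assoc)
      qed
    qed
    also have "\<dots> = ennreal ?c * (\<integral>\<^sup>+l. ennreal ((p - 1) * l powr (p - 1 - 1)) * indicator {0<..<2 * g t} l \<partial>lborel) * indicator ?T t"
      by (simp add: nn_integral_cmult nn_integral_multc)
    also have "\<dots> \<le> ennreal ?c * ennreal ((2 * g t) powr (p - 1)) * indicator ?T t"
    proof (cases "p = 2")
      case True
      have "(\<integral>\<^sup>+l. ennreal ((p - 1) * l powr (p - 1 - 1)) * indicator {0<..<2 * g t} l \<partial>lborel) \<le> (\<integral>\<^sup>+l. indicator {0<..<2 * g t} l \<partial>lborel)"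
        using True by (intro nn_integral_mono) (auto simp: indicator_def)
      also have "\<dots> = ennreal ((2 * g t) powr (p - 1))" using True g0 by simp
      finally show ?thesis by (intro mult_right_mono mult_left_mono) auto
    next
      case False
      then show ?thesis using p g0 by (subst nn_integral_powr_layer) auto
    qed
    also have "\<dots> = ennreal (?c * (2 * g t) powr (p - 1)) * indicator ?T t"
      using nonneg by (subst ennreal_mult) auto
    also have "?c * (2 * g t) powr (p - 1) = 40 * 2 powr p * K * g t powr p"
    proof -
      have "2 * g t * (2 * g t) powr (p - 1) = (2 * g t) powr p"
        using g0[of t] p by (cases "g t = 0") (auto simp: powr_diff)
      also have "\<dots> = 2 powr p * g t powr p" using g0 by (simp add: powr_mult)
      finally show ?thesis by (simp add: mult_ac)
    qed
    finally show "(\<integral>\<^sup>+l. ?F l t \<partial>lborel)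
      \<le> ennreal (40 * 2 powr p * K * g t powr p) * indicator ?T t" .
  qed
  also have "\<dots> = ennreal (integral ?T (\<lambda>t. 40 * 2 powr p * K * g t powr p))"
    using K p g0 by (intro nn_integral_Icc_continuous continuous_intros continuous_on_powr' cg) auto
  also have "integral ?T (\<lambda>t. 40 * 2 powr p * K * g t powr p) = 40 * 2 powr p * K * integral ?T (\<lambda>t. norm (f (of_real R * cis t)) powr p)"
    by (simp add: g_def)
  finally show ?thesis .
qed

section \<open>Polar coordinates\<close>

lemma lborel_complex_eq_distr:
  "(lborel :: complex measure) = distr (lborel \<Otimes>\<^sub>M lborel) borel (\<lambda>(x, y). of_real x + \<i> * of_real y)"
proof (rule lborel_eqI)
  fix l u :: complex assume le: "\<And>b. b \<in> Basis \<Longrightarrow> l \<bullet> b \<le> u \<bullet> b"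
  have le': "Re l \<le> Re u" "Im l \<le> Im u"
    using le[of 1] le[of \<i>] by (auto simp: Basis_complex_def inner_complex_def)
  have "(\<lambda>(x, y). of_real x + \<i> * of_real y :: complex) -` box l u \<inter> space (lborel \<Otimes>\<^sub>M lborel)
      = {Re l<..<Re u} \<times> {Im l<..<Im u}"
    by (auto simp: space_pair_measure in_box_complex_iff)
  then have "emeasure (distr (lborel \<Otimes>\<^sub>M lborel) borel (\<lambda>(x, y). of_real x + \<i> * of_real y)) (box l u)
      = emeasure lborel {Re l<..<Re u} * emeasure lborel {Im l<..<Im u}"
    by (subst emeasure_distr) (auto simp: lborel.emeasure_pair_measure_Times)
  also have "\<dots> = (\<Prod>b\<in>Basis. (u - l) \<bullet> b)"
    using le' by (simp add: Basis_complex_def inner_complex_def ennreal_mult)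
  finally show "emeasure (distr (lborel \<Otimes>\<^sub>M lborel) borel (\<lambda>(x, y). of_real x + \<i> * of_real y)) (box l u)
      = (\<Prod>b\<in>Basis. (u - l) \<bullet> b)" .
qed simp

lemma nn_integral_lborel_complex:
  assumes [measurable]: "g \<in> borel_measurable borel"
  shows "(\<integral>\<^sup>+z. g z \<partial>lborel) = (\<integral>\<^sup>+x. \<integral>\<^sup>+y. g (of_real x + \<i> * of_real y) \<partial>lborel \<partial>lborel)"
proof -
  have "(\<integral>\<^sup>+z. g z \<partial>lborel) = (\<integral>\<^sup>+w. g (case w of (x, y) \<Rightarrow> of_real x + \<i> * of_real y) \<partial>(lborel \<Otimes>\<^sub>M lborel))"
    by (subst lborel_complex_eq_distr, subst nn_integral_distr) (auto simp: case_prod_beta)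
  also have "\<dots> = (\<integral>\<^sup>+x. \<integral>\<^sup>+y. g (of_real x + \<i> * of_real y) \<partial>lborel \<partial>lborel)"
    by (subst lborel.nn_integral_fst[symmetric]) (auto simp: case_prod_beta)
  finally show ?thesis .
qed

lemma nn_integral_lborel_mult_ii:
  assumes [measurable]: "g \<in> borel_measurable borel"
  shows "(\<integral>\<^sup>+z. g (\<i> * z) \<partial>lborel) = (\<integral>\<^sup>+z. g z \<partial>(lborel :: complex measure))"
proof -
  have "lborel = distr lborel borel ((*) \<i>)"
  proof (rule lborel_eqI)
    fix l u :: complex assume le: "\<And>b. b \<in> Basis \<Longrightarrow> l \<bullet> b \<le> u \<bullet> b"
    have le': "Re l \<le> Re u" "Im l \<le> Im u"
      using le[of 1] le[of \<i>] by (auto simp: Basis_complex_def inner_complex_def)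
    have "(*) \<i> -` box l u = box (Complex (Im l) (- Re u)) (Complex (Im u) (- Re l))"
      by (auto simp: in_box_complex_iff)
    then have "emeasure (distr lborel borel ((*) \<i>)) (box l u)
        = emeasure lborel (box (Complex (Im l) (- Re u)) (Complex (Im u) (- Re l)))"
      by (subst emeasure_distr) auto
    also have "\<dots> = (\<Prod>b\<in>Basis. (u - l) \<bullet> b)"
      using le' by (subst emeasure_lborel_box) (auto simp: Basis_complex_def inner_complex_def ennreal_mult mult.commute)
    finally show "emeasure (distr lborel borel ((*) \<i>)) (box l u) = (\<Prod>b\<in>Basis. (u - l) \<bullet> b)" .
  qed simp
  then have "(\<integral>\<^sup>+z. g z \<partial>lborel) = (\<integral>\<^sup>+z. g z \<partial>distr lborel borel ((*) \<i>))" by simp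
  then show ?thesis by (simp add: nn_integral_distr)
qed

text \<open>
  On the sector \<open>|y| \<le> x\<close> polar coordinates split into two substitutions in one variable:
  \<open>y = x * tan t\<close> for fixed \<open>x\<close>, and \<open>x = r * cos t\<close> for fixed \<open>t\<close>.
\<close>

lemma nn_integral_sector_polar_le:
  fixes G :: "complex \<Rightarrow> real"
  assumes [measurable]: "G \<in> borel_measurable borel" and G: "\<And>z. 0 \<le> G z"
  shows "(\<integral>\<^sup>+t. (\<integral>\<^sup>+r. ennreal (r * G (of_real r * cis t)) * indicator {0<..} r \<partial>lborel) * indicator {- (pi / 4)..pi / 4} t \<partial>lborel)
    \<le> (\<integral>\<^sup>+z. G z \<partial>lborel)"
proof -
  have [measurable]: "sin \<in> borel_measurable (borel :: real measure)" "cos \<in> borel_measurable (borel :: real measure)"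
    by (auto intro!: borel_measurable_continuous_onI continuous_intros)
  let ?S = "{- (pi / 4)..pi / 4}"
  define K where "K = (\<lambda>x t. ennreal (G (of_real x + \<i> * of_real (x * (sin t / cos t))) * (x / (cos t)\<^sup>2)))"
  have [measurable]: "(\<lambda>(x, t). K x t) \<in> borel_measurable (borel \<Otimes>\<^sub>M borel)"
    unfolding K_def by measurable
  have cos: "0 < cos t" if "t \<in> ?S" for t
    using that pi_gt_zero unfolding atLeastAtMost_iff by (intro cos_gt_zero_pi) linarith+
  have inner: "(\<integral>\<^sup>+t. K x t * indicator ?S t \<partial>lborel) = (\<integral>\<^sup>+y. ennreal (G (of_real x + \<i> * of_real y)) * indicator {-x..x} y \<partial>lborel)"
    if x: "0 < x" for x
  proof -
    let ?g = "\<lambda>t. x * (sin t / cos t)"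
    have g: "?g (- (pi / 4)) = - x" "?g (pi / 4) = x"
      by (simp_all add: sin_45 cos_45)
    have "(\<integral>\<^sup>+y. ennreal (G (of_real x + \<i> * of_real y) * indicator {?g (- (pi / 4))..?g (pi / 4)} y) \<partial>lborel)
        = (\<integral>\<^sup>+t. ennreal (G (of_real x + \<i> * of_real (?g t)) * (x / (cos t)\<^sup>2) * indicator ?S t) \<partial>lborel)"
    proof (rule nn_integral_substitution[where g = ?g and g' = "\<lambda>t. x / (cos t)\<^sup>2"
          and f = "\<lambda>y. G (of_real x + \<i> * of_real y)" and a = "- (pi / 4)" and b = "pi / 4"])
      show "set_borel_measurable borel {?g (- (pi / 4))..?g (pi / 4)} (\<lambda>y. G (of_real x + \<i> * of_real y))"
        unfolding set_borel_measurable_def by measurable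
      show "(?g has_real_derivative x / (cos t)\<^sup>2) (at t)" if "t \<in> ?S" for t
      proof -
        have c: "cos t \<noteq> 0" using cos[OF that] by simp
        have "x * ((cos t * cos t - sin t * - sin t) / (cos t * cos t)) = x / (cos t)\<^sup>2"
          using sin_cos_squared_add[of t] by (simp add: power2_eq_square)
        moreover have "(?g has_real_derivative x * ((cos t * cos t - sin t * - sin t) / (cos t * cos t))) (at t)"
          using c by (intro DERIV_cmult DERIV_divide DERIV_sin DERIV_cos)
        ultimately show ?thesis by (simp only:)
      qed
      show "continuous_on ?S (\<lambda>t. x / (cos t)\<^sup>2)"
        using cos by (intro continuous_intros) force
    qed (use x in auto)
    then show ?thesis unfolding g K_def
      by (simp add: indicator_mult_ennreal mult.commute)
  qed
  have radial: "(\<integral>\<^sup>+x. K x t * indicator {0<..} x \<partial>lborel) = (\<integral>\<^sup>+r. ennreal (r * G (of_real r * cis t)) * indicator {0<..} r \<partial>lborel)"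
    if t: "t \<in> ?S" for t
  proof -
    have c: "0 < cos t" using cos[OF t] .
    have "(\<integral>\<^sup>+x. K x t * indicator {0<..} x \<partial>lborel) = ennreal \<bar>cos t\<bar> * (\<integral>\<^sup>+r. K (0 + cos t * r) t * indicator {0<..} (0 + cos t * r) \<partial>lborel)"
      using c by (intro nn_integral_real_affine) auto
    also have "\<dots> = (\<integral>\<^sup>+r. ennreal (cos t) * (K (cos t * r) t * indicator {0<..} (cos t * r)) \<partial>lborel)"
      using c by (subst nn_integral_cmult) auto
    also have "\<dots> = (\<integral>\<^sup>+r. ennreal (r * G (of_real r * cis t)) * indicator {0<..} r \<partial>lborel)"
    proof (rule nn_integral_cong)
      fix r :: real
      have "of_real (cos t * r) + \<i> * of_real (cos t * r * (sin t / cos t)) = of_real r * cis t"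
        using c by (simp add: complex_eq_iff)
      then have "K (cos t * r) t = ennreal (G (of_real r * cis t) * (r / cos t))"
        unfolding K_def using c by (simp add: power2_eq_square)
      moreover have "ennreal (cos t) * ennreal (G (of_real r * cis t) * (r / cos t)) = ennreal (r * G (of_real r * cis t))" if "0 < r"
        using c that G by (simp flip: ennreal_mult)
      ultimately show "ennreal (cos t) * (K (cos t * r) t * indicator {0<..} (cos t * r))
          = ennreal (r * G (of_real r * cis t)) * indicator {0<..} r"
        using c by (auto simp: indicator_def zero_less_mult_iff simp del: ennreal_mult)
    qed
    finally show ?thesis .
  qed
  have "(\<integral>\<^sup>+t. (\<integral>\<^sup>+r. ennreal (r * G (of_real r * cis t)) * indicator {0<..} r \<partial>lborel) * indicator ?S t \<partial>lborel)
      = (\<integral>\<^sup>+t. (\<integral>\<^sup>+x. K x t * indicator {0<..} x \<partial>lborel) * indicator ?S t \<partial>lborel)"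
    by (intro nn_integral_cong) (simp add: radial split: split_indicator)
  also have "\<dots> = (\<integral>\<^sup>+t. \<integral>\<^sup>+x. K x t * indicator {0<..} x * indicator ?S t \<partial>lborel \<partial>lborel)"
    by (intro nn_integral_cong nn_integral_multc[symmetric]) measurable
  also have "\<dots> = (\<integral>\<^sup>+x. \<integral>\<^sup>+t. K x t * indicator {0<..} x * indicator ?S t \<partial>lborel \<partial>lborel)"
    by (rule lborel_pair.Fubini') (simp add: case_prod_beta)
  also have "\<dots> \<le> (\<integral>\<^sup>+x. \<integral>\<^sup>+y. ennreal (G (of_real x + \<i> * of_real y)) \<partial>lborel \<partial>lborel)"
  proof (rule nn_integral_mono)
    fix x :: real
    show "(\<integral>\<^sup>+t. K x t * indicator {0<..} x * indicator ?S t \<partial>lborel) \<le> (\<integral>\<^sup>+y. ennreal (G (of_real x + \<i> * of_real y)) \<partial>lborel)"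
    proof (cases "0 < x")
      case True
      then have "(\<integral>\<^sup>+t. K x t * indicator {0<..} x * indicator ?S t \<partial>lborel) = (\<integral>\<^sup>+t. K x t * indicator ?S t \<partial>lborel)"
        by simp
      also have "\<dots> \<le> (\<integral>\<^sup>+y. ennreal (G (of_real x + \<i> * of_real y)) \<partial>lborel)"
        unfolding inner[OF True] by (intro nn_integral_mono) (auto simp: indicator_def)
      finally show ?thesis .
    qed simp
  qed
  also have "\<dots> = (\<integral>\<^sup>+z. G z \<partial>lborel)"
    by (rule nn_integral_lborel_complex[symmetric]) measurable
  finally show ?thesis .
qed

text \<open>
  Rotations by right angles preserve Lebesgue measure and move the sector over the whole plane.  The
  interval \<open>{0..2 * pi}\<close> starts in the middle of a sector and therefore meets five of them, which
  explains the constant.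
\<close>

lemma nn_integral_polar_le:
  fixes G :: "complex \<Rightarrow> real"
  assumes [measurable]: "G \<in> borel_measurable borel" and G: "\<And>z. 0 \<le> G z"
  shows "(\<integral>\<^sup>+t. (\<integral>\<^sup>+r. ennreal (r * G (of_real r * cis t)) * indicator {0<..} r \<partial>lborel) * indicator {0..2 * pi} t \<partial>lborel)
    \<le> 5 * (\<integral>\<^sup>+z. G z \<partial>lborel)"
proof -
  define P where "P = (\<lambda>t. \<integral>\<^sup>+r. ennreal (r * G (of_real r * cis t)) * indicator {0<..} r \<partial>lborel)"
  have cism[measurable]: "cis \<in> borel_measurable borel"
    by (intro borel_measurable_continuous_onI continuous_intros)
  have [measurable]: "P \<in> borel_measurable borel"
    unfolding P_def by measurable
  let ?S = "{- (pi / 4)..pi / 4}"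
  let ?J = "\<lambda>k::nat. {real k * (pi / 2) - pi / 4..real k * (pi / 2) + pi / 4}"
  have rot: "(\<integral>\<^sup>+z. ennreal (G (\<i> ^ k * z)) \<partial>lborel) = (\<integral>\<^sup>+z. G z \<partial>lborel)" for k :: nat
  proof (induction k)
    case (Suc k)
    have "(\<integral>\<^sup>+z. ennreal (G (\<i> ^ Suc k * z)) \<partial>lborel) = (\<integral>\<^sup>+z. ennreal (G (\<i> ^ k * (\<i> * z))) \<partial>lborel)"
      by (simp add: mult_ac)
    also have "\<dots> = (\<integral>\<^sup>+z. ennreal (G (\<i> ^ k * z)) \<partial>lborel)"
      by (rule nn_integral_lborel_mult_ii) measurable
    finally show ?case using Suc by simp
  qed simp
  have part: "(\<integral>\<^sup>+t. P t * indicator (?J k) t \<partial>lborel) \<le> (\<integral>\<^sup>+z. G z \<partial>lborel)" for k :: nat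
  proof -
    have ik: "\<i> ^ k = cis (real k * (pi / 2))"
      using Complex.DeMoivre[of "pi / 2" k] by simp
    have "(\<integral>\<^sup>+t. P t * indicator (?J k) t \<partial>lborel)
        = (\<integral>\<^sup>+t. P (real k * (pi / 2) + 1 * t) * indicator (?J k) (real k * (pi / 2) + 1 * t) \<partial>lborel)"
      by (subst nn_integral_real_affine[where c = 1 and t = "real k * (pi / 2)"]) auto
    also have "\<dots> = (\<integral>\<^sup>+t. (\<integral>\<^sup>+r. ennreal (r * G (\<i> ^ k * (of_real r * cis t))) * indicator {0<..} r \<partial>lborel) * indicator ?S t \<partial>lborel)"
      by (intro nn_integral_cong arg_cong2[where f = "(*)"])
         (auto simp: P_def ik cis_mult mult.left_commute indicator_def)
    also have "\<dots> \<le> (\<integral>\<^sup>+z. ennreal (G (\<i> ^ k * z)) \<partial>lborel)"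
      using G by (intro nn_integral_sector_polar_le) auto
    finally show ?thesis unfolding rot .
  qed
  have "(\<integral>\<^sup>+t. P t * indicator {0..2 * pi} t \<partial>lborel)
      \<le> (\<integral>\<^sup>+t. (\<Sum>k\<in>{..<5::nat}. P t * indicator (?J k) t) \<partial>lborel)"
  proof (rule nn_integral_mono)
    fix t :: real
    show "P t * indicator {0..2 * pi} t \<le> (\<Sum>k\<in>{..<5::nat}. P t * indicator (?J k) t)"
    proof (cases "t \<in> {0..2 * pi}")
      case True
      have "\<exists>k\<in>{..<5::nat}. t \<in> ?J k"
      proof -
        consider "t \<le> pi / 4" | "pi / 4 \<le> t" "t \<le> 3 * pi / 4" | "3 * pi / 4 \<le> t" "t \<le> 5 * pi / 4"
          | "5 * pi / 4 \<le> t" "t \<le> 7 * pi / 4" | "7 * pi / 4 \<le> t" by linarith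
        then show ?thesis
        proof cases
          case 1 then show ?thesis using True by (intro bexI[of _ 0]) auto
        next
          case 2 then show ?thesis by (intro bexI[of _ 1]) auto
        next
          case 3 then show ?thesis by (intro bexI[of _ 2]) auto
        next
          case 4 then show ?thesis by (intro bexI[of _ 3]) auto
        next
          case 5 then show ?thesis using True by (intro bexI[of _ 4]) auto
        qed
      qed
      then obtain k :: nat where k: "k \<in> {..<5}" "t \<in> ?J k" by blast
      have "P t * indicator {0..2 * pi} t = P t * indicator (?J k) t"
        using True k by simp
      also have "\<dots> \<le> (\<Sum>k\<in>{..<5::nat}. P t * indicator (?J k) t)"
        by (rule member_le_sum[OF k(1)]) auto
      finally show ?thesis .
    qed simp
  qed
  also have "\<dots> = (\<Sum>k\<in>{..<5::nat}. \<integral>\<^sup>+t. P t * indicator (?J k) t \<partial>lborel)"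
    by (intro nn_integral_sum) measurable
  also have "\<dots> \<le> (\<Sum>k\<in>{..<5::nat}. \<integral>\<^sup>+z. G z \<partial>lborel)"
    by (intro sum_mono part)
  also have "\<dots> = 5 * (\<integral>\<^sup>+z. G z \<partial>lborel)" by simp
  finally show ?thesis unfolding P_def .
qed

section \<open>From the shells to the disc\<close>

lemma radial_integral_le_area_integral:
  assumes f: "f holomorphic_on ball 0 1" and p: "1 < p" and r: "0 \<le> r" "r < 1"
  shows "ennreal (integral {0..r} (\<lambda>s. (1 - s) powr (p - 1) * integral {0..2 * pi} (\<lambda>t. norm (f (of_real s * cis t)) powr p) * s))
    \<le> ennreal (5 * pi) * (\<integral>\<^sup>+z\<in>ball 0 1. ennreal (norm (f z) powr p * (1 - (norm z)\<^sup>2) powr (p - 1)) \<partial>area_measure)"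
proof -
  define G where "G = (\<lambda>z. indicator (ball 0 1) z *\<^sub>R (norm (f z) powr p * (1 - (norm z)\<^sup>2) powr (p - 1)))"
  have n1: "(norm z)\<^sup>2 \<le> 1" if "z \<in> ball 0 1" for z :: complex
    using that power_mono[of "norm z" 1 2] by simp
  have Gm[measurable]: "G \<in> borel_measurable borel"
    unfolding G_def
    by (rule borel_measurable_continuous_on_indicator)
       (use p f n1 in \<open>auto intro!: continuous_intros continuous_on_powr' holomorphic_on_imp_continuous_on\<close>)
  have G0: "0 \<le> G z" for z by (simp add: G_def)
  have cism[measurable]: "cis \<in> borel_measurable borel"
    by (intro borel_measurable_continuous_onI continuous_intros)
  define m where "m = (\<lambda>s. integral {0..2 * pi} (\<lambda>t. norm (f (of_real s * cis t)) powr p))"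
  have cm: "continuous_on {0..r} m"
  proof -
    have "continuous_on (ball 0 1) (\<lambda>z. norm (f z) powr p)"
      using p f by (intro continuous_on_powr' continuous_intros holomorphic_on_imp_continuous_on) auto
    from continuous_on_circle_integral_Icc[OF this, of 0 r] r show ?thesis
      by (simp add: m_def circle_integral_def[abs_def])
  qed
  have ct: "continuous_on {0..2 * pi} (\<lambda>t. norm (f (of_real s * cis t)) powr p)" if "\<bar>s\<bar> < 1" for s
    using p that
    by (intro continuous_on_powr' continuous_intros continuous_on_circle holomorphic_on_imp_continuous_on[OF f]) auto
  have m0: "0 \<le> m s" if "\<bar>s\<bar> < 1" for s
    unfolding m_def using ct[OF that] by (intro integral_nonneg integrable_continuous_real) auto
  have "ennreal (integral {0..r} (\<lambda>s. (1 - s) powr (p - 1) * m s * s))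
      = (\<integral>\<^sup>+s. ennreal ((1 - s) powr (p - 1) * m s * s) * indicator {0..r} s \<partial>lborel)"
    using r m0 p by (intro nn_integral_Icc_continuous[symmetric] continuous_intros continuous_on_powr' cm) auto
  also have "\<dots> \<le> (\<integral>\<^sup>+s. \<integral>\<^sup>+t. ennreal (s * G (of_real s * cis t)) * indicator {0<..} s * indicator {0..2 * pi} t \<partial>lborel \<partial>lborel)"
  proof (rule nn_integral_mono)
    fix s :: real
    show "ennreal ((1 - s) powr (p - 1) * m s * s) * indicator {0..r} s
        \<le> (\<integral>\<^sup>+t. ennreal (s * G (of_real s * cis t)) * indicator {0<..} s * indicator {0..2 * pi} t \<partial>lborel)"
    proof (cases "0 < s \<and> s \<le> r")
      case True
      then have s: "0 < s" "s < 1" "\<bar>s\<bar> < 1" using r by auto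
      have "ennreal ((1 - s) powr (p - 1) * m s * s) = ennreal (integral {0..2 * pi} (\<lambda>t. (1 - s) powr (p - 1) * s * (norm (f (of_real s * cis t)) powr p)))"
        by (simp add: m_def mult_ac)
      also have "\<dots> = (\<integral>\<^sup>+t. ennreal ((1 - s) powr (p - 1) * s * (norm (f (of_real s * cis t)) powr p)) * indicator {0..2 * pi} t \<partial>lborel)"
        using s by (intro nn_integral_Icc_continuous[symmetric] continuous_on_mult continuous_on_const ct) auto
      also have "\<dots> \<le> (\<integral>\<^sup>+t. ennreal (s * G (of_real s * cis t)) * indicator {0<..} s * indicator {0..2 * pi} t \<partial>lborel)"
      proof (intro nn_integral_mono mult_right_mono)
        fix t
        have "s\<^sup>2 \<le> s" using s by (simp add: power2_eq_square)
        then have "(1 - s) powr (p - 1) \<le> (1 - s\<^sup>2) powr (p - 1)" using s p by (intro powr_mono2) auto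
        then have "s * (norm (f (of_real s * cis t)) powr p * (1 - s) powr (p - 1)) \<le> s * G (of_real s * cis t)"
          using s by (intro mult_left_mono) (auto simp: G_def norm_mult intro: mult_left_mono)
        then show "ennreal ((1 - s) powr (p - 1) * s * (norm (f (of_real s * cis t)) powr p)) \<le> ennreal (s * G (of_real s * cis t)) * indicator {0<..} s"
          using s by (simp add: mult_ac ennreal_leI)
      qed simp
      finally show ?thesis using True by simp
    next
      case False
      then have z0: "ennreal ((1 - s) powr (p - 1) * m s * s) * indicator {0..r} s = 0"
        by (cases "s = 0") (auto simp: indicator_def)
      show ?thesis unfolding z0 by simp
    qed
  qed
  also have "\<dots> = (\<integral>\<^sup>+t. \<integral>\<^sup>+s. ennreal (s * G (of_real s * cis t)) * indicator {0<..} s * indicator {0..2 * pi} t \<partial>lborel \<partial>lborel)"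
    by (rule lborel_pair.Fubini') measurable
  also have "\<dots> = (\<integral>\<^sup>+t. (\<integral>\<^sup>+s. ennreal (s * G (of_real s * cis t)) * indicator {0<..} s \<partial>lborel) * indicator {0..2 * pi} t \<partial>lborel)"
    by (intro nn_integral_cong nn_integral_multc) measurable
  also have "\<dots> \<le> 5 * (\<integral>\<^sup>+z. ennreal (G z) \<partial>lborel)"
    by (rule nn_integral_polar_le[OF Gm G0])
  also have "(\<integral>\<^sup>+z. ennreal (G z) \<partial>lborel) = ennreal pi * (\<integral>\<^sup>+z. ennreal (G z) \<partial>area_measure)"
  proof -
    have "(\<integral>\<^sup>+z. ennreal (G z) \<partial>area_measure) = ennreal (1 / pi) * (\<integral>\<^sup>+z. ennreal (G z) \<partial>lborel)"
      unfolding area_measure_def by (subst nn_integral_scale_measure) auto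
    moreover have "ennreal pi * (ennreal (1 / pi) * x) = x" for x
      by (simp add: mult.assoc[symmetric] ennreal_mult[symmetric])
    ultimately show ?thesis by simp
  qed
  also have "(\<integral>\<^sup>+z. ennreal (G z) \<partial>area_measure) = (\<integral>\<^sup>+z\<in>ball 0 1. ennreal (norm (f z) powr p * (1 - (norm z)\<^sup>2) powr (p - 1)) \<partial>area_measure)"
    by (intro nn_integral_cong) (simp add: G_def split: split_indicator)
  also have "5 * (ennreal pi * x) = ennreal (5 * pi) * x" for x
    by (simp add: ennreal_mult mult.assoc)
  finally show ?thesis by (simp only: m_def)
qed

lemma exists_log_scale:
  assumes "0 < d" "d \<le> 1"
  obtains k where "log_scale (Suc k) < d" "d \<le> log_scale k"
proof -
  obtain M :: nat where "1 - ln d < 2 ^ M" using real_arch_pow[of 2 "1 - ln d"] by auto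
  then have "exp (1 - 2 ^ M) < exp (ln d)" by (subst exp_less_cancel_iff) simp
  then have M: "log_scale M < d" using assms by (simp add: log_scale_def)
  define n where "n = (LEAST n. log_scale n < d)"
  have n: "log_scale n < d" unfolding n_def using M by (rule LeastI)
  have "n \<noteq> 0" using n assms by (auto simp: log_scale_0 intro: ccontr)
  then obtain k where k: "n = Suc k" by (cases n) auto
  then have "\<not> log_scale k < d" using not_less_Least[of k "\<lambda>n. log_scale n < d"] by (simp add: n_def)
  then show thesis using that n k by simp
qed

text \<open>
  The logarithmic weight of \<open>1 - |z|\<close> stays between \<open>2 ^ k\<close> and \<open>2 ^ (k + 1)\<close> on this shell.
\<close>

definition log_shell :: "nat \<Rightarrow> complex set" where
  "log_shell k = {z. log_scale (Suc k) < 1 - norm z \<and> 1 - norm z \<le> log_scale k}"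

lemma log_shell_borel: "log_shell k \<in> sets borel"
proof -
  have "(\<lambda>z. 1 - norm z) \<in> borel_measurable (borel :: complex measure)" by measurable
  then have "(\<lambda>z. 1 - norm z) -` {log_scale (Suc k)<..log_scale k} \<inter> space borel \<in> sets (borel :: complex measure)"
    by (rule measurable_sets) simp
  also have "(\<lambda>z :: complex. 1 - norm z) -` {log_scale (Suc k)<..log_scale k} \<inter> space borel = log_shell k"
    by (auto simp: log_shell_def)
  finally show ?thesis .
qed

text \<open>
  On the shell, \<open>\<mu>\<close> satisfies the classical Carleson condition with a constant of size
  \<open>2 powr (- k * a)\<close>.  The radius two scales further out leaves half of the distance to the
  boundary between the shell and the circle.
\<close>

lemma shell_embedding:
  assumes sets: "sets M = sets (restrict_space borel (ball 0 1))"
    and bound: "\<And>c h. 0 < h \<Longrightarrow> h \<le> 1 \<Longrightarrow> emeasure M (polar_box c (2 * pi * h) h) \<le> ennreal (K * h * (1 - ln h) powr (- a))"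
    and a: "0 \<le> a" and K: "0 \<le> K" and f: "f holomorphic_on ball 0 1" and p: "2 \<le> p"
  shows "(\<integral>\<^sup>+z. ennreal (norm (f z) powr p) * indicator (log_shell k) z \<partial>M)
    \<le> ennreal (80 * 2 powr p * K * 2 powr (- (real k * a))
        * integral {0..2 * pi} (\<lambda>t. norm (f (of_real (1 - log_scale (Suc (Suc k))) * cis t)) powr p))"
proof -
  have space: "space M = ball 0 1" using sets_eq_imp_space_eq[OF sets] by (simp add: space_restrict_space)
  have fm[measurable]: "f \<in> borel_measurable M"
    by (rule holomorphic_borel_measurable[OF sets f])
  define S where "S = log_shell k \<inter> ball 0 1"
  have Sm[measurable]: "S \<in> sets M"
    unfolding sets S_def using log_shell_borel by (simp add: sets_restrict_space_iff)
  define N where "N = density M (indicator S)"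
  have setsN: "sets N = sets (restrict_space borel (ball 0 1))" by (simp add: N_def sets)
  have box: "polar_box c w d \<in> sets M" for c w d
    unfolding sets using borel_polar_box polar_box_subset_disc by (simp add: sets_restrict_space_iff)
  let ?R = "1 - log_scale (Suc (Suc k))"
  let ?K = "2 * K * (1 - ln (log_scale k)) powr (- a)"
  have "(\<integral>\<^sup>+z. ennreal (norm (f z) powr p) \<partial>N)
      \<le> ennreal (40 * 2 powr p * ?K * integral {0..2 * pi} (\<lambda>t. norm (f (of_real ?R * cis t)) powr p))"
  proof (rule carleson_embedding_circle[OF setsN _ _ _ _ _ f p])
    fix c h :: real assume h: "0 < h"
    have "emeasure N (polar_box c (2 * pi * h) h) = emeasure M (polar_box c (2 * pi * h) h \<inter> S)"
      unfolding N_def using box Sm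
      by (subst emeasure_density) (auto simp: Int_commute indicator_inter_arith[symmetric] intro!: nn_integral_indicator)
    also have "\<dots> \<le> emeasure M (polar_box c (2 * pi * h) (min h (log_scale k)))"
    proof (intro emeasure_mono box subsetI)
      fix z assume z: "z \<in> polar_box c (2 * pi * h) h \<inter> S"
      then obtain r t where "z = of_real r * cis t" "\<bar>t - c\<bar> \<le> 2 * pi * h" "1 - h \<le> r" "0 \<le> r" "r < 1"
        unfolding polar_box_def by blast
      moreover from this have "1 - log_scale k \<le> r"
        using z by (auto simp: S_def log_shell_def norm_mult)
      ultimately show "z \<in> polar_box c (2 * pi * h) (min h (log_scale k))"
        using polar_boxI[of t c "2 * pi * h" "min h (log_scale k)" r] by simp
    qed
    also have "\<dots> \<le> ennreal (?K * h)"
      by (intro emeasure_polar_box_shell_le sets bound a K h log_scale_pos log_scale_le_1)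
    finally show "emeasure N (polar_box c (2 * pi * h) h) \<le> ennreal (?K * h)" .
  next
    show "0 \<le> ?K" using K by simp
    have half: "log_scale (Suc (Suc k)) \<le> log_scale (Suc k) / 2"
    proof -
      have "log_scale (Suc (Suc k)) = log_scale (Suc k) * exp (- (2 ^ Suc k))"
        by (simp add: log_scale_def flip: exp_add)
      also have "\<dots> \<le> log_scale (Suc k) * (1 / 2)"
      proof (intro mult_left_mono)
        have "(1::real) \<le> 2 ^ Suc k" by (rule one_le_power) simp
        then have "2 \<le> exp (2 ^ Suc k :: real)" using exp_ge_add_one_self[of "2 ^ Suc k :: real"] by linarith
        then show "exp (- (2 ^ Suc k)) \<le> (1 / 2 :: real)" by (simp add: exp_minus field_simps)
      qed (use log_scale_pos[of "Suc k"] in simp)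
      finally show ?thesis by simp
    qed
    show "AE z in N. 1 - ?R \<le> (1 - norm z) / 2"
      unfolding N_def
    proof (subst AE_density)
      show "AE z in M. 0 < (indicator S z :: ennreal) \<longrightarrow> 1 - ?R \<le> (1 - norm z) / 2"
        using half by (intro AE_I2) (auto simp: indicator_def S_def log_shell_def)
    qed simp
    have "log_scale (Suc (Suc k)) \<le> exp (- 3)"
      unfolding log_scale_def by (subst exp_le_cancel_iff) simp
    also have "exp (- 3) \<le> (1 / 4 :: real)"
      using exp_ge_add_one_self[of "3::real"] by (simp add: exp_minus field_simps)
    finally show "3 / 4 \<le> ?R" by simp
    show "?R < 1" using log_scale_pos by simp
  qed
  also have "(\<integral>\<^sup>+z. ennreal (norm (f z) powr p) \<partial>N) = (\<integral>\<^sup>+z. ennreal (norm (f z) powr p) * indicator (log_shell k) z \<partial>M)"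
  proof -
    have "(\<integral>\<^sup>+z. ennreal (norm (f z) powr p) \<partial>N) = (\<integral>\<^sup>+z. indicator S z * ennreal (norm (f z) powr p) \<partial>M)"
      unfolding N_def by (rule nn_integral_density) measurable
    also have "\<dots> = (\<integral>\<^sup>+z. ennreal (norm (f z) powr p) * indicator (log_shell k) z \<partial>M)"
      by (intro nn_integral_cong) (auto simp: S_def space indicator_def)
    finally show ?thesis .
  qed
  also have "?K = 2 * K * 2 powr (- (real k * a))"
    by (simp add: log_scale_def powr_powr flip: powr_realpow)
  finally show ?thesis by (simp add: mult_ac)
qed

lemma power2_powr_half: "0 \<le> x \<Longrightarrow> (x\<^sup>2) powr (p / 2) = x powr p" for x p :: real
  using powr_powr[of x 2 "p / 2"] by simp

text \<open>
  Removes the regularisation on the right-hand side of \<open>dyadic_log_means_le\<close>, up to a term that vanishes with \<open>e\<close>.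
\<close>

lemma area_bound_of_smooth_means:
  assumes f: "f holomorphic_on ball 0 1" and p: "2 < p" and e: "0 < e" and r: "0 \<le> r" "r < 1"
  shows "ennreal (circle_integral (smooth_power e (p / 2) f) 0
      + integral {0..r} (\<lambda>s. (1 - s) powr (p - 1) * circle_integral (smooth_power e (p / 2) (deriv f)) s * s))
    \<le> ennreal (5 * pi * 2 powr (p / 2)) * dirichlet_norm_powr p f + ennreal (4 * pi * 2 powr (p / 2) * e powr (p / 2))"
proof -
  let ?q = "p / 2"
  let ?c = "2 powr ?q * (2 * pi * e powr ?q)"
  have f': "deriv f holomorphic_on ball 0 1"
    using f by (intro holomorphic_deriv) auto
  have pw: "smooth_power e ?q h z \<le> 2 powr ?q * (e powr ?q + norm (h z) powr p)" for h z
  proof -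
    have "smooth_power e ?q h z \<le> 2 powr ?q * (e powr ?q + ((norm (h z))\<^sup>2) powr ?q)"
      unfolding smooth_power_def using e p by (intro sum_powr_le_powr_mult) auto
    also have "((norm (h z))\<^sup>2) powr ?q = norm (h z) powr p"
      by (rule power2_powr_half) simp
    finally show ?thesis .
  qed
  have const: "((\<lambda>_. c) has_integral b * c) {0..b}" if "0 \<le> b" for b c :: real
    using has_integral_const_real[of c 0 b] that by simp
  define m where "m = (\<lambda>s. integral {0..2 * pi} (\<lambda>t. norm (deriv f (of_real s * cis t)) powr p))"
  let ?err = "4 * pi * 2 powr ?q * e powr ?q"
  let ?k = "\<lambda>s. (1 - s) powr (p - 1) * m s * s"
  define v where "v = circle_integral (smooth_power e ?q (deriv f))"
  have cb: "continuous_on (ball 0 1) (\<lambda>z. norm (deriv f z) powr p)"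
    using p f' by (intro continuous_on_powr' continuous_intros holomorphic_on_imp_continuous_on) auto
  have cv: "continuous_on {0..r} v"
    unfolding v_def using r by (intro continuous_on_circle_integral_Icc continuous_on_smooth_power f' e) auto
  have cm: "continuous_on {0..r} m"
    using continuous_on_circle_integral_Icc[OF cb, of 0 r] r by (simp add: m_def circle_integral_def[abs_def])
  have v_le: "v s \<le> 2 powr ?q * (2 * pi * e powr ?q + m s)" if "\<bar>s\<bar> < 1" for s
  proof -
    have "v s \<le> circle_integral (\<lambda>z. 2 powr ?q * (e powr ?q + norm (deriv f z) powr p)) s"
      unfolding v_def using that by (intro circle_integral_mono continuous_on_smooth_power f' e pw continuous_intros cb)
    also have "\<dots> = 2 powr ?q * (2 * pi * e powr ?q + m s)"
    proof -
      have "((\<lambda>t. 2 powr ?q * (e powr ?q + norm (deriv f (of_real s * cis t)) powr p)) has_integral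
          2 powr ?q * (2 * pi * e powr ?q + m s)) {0..2 * pi}"
        unfolding m_def
        by (intro has_integral_mult_right has_integral_add integrable_integral integrable_continuous_real
            continuous_on_circle cb that const) simp
      from integral_unique[OF this] show ?thesis by (simp only: circle_integral_def)
    qed
    finally show ?thesis .
  qed
  have m0: "0 \<le> m s" if "\<bar>s\<bar> < 1" for s
    unfolding m_def using that by (intro integral_nonneg integrable_continuous_real continuous_on_circle cb) auto
  let ?J = "integral {0..r} (\<lambda>s. (1 - s) powr (p - 1) * m s * s)"
  have J0: "0 \<le> ?J"
    using r m0 p by (intro integral_nonneg integrable_continuous_real continuous_intros continuous_on_powr' cm) auto
  have "integral {0..r} (\<lambda>s. (1 - s) powr (p - 1) * v s * s)
      \<le> integral {0..r} (\<lambda>s. ?c + 2 powr ?q * (?k s))"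
  proof (rule integral_le)
    show "(\<lambda>s. (1 - s) powr (p - 1) * v s * s) integrable_on {0..r}"
      using r p by (intro integrable_continuous_real continuous_intros continuous_on_powr' cv) auto
    show "(\<lambda>s. ?c + 2 powr ?q * (?k s)) integrable_on {0..r}"
      using r p by (intro integrable_continuous_real continuous_intros continuous_on_powr' cm) auto
    fix s assume s: "s \<in> {0..r}"
    have w: "0 \<le> (1 - s) powr (p - 1) * s" "(1 - s) powr (p - 1) * s \<le> 1"
      using s r p by (auto intro!: mult_le_one powr_le1)
    have "(1 - s) powr (p - 1) * v s * s = ((1 - s) powr (p - 1) * s) * v s" by simp
    also have "\<dots> \<le> ((1 - s) powr (p - 1) * s) * (2 powr ?q * (2 * pi * e powr ?q + m s))"
      using s r by (intro mult_left_mono w v_le) auto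
    also have "\<dots> = ((1 - s) powr (p - 1) * s) * (?c) + 2 powr ?q * (?k s)"
      by (simp add: algebra_simps)
    also have "\<dots> \<le> 1 * (?c) + 2 powr ?q * (?k s)"
      by (intro add_right_mono mult_right_mono w) auto
    finally show "(1 - s) powr (p - 1) * v s * s \<le> ?c + 2 powr ?q * (?k s)"
      by simp
  qed
  also have "\<dots> = r * (?c) + 2 powr ?q * ?J"
  proof (rule integral_unique)
    show "((\<lambda>s. ?c + 2 powr ?q * (?k s)) has_integral
        r * (?c) + 2 powr ?q * ?J) {0..r}"
      using r p
      by (intro has_integral_add has_integral_mult_right integrable_integral integrable_continuous_real continuous_intros
          continuous_on_powr' cm const) auto
  qed
  also have "\<dots> \<le> 1 * (?c) + 2 powr ?q * ?J"
    using r by (intro add_right_mono mult_right_mono) auto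
  finally have I: "integral {0..r} (\<lambda>s. (1 - s) powr (p - 1) * v s * s) \<le> ?c + 2 powr ?q * ?J"
    by simp
  have "circle_integral (smooth_power e ?q f) 0 = 2 * pi * smooth_power e ?q f 0"
    by (simp add: circle_integral_def)
  also have "\<dots> \<le> 2 * pi * (2 powr ?q * (e powr ?q + norm (f 0) powr p))"
    by (intro mult_left_mono pw) simp
  finally have "circle_integral (smooth_power e ?q f) 0 + integral {0..r} (\<lambda>s. (1 - s) powr (p - 1) * v s * s)
      \<le> 2 powr ?q * (2 * pi * norm (f 0) powr p + ?J) + ?err"
    using I by (simp add: algebra_simps)
  also have "\<dots> \<le> 2 powr ?q * (5 * pi * norm (f 0) powr p + ?J) + ?err"
    by (intro add_right_mono mult_left_mono mult_right_mono) auto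
  finally have "ennreal (circle_integral (smooth_power e ?q f) 0 + integral {0..r} (\<lambda>s. (1 - s) powr (p - 1) * v s * s))
      \<le> ennreal (2 powr ?q * (5 * pi * norm (f 0) powr p + ?J) + ?err)"
    by (rule ennreal_leI)
  also have "\<dots> = ennreal (2 powr ?q) * (ennreal (5 * pi) * ennreal (norm (f 0) powr p) + ennreal ?J) + ennreal (?err)"
    using J0 by (simp add: ennreal_plus ennreal_mult)
  also have "\<dots> \<le> ennreal (2 powr ?q) * (ennreal (5 * pi) * ennreal (norm (f 0) powr p)
        + ennreal (5 * pi) * (\<integral>\<^sup>+z\<in>ball 0 1. ennreal (norm (deriv f z) powr p * (1 - (norm z)\<^sup>2) powr (p - 1)) \<partial>area_measure))
      + ennreal (?err)"
    unfolding m_def using p r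
    by (intro add_mono mult_left_mono radial_integral_le_area_integral f' order_refl) auto
  also have "\<dots> = ennreal (5 * pi * 2 powr ?q) * dirichlet_norm_powr p f + ennreal (?err)"
  proof -
    have "ennreal (5 * pi * 2 powr ?q) = ennreal (2 powr ?q) * ennreal (5 * pi)"
      by (subst ennreal_mult[symmetric]) (auto simp: mult.commute)
    then show ?thesis unfolding dirichlet_norm_powr_def
      by (simp only: distrib_left mult.assoc add.commute)
  qed
  finally show ?thesis by (simp only: v_def)
qed

lemma ennreal_le_of_quotient_le:
  fixes x :: ennreal
  assumes "x / ennreal w \<le> s" "0 < w"
  shows "x \<le> s * ennreal w"
proof -
  have "x = x / ennreal w * ennreal w"
    using assms(2) by (simp add: ennreal_divide_times ennreal_mult_divide_eq)
  also have "\<dots> \<le> s * ennreal w" using assms(1) by (rule mult_right_mono) simp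
  finally show ?thesis .
qed

theorem theorem5:
  fixes p :: real and \<mu> :: "complex measure"
  assumes "2 < p"
    and "borel_measure_on_disc \<mu>"
    and "(SUP I \<in> {I. circle_arc I}.
            emeasure \<mu> (carleson_square I)
              / ennreal (arc_length I * (ln (exp 1 / arc_length I)) powr (- p / 2 + 1))) < \<infinity>"
  shows "p_carleson_measure p \<mu>"
proof -
  define q a where "q = p / 2" and "a = q - 1"
  have q: "1 < q" and a: "0 \<le> a" using assms(1) by (auto simp: q_def a_def)
  have sets: "sets \<mu> = sets (restrict_space borel (ball 0 1))"
    using assms(2) by (simp add: borel_measure_on_disc_def)
  have space: "space \<mu> = ball 0 1" using sets_eq_imp_space_eq[OF sets] by (simp add: space_restrict_space)
  obtain B where B: "0 \<le> B" "(SUP I \<in> {I. circle_arc I}.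
            emeasure \<mu> (carleson_square I)
              / ennreal (arc_length I * (ln (exp 1 / arc_length I)) powr (- p / 2 + 1))) = ennreal B"
    using assms(3) by (cases rule: ennreal_cases) auto
  have arc: "emeasure \<mu> (carleson_square I) \<le> ennreal (B * (arc_length I * ln (exp 1 / arc_length I) powr (- a)))"
    if I: "circle_arc I" for I
  proof -
    let ?w = "arc_length I * ln (exp 1 / arc_length I) powr (- a)"
    have l: "0 < arc_length I" "arc_length I \<le> 1" using I arc_length_le_1 by (auto simp: circle_arc_def)
    have "ln (exp 1 / arc_length I) = 1 - ln (arc_length I)" using l by (simp add: ln_div)
    then have "0 < ln (exp 1 / arc_length I)" using l ln_le_zero_iff[of "arc_length I"] by linarith
    then have w: "0 < ?w" using l by simp
    have "- p / 2 + 1 = - a" by (simp add: a_def q_def)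
    then have "emeasure \<mu> (carleson_square I) / ennreal ?w \<le> ennreal B"
      using B(2) SUP_upper[of I "{I. circle_arc I}" "\<lambda>I. emeasure \<mu> (carleson_square I)
              / ennreal (arc_length I * (ln (exp 1 / arc_length I)) powr (- p / 2 + 1))"] I by simp
    from ennreal_le_of_quotient_le[OF this w] show ?thesis
      using B(1) w by (simp add: ennreal_mult)
  qed
  define K where "K = 6 * 3 powr a * B"
  have K: "0 \<le> K" using B by (simp add: K_def)
  have box: "emeasure \<mu> (polar_box c (2 * pi * h) h) \<le> ennreal (K * h * (1 - ln h) powr (- a))"
    if "0 < h" "h \<le> 1" for c h
    unfolding K_def by (rule emeasure_polar_box_le[OF sets arc a B(1) that])
  obtain C where C: "0 < C" "\<And>f e N. f holomorphic_on ball 0 1 \<Longrightarrow> 0 < e \<Longrightarrow>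
      (\<Sum>n\<le>N. 2 powr (- (real n * (q - 1))) * circle_integral (smooth_power e q f) (1 - log_scale (Suc n)))
      \<le> C * (circle_integral (smooth_power e q f) 0
          + integral {0..1 - log_scale (Suc N)} (\<lambda>s. (1 - s) powr (2 * q - 1) * circle_integral (smooth_power e q (deriv f)) s * s))"
    using dyadic_log_means_le[OF q] by blast
  define A where "A = 80 * 2 powr p * (K + 1) * 2 powr a"
  have A: "0 < A" using K by (simp add: A_def)
  define D where "D = A * C * (5 * pi * 2 powr q)"
  have D: "0 < D" using A C by (simp add: D_def)
  have main: "(\<integral>\<^sup>+z. ennreal (norm (f z) powr p) \<partial>\<mu>) \<le> ennreal D * dirichlet_norm_powr p f"
    if f: "f holomorphic_on ball 0 1" for f
  proof -
    define S where "S = (\<lambda>k. \<integral>\<^sup>+z. ennreal (norm (f z) powr p) * indicator (log_shell k) z \<partial>\<mu>)"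
    have part_e: "(\<Sum>k\<le>N. S k) \<le> ennreal D * dirichlet_norm_powr p f + ennreal (A * C * (4 * pi * 2 powr q * e powr q))"
      if e: "0 < e" for e N
    proof -
      define u where "u = circle_integral (smooth_power e q f)"
      let ?I = "integral {0..1 - log_scale (Suc (Suc N))} (\<lambda>s. (1 - s) powr (2 * q - 1) * circle_integral (smooth_power e q (deriv f)) s * s)"
      have R: "\<bar>1 - log_scale k\<bar> < 1" for k using log_scale_pos[of k] log_scale_le_1[of k] by auto
      have u0: "0 \<le> u (1 - log_scale k)" for k
        unfolding u_def by (intro less_imp_le circle_integral_pos continuous_on_smooth_power f e R smooth_power_pos)
      have shell: "S k \<le> ennreal (A * (2 powr (- (real (Suc k) * a)) * u (1 - log_scale (Suc (Suc k)))))" for k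
      proof -
        let ?n = "integral {0..2 * pi} (\<lambda>t. norm (f (of_real (1 - log_scale (Suc (Suc k))) * cis t)) powr p)"
        have "S k \<le> ennreal (80 * 2 powr p * K * 2 powr (- (real k * a))
            * ?n)"
          unfolding S_def using assms(1) by (intro shell_embedding sets box a K f) auto
        also have "\<dots> \<le> ennreal (80 * 2 powr p * (K + 1) * 2 powr (- (real k * a)) * u (1 - log_scale (Suc (Suc k))))"
        proof (intro ennreal_leI mult_mono mult_right_mono)
          have "circle_integral (\<lambda>z. norm (f z) powr p) (1 - log_scale (Suc (Suc k))) \<le> u (1 - log_scale (Suc (Suc k)))"
            unfolding u_def
          proof (rule circle_integral_mono[OF _ _ R])
            show "continuous_on (ball 0 1) (\<lambda>z. norm (f z) powr p)"
              using assms(1) f by (intro continuous_on_powr' continuous_intros holomorphic_on_imp_continuous_on) auto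
            show "norm (f z) powr p \<le> smooth_power e q f z" for z
            proof -
              have "norm (f z) powr p = ((norm (f z))\<^sup>2) powr q"
                unfolding q_def by (rule power2_powr_half[symmetric]) simp
              also have "\<dots> \<le> smooth_power e q f z"
                unfolding smooth_power_def using e q by (intro powr_mono2) auto
              finally show ?thesis .
            qed
          qed (intro continuous_on_smooth_power f e)
          then show "?n \<le> u (1 - log_scale (Suc (Suc k)))"
            by (simp add: circle_integral_def)
          show "0 \<le> ?n"
            using assms(1) R[of "Suc (Suc k)"]
            by (intro integral_nonneg integrable_continuous_real continuous_on_powr' continuous_intros
                continuous_on_circle holomorphic_on_imp_continuous_on[OF f]) auto
        qed (use K in auto)
        also have "80 * 2 powr p * (K + 1) * 2 powr (- (real k * a)) = A * 2 powr (- (real (Suc k) * a))"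
        proof -
          have "2 powr (- (real k * a)) = 2 powr a * 2 powr (- (real (Suc k) * a))"
            unfolding powr_add[symmetric] by (simp add: algebra_simps)
          then show ?thesis by (simp add: A_def)
        qed
        finally show ?thesis by (simp add: mult.assoc)
      qed
      have "(\<Sum>k\<le>N. S k) \<le> (\<Sum>k\<le>N. ennreal (A * (2 powr (- (real (Suc k) * a)) * u (1 - log_scale (Suc (Suc k))))))"
        by (intro sum_mono shell)
      also have "\<dots> = ennreal (\<Sum>k\<le>N. A * (2 powr (- (real (Suc k) * a)) * u (1 - log_scale (Suc (Suc k)))))"
        using A u0 by (intro sum_ennreal) auto
      also have "\<dots> \<le> ennreal (A * (\<Sum>n\<le>Suc N. 2 powr (- (real n * a)) * u (1 - log_scale (Suc n))))"
        unfolding sum.atMost_Suc_shift[of _ N] using A u0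
        by (intro ennreal_leI) (simp add: sum_distrib_left distrib_left)
      also have "\<dots> \<le> ennreal (A * (C * (u 0 + ?I)))"
        unfolding u_def a_def using A by (intro ennreal_leI mult_left_mono C(2) f e) auto
      also have "\<dots> = ennreal (A * C) * ennreal (u 0 + ?I)"
        using A C by (simp add: ennreal_mult'[symmetric] mult.assoc)
      also have "\<dots> \<le> ennreal (A * C) * (ennreal (5 * pi * 2 powr q) * dirichlet_norm_powr p f + ennreal (4 * pi * 2 powr q * e powr q))"
      proof (intro mult_left_mono)
        have "2 * q = p" by (simp add: q_def)
        then show "ennreal (u 0 + ?I)
          \<le> ennreal (5 * pi * 2 powr q) * dirichlet_norm_powr p f + ennreal (4 * pi * 2 powr q * e powr q)"
          unfolding u_def q_def
          using area_bound_of_smooth_means[OF f assms(1) e, of "1 - log_scale (Suc (Suc N))"] log_scale_pos[of "Suc (Suc N)"] log_scale_le_1[of "Suc (Suc N)"]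
          by simp
      qed simp
      also have "\<dots> = ennreal D * dirichlet_norm_powr p f + ennreal (A * C * (4 * pi * 2 powr q * e powr q))"
        unfolding D_def using A C by (simp add: distrib_left ennreal_mult mult.assoc)
      finally show ?thesis .
    qed
    have part: "(\<Sum>k\<le>N. S k) \<le> ennreal D * dirichlet_norm_powr p f" for N
    proof (rule ennreal_le_epsilon)
      fix \<epsilon> :: real assume \<epsilon>: "0 < \<epsilon>"
      \<comment> \<open>The regularisation parameter is chosen such that its contribution is exactly the given error.\<close>
      define c where "c = A * C * (4 * pi * 2 powr q)"
      have c: "0 < c" using A C by (simp add: c_def)
      have "A * C * (4 * pi * 2 powr q * ((\<epsilon> / c) powr (1 / q)) powr q) = c * (\<epsilon> / c)"
        using c \<epsilon> q by (simp add: c_def powr_powr)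
      also have "\<dots> = \<epsilon>" using c by simp
      finally show "(\<Sum>k\<le>N. S k) \<le> ennreal D * dirichlet_norm_powr p f + ennreal \<epsilon>"
        using part_e[of "(\<epsilon> / c) powr (1 / q)" N] c \<epsilon> by simp
    qed
    have fm[measurable]: "f \<in> borel_measurable \<mu>"
      by (rule holomorphic_borel_measurable[OF sets f])
    have Sm: "log_shell k \<inter> space \<mu> \<in> sets \<mu>" for k
      unfolding sets space using log_shell_borel by (simp add: sets_restrict_space_iff)
    have "(\<integral>\<^sup>+z. ennreal (norm (f z) powr p) \<partial>\<mu>) \<le> (\<integral>\<^sup>+z. (\<Sum>k. ennreal (norm (f z) powr p) * indicator (log_shell k) z) \<partial>\<mu>)"
    proof (rule nn_integral_mono)
      fix z assume "z \<in> space \<mu>"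
      then have "0 < 1 - norm z" "1 - norm z \<le> 1" by (auto simp: space)
      then obtain k where k: "log_scale (Suc k) < 1 - norm z" "1 - norm z \<le> log_scale k" by (rule exists_log_scale)
      have "ennreal (norm (f z) powr p) = (\<Sum>j\<in>{k}. ennreal (norm (f z) powr p) * indicator (log_shell j) z)"
        using k by (simp add: log_shell_def)
      also have "\<dots> \<le> (\<Sum>k. ennreal (norm (f z) powr p) * indicator (log_shell k) z)"
        by (rule sum_le_suminf) auto
      finally show "ennreal (norm (f z) powr p) \<le> (\<Sum>k. ennreal (norm (f z) powr p) * indicator (log_shell k) z)" .
    qed
    also have "\<dots> = (\<Sum>k. S k)"
      unfolding S_def
    proof (rule nn_integral_suminf)
      fix k
      have "(\<lambda>z. ennreal (norm (f z) powr p) * indicator (log_shell k \<inter> space \<mu>) z) \<in> borel_measurable \<mu>"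
        using Sm[of k] by measurable
      then show "(\<lambda>z. ennreal (norm (f z) powr p) * indicator (log_shell k) z) \<in> borel_measurable \<mu>"
        by (rule measurable_cong[THEN iffD1, rotated]) (simp add: indicator_def)
    qed
    also have "\<dots> \<le> ennreal D * dirichlet_norm_powr p f"
      unfolding suminf_eq_SUP
    proof (rule SUP_least)
      fix n
      have "sum S {..<n} \<le> sum S {..n}" by (intro sum_mono2) auto
      also have "\<dots> \<le> ennreal D * dirichlet_norm_powr p f" by (rule part)
      finally show "sum S {..<n} \<le> ennreal D * dirichlet_norm_powr p f" .
    qed
    finally show ?thesis .
  qed
  show ?thesis
    unfolding p_carleson_measure_def
    using D main by (intro exI[of _ D]) (auto simp: dirichlet_space_def)
qed

end
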